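(* Let $n\in\mathbb{N}$, $1<p<n$ and $p^{\ast}=\frac{pn}{n-p}$. Suppose $a,b\in\mathbb{R}$ are such that for every $u\in W^{1,p}(\mathbb{S}^n)$ satisfying $$\int_{\mathbb{S}^n}f|u|^{p^{\ast}}\,d\mu=0\quad\text{for all } f\in\overset{\circ}{\mathcal{P}}_2,$$ one has $$\|u\|_{L^{p^{\ast}}(\mathbb{S}^n)}^p\le a\|\nabla u\|_{L^p(\mathbb{S}^n)}^p+b\|u\|_{L^p(\mathbb{S}^n)}^p.$$ Then $$a\ge\frac{S_{n,p}^p}{(n+2)^{\frac pn}},$$ where $$S_{n,p}=\frac1n\left(\frac{n(p-1)}{n-p}\right)^{1-\frac1p}\left(\frac{n!}{\Gamma\left(\frac np\right)\Gamma\left(n+1-\frac np\right)|\mathbb{S}^{n-1}|}\right)^{\frac1n}.$$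
   Context: $\mathbb{S}^n\subset\mathbb{R}^{n+1}$ is the unit sphere with its standard metric and $\mu$ is the associated (standard) measure; functions are real-valued. $\overset{\circ}{\mathcal{P}}_2$ is the set of all polynomials $f$ on $\mathbb{R}^{n+1}$ of degree at most $2$ with $\int_{\mathbb{S}^n}f\,d\mu=0$. $|\mathbb{S}^{n-1}|$ is the surface measure of $\mathbb{S}^{n-1}$ and $\Gamma$ is the Gamma function. *)

theory Defs
  imports "HOL-Analysis.Analysis"
begin

section \<open>The standard measure of the unit sphere\<close>

text \<open>
  The surface measure of a Borel set \<open>A\<close> of the unit sphere is the dimension of the ambient space
  times the Lebesgue measure of the cone \<open>{t *\<^sub>R x | x t. x \<in> A \<and> 0 < t \<and> t < 1}\<close>, which is the
  preimage of \<open>A\<close> under \<open>x \<mapsto> x / norm x\<close> (\<open>sgn\<close>) in the punctured unit ball.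
\<close>

definition sphere_measure :: "'a::euclidean_space measure" where
  "sphere_measure = scale_measure (of_nat DIM('a))
     (distr (restrict_space lborel (ball 0 1 - {0})) (restrict_space borel (sphere 0 1)) sgn)"

lemma space_sphere_measure [simp]: "space (sphere_measure :: 'a::euclidean_space measure) = sphere 0 1"
  by (simp add: sphere_measure_def space_scale_measure space_restrict_space)

lemma sets_sphere_measure [measurable_cong]:
  "sets (sphere_measure :: 'a::euclidean_space measure) = sets (restrict_space borel (sphere 0 1))"
  by (simp add: sphere_measure_def)

lemma measurable_sgn_sphere:
  "sgn \<in> restrict_space lborel (ball 0 1 - {0 :: 'a::euclidean_space})
     \<rightarrow>\<^sub>M restrict_space borel (sphere 0 1)"
proof (rule measurable_restrict_space2)
  show "sgn \<in> space (restrict_space lborel (ball 0 1 - {0 :: 'a})) \<rightarrow> sphere 0 1"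
    by (auto simp: space_restrict_space norm_sgn)
  show "sgn \<in> borel_measurable (restrict_space lborel (ball 0 1 - {0 :: 'a}))"
    unfolding sgn_div_norm by (rule measurable_restrict_space1) measurable
qed

text \<open>
  The total mass is the classical surface area: \<open>unit_ball_vol\<close> is the volume of the unit ball.
\<close>

lemma emeasure_sphere_measure:
  "emeasure (sphere_measure :: 'a::euclidean_space measure) (sphere 0 1)
     = ennreal (DIM('a) * unit_ball_vol DIM('a))"
proof -
  have *: "emeasure lborel (ball 0 1 - {0 :: 'a}) = ennreal (unit_ball_vol DIM('a))"
    by (subst emeasure_Diff) (auto simp: emeasure_ball)
  have "emeasure (sphere_measure :: 'a measure) (sphere 0 1)
      = of_nat DIM('a) * emeasure (restrict_space lborel (ball 0 1 - {0 :: 'a})) (ball 0 1 - {0})"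
    unfolding sphere_measure_def emeasure_scale_measure
    by (subst emeasure_distr[OF measurable_sgn_sphere])
       (auto simp: sets_restrict_space space_restrict_space norm_sgn
             intro!: arg_cong2[where f = "(*)"] arg_cong2[where f = emeasure])
  also have "\<dots> = of_nat DIM('a) * emeasure lborel (ball 0 1 - {0 :: 'a})"
    by (subst emeasure_restrict_space) auto
  finally show ?thesis
    by (simp add: * ennreal_mult ennreal_of_nat_eq_real_of_nat)
qed

section \<open>Lebesgue spaces\<close>

definition Lp_space :: "'a measure \<Rightarrow> real \<Rightarrow> ('a \<Rightarrow> 'b::euclidean_space) set" where
  "Lp_space M q = {g \<in> borel_measurable M. integrable M (\<lambda>x. norm (g x) powr q)}"

definition Lp_norm :: "'a measure \<Rightarrow> real \<Rightarrow> ('a \<Rightarrow> 'b::euclidean_space) \<Rightarrow> real" where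
  "Lp_norm M q g = (LINT x|M. norm (g x) powr q) powr (1 / q)"

section \<open>The Sobolev space of the sphere\<close>

text \<open>
  \<open>C\<^sup>\<infinity>\<close> maps: \<open>D [v\<^sub>k, \<dots>, v\<^sub>1]\<close> is the iterated directional derivative of \<open>X\<close> along \<open>v\<^sub>1, \<dots>, v\<^sub>k\<close>.
\<close>

definition smooth_map :: "('a::euclidean_space \<Rightarrow> 'b::euclidean_space) \<Rightarrow> bool" where
  "smooth_map X \<longleftrightarrow>
     (\<exists>D. D [] = X \<and> (\<forall>vs x. (D vs has_derivative (\<lambda>v. D (v # vs) x)) (at x)))"

text \<open>
  Every smooth vector field on the sphere is the restriction of a smooth map on the ambient space.
\<close>

definition smooth_tangent_field :: "('a::euclidean_space \<Rightarrow> 'a) \<Rightarrow> bool" where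
  "smooth_tangent_field X \<longleftrightarrow> smooth_map X \<and> (\<forall>x\<in>sphere 0 1. x \<bullet> X x = 0)"

text \<open>
  The Riemannian divergence at \<open>x\<close> is the trace of the derivative of \<open>X\<close> over the tangent space,
  the orthogonal complement of \<open>x\<close>, i.e. the full trace minus the normal contribution.
\<close>

definition sphere_div :: "('a::euclidean_space \<Rightarrow> 'a) \<Rightarrow> 'a \<Rightarrow> real" where
  "sphere_div X x = (\<Sum>e\<in>Basis. frechet_derivative X (at x) e \<bullet> e)
                      - frechet_derivative X (at x) x \<bullet> x"

text \<open>
  \<open>sobolev_gradient p u G\<close>: \<open>u \<in> W\<^sup>1\<^sup>,\<^sup>p\<close> with weak gradient \<open>G\<close>, which is unique almost everywhere.
\<close>

definition sobolev_gradient :: "real \<Rightarrow> ('a::euclidean_space \<Rightarrow> real) \<Rightarrow> ('a \<Rightarrow> 'a) \<Rightarrow> bool" where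
  "sobolev_gradient p u G \<longleftrightarrow>
     u \<in> Lp_space sphere_measure p \<and>
     G \<in> Lp_space sphere_measure p \<and>
     (AE x in sphere_measure. x \<bullet> G x = 0) \<and>
     (\<forall>X. smooth_tangent_field X \<longrightarrow>
        (LINT x|sphere_measure. u x * sphere_div X x) = - (LINT x|sphere_measure. G x \<bullet> X x))"

section \<open>Polynomials\<close>

definition polynomials_le :: "nat \<Rightarrow> (real ^ 'm \<Rightarrow> real) set" where
  "polynomials_le d = {f. \<exists>c. f = (\<lambda>x.
     \<Sum>k | sum k UNIV \<le> d. c k * (\<Prod>i\<in>UNIV. x $ i ^ k i))}"

definition mean_zero_polynomials_le :: "nat \<Rightarrow> (real ^ 'm \<Rightarrow> real) set" where
  "mean_zero_polynomials_le d = {f \<in> polynomials_le d. (LINT x|sphere_measure. f x) = 0}"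

text \<open>The index set of the monomials is finite, so the sum above is a genuine one.\<close>

lemma finite_bounded_multidegree: "finite {k :: 'm::finite \<Rightarrow> nat. sum k UNIV \<le> d}"
proof (rule finite_subset)
  show "{k :: 'm \<Rightarrow> nat. sum k UNIV \<le> d} \<subseteq> (UNIV \<rightarrow>\<^sub>E {..d})"
  proof
    fix k :: "'m \<Rightarrow> nat"
    assume "k \<in> {k. sum k UNIV \<le> d}"
    then have "sum k UNIV \<le> d"
      by simp
    then have "k i \<le> d" for i
      using member_le_sum[of i UNIV k] by simp
    then show "k \<in> (UNIV \<rightarrow>\<^sub>E {..d})"
      by (simp add: PiE_iff)
  qed
  show "finite ((UNIV :: 'm set) \<rightarrow>\<^sub>E {..d})"
    by (rule finite_PiE) auto
qed

end

theory Submission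
  imports Defs
begin

text \<open>
  The test functions are sums of \<open>n + 2\<close> equal bubbles, centred at the vertices \<open>v\<^sub>k\<close> of a regular
  simplex inscribed in the sphere:
  \<open>u x = (\<Sum>k. h (\<rho> * norm (x - v\<^sub>k)))\<close> with a scale \<open>\<rho>\<close> tending to infinity,
  where \<open>h\<close> is a radial profile with compact support, so that for large \<open>\<rho>\<close> the bubbles have disjoint
  supports.  The vertices of a regular simplex form a design of degree two, and each bubble is
  invariant under the rotations fixing its centre; hence \<open>\<bar>u\<bar>\<^sup>q d\<mu>\<close> integrates polynomials of degree at
  most two like a multiple of \<open>\<mu>\<close> (\<open>simplex_quadrature\<close>).  The moment conditions therefore hold exactly
  and for every profile, and no perturbation of \<open>u\<close> is needed.

  By disjointness the integrals of \<open>\<bar>u\<bar>\<^sup>q\<close>, \<open>\<bar>\<nabla>u\<bar>\<^sup>p\<close> and \<open>\<bar>u\<bar>\<^sup>p\<close> are \<open>n + 2\<close> times those of one bubble.  As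
  \<open>\<rho> \<rightarrow> \<infinity>\<close> a bubble sees only the tangent space at its centre: \<open>\<rho>\<^sup>n\<close> times the sphere integral of
  \<open>\<Phi> (\<rho> * norm (x - v))\<close> tends to the integral of the radial function \<open>\<Phi>\<close> over Euclidean \<open>n\<close>-space
  (\<open>sphere_concentration\<close>).  After rescaling, the term with \<open>b\<close> carries a factor \<open>\<rho>\<^sup>-\<^sup>p\<close> and disappears, and
  there remains
  \<open>((n + 2) * \<integral>\<bar>h\<bar>\<^sup>q)\<^sup>p\<^sup>/\<^sup>q \<le> max a 0 * (n + 2) * \<integral>\<bar>h'\<bar>\<^sup>p\<close>
  with Euclidean radial integrals (\<open>simplex_test_inequality\<close>).  The maximum with \<open>0\<close> serves because
  only an upper bound for the gradient is used, while the sign of \<open>a\<close> is not known beforehand.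

  Finally \<open>h\<close> runs through \<open>C\<^sup>1\<close> truncations of the extremal \<open>(1 + r\<^sup>k)\<^sup>-\<^sup>\<gamma>\<close>, \<open>k = p / (p - 1)\<close> and
  \<open>\<gamma> = (n - p) / p\<close>, of the Euclidean Sobolev inequality.  Its two integrals are Beta integrals
  (\<open>integral_bubble\<close>), and combine to the constant \<open>S\<^sup>p\<close>.  Since \<open>p / q = 1 - p / n\<close>, the powers
  of \<open>n + 2\<close> combine to the factor \<open>(n + 2)\<^sup>-\<^sup>p\<^sup>/\<^sup>n\<close>.

  That \<open>u\<close> has the expected weak gradient is an integration by parts on the sphere, which follows
  from the invariance of \<open>\<mu>\<close> under rotations of the coordinate planes
  (\<open>sphere_integration_by_parts\<close>).
\<close>

section \<open>Integration over the sphere\<close>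

lemma measurable_sphere_measure:
  assumes "f \<in> borel_measurable borel"
  shows "f \<in> measurable (sphere_measure :: 'a::euclidean_space measure) borel"
  by (subst measurable_cong_sets[OF sets_sphere_measure refl]) (rule measurable_restrict_space1[OF assms])

lemma finite_measure_sphere: "finite_measure (sphere_measure :: 'a::euclidean_space measure)"
  by (rule finite_measureI) (simp add: emeasure_sphere_measure)

lemma measure_sphere:
  "measure (sphere_measure :: 'a::euclidean_space measure) (sphere 0 1) = DIM('a) * unit_ball_vol DIM('a)"
  by (simp add: measure_def emeasure_sphere_measure)

lemma measure_sphere_pos: "measure (sphere_measure :: 'a::euclidean_space measure) (sphere 0 1) > 0"
  by (simp add: measure_sphere)

lemma nn_integral_sphere_measure:
  assumes [measurable]: "f \<in> borel_measurable borel"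
  shows "(\<integral>\<^sup>+x. f x \<partial>(sphere_measure :: 'a::euclidean_space measure))
     = of_nat DIM('a) * (\<integral>\<^sup>+x. f (sgn x) * indicator (ball 0 1 - {0}) x \<partial>lborel)"
proof -
  have "f \<in> borel_measurable (restrict_space borel (sphere 0 1 :: 'a set))"
    by (rule measurable_restrict_space1) measurable
  then show ?thesis
    unfolding sphere_measure_def
    by (simp add: nn_integral_scale_measure nn_integral_distr[OF measurable_sgn_sphere] nn_integral_restrict_space)
qed

lemma integrable_sphere_measure_bounded:
  fixes f :: "'a::euclidean_space \<Rightarrow> 'b::{banach,second_countable_topology}"
  assumes "f \<in> borel_measurable borel" "\<And>x. norm x = 1 \<Longrightarrow> norm (f x) \<le> B"
  shows "integrable sphere_measure f"
  by (rule finite_measure.integrable_const_bound[OF finite_measure_sphere, where B = B])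
     (auto intro!: measurable_sphere_measure assms)

lemma continuous_bounded_on_sphere:
  fixes f :: "'a::euclidean_space \<Rightarrow> 'b::real_normed_vector"
  assumes "continuous_on UNIV f"
  obtains B where "B \<ge> 0" "\<And>x. norm x = 1 \<Longrightarrow> norm (f x) \<le> B"
proof -
  have "compact (f ` sphere 0 1)"
    by (intro compact_continuous_image continuous_on_subset[OF assms]) auto
  then have "bounded (f ` sphere 0 1)"
    by (rule compact_imp_bounded)
  then obtain B where B: "\<forall>y\<in>f ` sphere 0 1. norm y \<le> B"
    unfolding bounded_iff by blast
  show thesis
    by (rule that[of "max B 0"]) (use B in \<open>auto simp: le_max_iff_disj\<close>)
qed

lemma integrable_sphere_measure_continuous:
  fixes f :: "'a::euclidean_space \<Rightarrow> 'b::euclidean_space"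
  assumes "continuous_on UNIV f"
  shows "integrable sphere_measure f"
proof -
  obtain B where "\<And>x. norm x = 1 \<Longrightarrow> norm (f x) \<le> B"
    using continuous_bounded_on_sphere[OF assms] by blast
  then show ?thesis
    by (rule integrable_sphere_measure_bounded[OF borel_measurable_continuous_onI[OF assms]])
qed

section \<open>Orthogonal invariance\<close>

text \<open>
  A copy of a finite type, well-ordered by an arbitrary enumeration.  The change of variables formula for
  linear maps concerns vectors over a well-ordered index type; renaming the coordinates along this
  copy carries it over to every finite index type.
\<close>

typedef 'a ordered_copy = "UNIV :: 'a set" morphisms original copy_of ..

text \<open>
  The position of an element in an arbitrary but fixed enumeration of the finite type.
\<close>

definition copy_index :: "'a::finite ordered_copy \<Rightarrow> nat" where
  "copy_index x = (SOME f. inj f) (original x)"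

lemma inj_copy_index: "inj (copy_index :: 'a::finite ordered_copy \<Rightarrow> nat)"
proof -
  obtain f :: "'a \<Rightarrow> nat" where "inj f"
    using finite_imp_inj_to_nat_seg[OF finite, of UNIV] by auto
  then have "inj (SOME f :: 'a \<Rightarrow> nat. inj f)"
    by (rule someI[of "\<lambda>f. inj f"])
  then show ?thesis
    by (intro injI) (simp add: copy_index_def inj_eq original_inject)
qed

instance ordered_copy :: (finite) finite
proof
  have "(UNIV :: 'a ordered_copy set) = range copy_of"
    by (auto simp: image_iff intro: exI[of _ "original _"] original_inverse[symmetric])
  then show "finite (UNIV :: 'a ordered_copy set)"
    by (metis finite finite_imageI)
qed

instantiation ordered_copy :: (finite) wellorder
begin
definition "x \<le> y \<longleftrightarrow> copy_index x \<le> copy_index y"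
definition "x < y \<longleftrightarrow> copy_index x < copy_index y"
instance
proof
  fix P :: "'a ordered_copy \<Rightarrow> bool" and a
  assume "\<And>x. (\<And>y. y < x \<Longrightarrow> P y) \<Longrightarrow> P x"
  then show "P a"
    unfolding less_ordered_copy_def by (rule measure_induct_rule)
qed (auto simp: less_eq_ordered_copy_def less_ordered_copy_def dest: injD[OF inj_copy_index])
end

text \<open>
  The isometry that renames the coordinates, and its inverse.
\<close>

definition reindex_copy :: "real^'m \<Rightarrow> real^('m::finite ordered_copy)" where
  "reindex_copy x = (\<chi> i. x $ original i)"

definition reindex_original :: "real^('m::finite ordered_copy) \<Rightarrow> real^'m" where
  "reindex_original y = (\<chi> i. y $ copy_of i)"

lemma reindex_inverse [simp]:
  "reindex_original (reindex_copy x) = x" "reindex_copy (reindex_original y) = y"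
  by (simp_all add: reindex_copy_def reindex_original_def vec_eq_iff copy_of_inverse original_inverse)

lemma bij_original: "bij (original :: 'm ordered_copy \<Rightarrow> 'm)"
  by (rule o_bij[of copy_of]) (auto simp: fun_eq_iff original_inverse copy_of_inverse)

lemma linear_reindex: "linear reindex_copy" "linear reindex_original"
  by (auto simp: linear_iff reindex_copy_def reindex_original_def vec_eq_iff)

lemma borel_measurable_linear:
  fixes f :: "'a::euclidean_space \<Rightarrow> 'b::euclidean_space"
  assumes "linear f"
  shows "f \<in> borel_measurable borel"
  using assms by (intro borel_measurable_continuous_onI linear_continuous_on)
    (simp add: linear_conv_bounded_linear)

lemma inner_reindex_copy: "reindex_copy x \<bullet> reindex_copy y = x \<bullet> y"
  unfolding inner_vec_def reindex_copy_def
  using sum.reindex_bij_betw[OF bij_original, of "\<lambda>i. x $ i \<bullet> y $ i"] by simp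

lemma distr_lborel_reindex_copy: "distr lborel borel reindex_copy = (lborel :: (real^('m::finite ordered_copy)) measure)"
proof (rule sym, rule lborel_eqI)
  fix l u :: "real^('m ordered_copy)"
  assume lu: "\<And>b. b \<in> Basis \<Longrightarrow> l \<bullet> b \<le> u \<bullet> b"
  have prod: "(\<Prod>b\<in>Basis. h b) = (\<Prod>i\<in>UNIV. h (axis i 1))" for h :: "real^'k::finite \<Rightarrow> real"
    by (rule prod.reindex_cong[of "\<lambda>i. axis i 1"])
       (auto simp: Basis_vec_def inj_on_def axis_eq_axis)
  have vim: "reindex_copy -` box l u = box (reindex_original l) (reindex_original u)"
  proof -
    have "(\<forall>i. l $ i < x $ original i \<and> x $ original i < u $ i)
        \<longleftrightarrow> (\<forall>i. l $ copy_of i < x $ i \<and> x $ i < u $ copy_of i)" for x :: "real^'m"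
      by (metis original_inverse copy_of_inverse UNIV_I)
    then show ?thesis
      by (auto simp: mem_box_cart reindex_copy_def reindex_original_def)
  qed
  have lu': "reindex_original l \<bullet> b \<le> reindex_original u \<bullet> b" if b: "b \<in> Basis" for b
  proof -
    obtain i where "b = axis i 1"
      using b by (auto simp: Basis_vec_def)
    then show ?thesis
      using lu[of "axis (copy_of i) 1"] by (simp add: inner_axis reindex_original_def axis_in_Basis_iff)
  qed
  have "emeasure (distr lborel borel reindex_copy) (box l u)
     = emeasure lborel (box (reindex_original l) (reindex_original u))"
    by (simp add: emeasure_distr borel_measurable_linear linear_reindex vim)
  also have "\<dots> = ennreal (\<Prod>b\<in>Basis. (reindex_original u - reindex_original l) \<bullet> b)"
    using lu' by (simp add: emeasure_lborel_box)
  also have "(\<Prod>b\<in>Basis. (reindex_original u - reindex_original l) \<bullet> b) = (\<Prod>b\<in>Basis. (u - l) \<bullet> b)"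
    unfolding prod
    using prod.reindex_bij_betw[OF bij_original, of "\<lambda>i. (u - l) $ copy_of i"]
    by (simp add: inner_axis reindex_original_def original_inverse)
  finally show "emeasure (distr lborel borel reindex_copy) (box l u) = ennreal (\<Prod>b\<in>Basis. (u - l) \<bullet> b)" .
qed simp

lemma distr_lborel_orthogonal_wellorder:
  fixes T :: "real^'m::{finite,wellorder} \<Rightarrow> real^'m::_"
  assumes T: "orthogonal_transformation T"
  shows "distr lborel borel T = lborel"
proof -
  obtain T' where T': "orthogonal_transformation T'" "\<And>x. T' (T x) = x" "\<And>x. T (T' x) = x"
    using T by (metis orthogonal_transformation_inv orthogonal_transformation_inj
      orthogonal_transformation_surj inv_f_f surj_f_inv_f)
  have meas_T: "T \<in> borel_measurable borel"
    by (intro borel_measurable_linear orthogonal_transformation_linear T)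
  show ?thesis
  proof (rule sym, rule lborel_eqI)
    fix l u :: "real^'m::_"
    assume lu: "\<And>b. b \<in> Basis \<Longrightarrow> l \<bullet> b \<le> u \<bullet> b"
    have vim: "T -` box l u = T' ` box l u"
      using T' by (auto simp: image_iff) metis
    have lm: "box l u \<in> lmeasurable"
      by simp
    have m: "measure lebesgue (T' ` box l u) = measure lebesgue (box l u)"
            "T' ` box l u \<in> lmeasurable"
      using measure_orthogonal_image[OF T'(1) lm] measurable_orthogonal_image[OF T'(1) lm] by auto
    have meas: "T -` box l u \<in> sets borel"
      using measurable_sets[OF meas_T, of "box l u"] by simp
    have "emeasure (distr lborel borel T) (box l u) = emeasure lebesgue (T -` box l u)"
      using meas meas_T by (simp add: emeasure_distr)
    also have "\<dots> = emeasure lebesgue (box l u)"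
      unfolding vim using m lm by (simp add: emeasure_eq_measure2 fmeasurableD2)
    finally show "emeasure (distr lborel borel T) (box l u) = ennreal (\<Prod>b\<in>Basis. (u - l) \<bullet> b)"
      using lu by (simp add: emeasure_lborel_box)
  qed simp
qed

lemma distr_lborel_orthogonal:
  fixes T :: "real^'m \<Rightarrow> real^'m"
  assumes T: "orthogonal_transformation T"
  shows "distr lborel borel T = lborel"
proof -
  define U where "U = reindex_copy \<circ> T \<circ> reindex_original"
  have linT: "linear T"
    using T by (rule orthogonal_transformation_linear)
  have U: "orthogonal_transformation U"
    unfolding orthogonal_transformation_def
  proof (intro conjI allI)
    show "linear U"
      unfolding U_def by (intro linear_compose linear_reindex linT)
    fix x y
    have "U x \<bullet> U y = reindex_original x \<bullet> reindex_original y"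
      using T by (simp add: U_def inner_reindex_copy orthogonal_transformation_def)
    also have "\<dots> = x \<bullet> y"
      by (subst inner_reindex_copy[symmetric]) simp
    finally show "U x \<bullet> U y = x \<bullet> y" .
  qed
  have meas: "T \<in> borel_measurable borel" "U \<in> borel_measurable borel"
    "reindex_copy \<in> borel_measurable borel" "reindex_original \<in> borel_measurable borel"
    by (intro borel_measurable_linear linear_reindex linT orthogonal_transformation_linear[OF U])+
  have "distr (lborel :: (real^('m ordered_copy)) measure) borel reindex_original
      = distr (distr (lborel :: (real^'m) measure) borel reindex_copy) borel reindex_original"
    by (simp only: distr_lborel_reindex_copy)
  also have "\<dots> = distr lborel borel (\<lambda>x. x)"
    by (subst distr_distr[OF meas(4)]) (simp_all add: meas comp_def)
  also have "\<dots> = lborel"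
    by (rule distr_id2) simp
  finally have orig: "distr (lborel :: (real^('m ordered_copy)) measure) borel reindex_original = lborel" .
  have "distr lborel borel T = distr (distr (lborel :: (real^('m ordered_copy)) measure) borel reindex_original) borel T"
    by (simp only: orig)
  also have "\<dots> = distr lborel borel (T \<circ> reindex_original)"
    by (rule distr_distr[OF meas(1)]) (simp add: meas)
  also have "T \<circ> reindex_original = reindex_original \<circ> U"
    by (simp add: U_def fun_eq_iff)
  also have "distr lborel borel (reindex_original \<circ> U) = distr (distr lborel borel U) borel reindex_original"
    by (rule distr_distr[symmetric, OF meas(4)]) (simp add: meas)
  also have "\<dots> = lborel"
    by (simp only: distr_lborel_orthogonal_wellorder[OF U] orig)
  finally show ?thesis .
qed

lemma nn_integral_sphere_orthogonal:
  fixes T :: "real^'m \<Rightarrow> real^'m"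
  assumes T: "orthogonal_transformation T" and [measurable]: "f \<in> borel_measurable borel"
  shows "(\<integral>\<^sup>+x. f (T x) \<partial>sphere_measure) = (\<integral>\<^sup>+x. f x \<partial>sphere_measure)"
proof -
  have [measurable]: "T \<in> borel_measurable borel"
    by (intro borel_measurable_linear orthogonal_transformation_linear T)
  have sgn_meas [measurable]: "(sgn :: real^'m \<Rightarrow> _) \<in> borel_measurable borel"
    unfolding sgn_div_norm[abs_def] by measurable
  have norm: "norm (T x) = norm x" for x
    using T by (simp add: orthogonal_transformation)
  have sgn: "T (sgn x) = sgn (T x)" for x
    using orthogonal_transformation_linear[OF T] by (simp add: sgn_div_norm norm linear_cmul)
  have ind: "indicator (ball 0 1 - {0}) (T x) = (indicator (ball 0 1 - {0}) x :: ennreal)" for x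
  proof -
    have "T x = 0 \<longleftrightarrow> x = 0"
      by (metis norm norm_eq_zero)
    then show ?thesis
      using norm[of x] by (simp add: indicator_def)
  qed
  define F where "F x = f (sgn x) * indicator (ball 0 1 - {0}) x" for x
  have F: "F \<in> borel_measurable borel"
    unfolding F_def[abs_def]
    by (intro borel_measurable_times_ennreal measurable_compose[OF sgn_meas assms(2)] borel_measurable_indicator) auto
  have fT: "(\<lambda>x. f (T x)) \<in> borel_measurable borel"
    by measurable
  have "(\<integral>\<^sup>+x. f (T x) \<partial>sphere_measure) = of_nat DIM(real^'m) * (\<integral>\<^sup>+x. F (T x) \<partial>lborel)"
    unfolding nn_integral_sphere_measure[OF fT] F_def sgn ind ..
  also have "(\<integral>\<^sup>+x. F (T x) \<partial>lborel) = (\<integral>\<^sup>+x. F x \<partial>distr lborel borel T)"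
    by (rule nn_integral_distr[symmetric]) (use F in simp_all)
  also have "of_nat DIM(real^'m) * \<dots> = (\<integral>\<^sup>+x. f x \<partial>sphere_measure)"
    unfolding nn_integral_sphere_measure[OF assms(2)] distr_lborel_orthogonal[OF T] F_def ..
  finally show ?thesis .
qed

lemma distr_sphere_measure_orthogonal:
  fixes T :: "real^'m \<Rightarrow> real^'m"
  assumes T: "orthogonal_transformation T"
  shows "T \<in> sphere_measure \<rightarrow>\<^sub>M sphere_measure" "distr sphere_measure sphere_measure T = sphere_measure"
proof -
  have Tb: "T \<in> borel_measurable borel"
    by (intro borel_measurable_linear orthogonal_transformation_linear T)
  show meas: "T \<in> sphere_measure \<rightarrow>\<^sub>M sphere_measure"
    unfolding measurable_cong_sets[OF sets_sphere_measure sets_sphere_measure]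
    using T by (intro measurable_restrict_space2 measurable_restrict_space1 Tb)
      (auto simp: space_restrict_space orthogonal_transformation)
  show "distr sphere_measure sphere_measure T = sphere_measure"
  proof (rule measure_eqI)
    fix A assume "A \<in> sets (distr sphere_measure sphere_measure T)"
    then have A: "A \<in> sets sphere_measure" by simp
    then have Ab[measurable]: "A \<in> sets borel"
      by (auto simp: sets_sphere_measure sets_restrict_space)
    have "emeasure (distr sphere_measure sphere_measure T) A
        = (\<integral>\<^sup>+x. indicator A (T x) \<partial>sphere_measure)"
      using A meas by (subst nn_integral_distr[OF meas, symmetric]) auto
    also have "\<dots> = emeasure sphere_measure A"
      using A by (subst nn_integral_sphere_orthogonal[OF T]) auto
    finally show "emeasure (distr sphere_measure sphere_measure T) A = emeasure sphere_measure A" .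
  qed simp
qed

lemma integral_sphere_orthogonal:
  fixes T :: "real^'m \<Rightarrow> real^'m" and f :: "real^'m \<Rightarrow> real"
  assumes T: "orthogonal_transformation T" and f: "f \<in> borel_measurable borel"
  shows "(LINT x|sphere_measure. f (T x)) = (LINT x|sphere_measure. f x)"
  using integral_distr[OF distr_sphere_measure_orthogonal(1)[OF T] measurable_sphere_measure[OF f]]
  by (simp add: distr_sphere_measure_orthogonal(2)[OF T])

section \<open>Integration by parts\<close>

text \<open>
  Rotation by the angle \<open>t\<close> in the plane of two orthonormal vectors \<open>i\<close> and \<open>j\<close>, and the linear
  vector field that generates it.
\<close>

definition plane_rotation :: "'a::euclidean_space \<Rightarrow> 'a \<Rightarrow> real \<Rightarrow> 'a \<Rightarrow> 'a" where
  "plane_rotation i j t x = x + (cos t - 1) *\<^sub>R ((x \<bullet> i) *\<^sub>R i + (x \<bullet> j) *\<^sub>R j)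
     + sin t *\<^sub>R ((x \<bullet> i) *\<^sub>R j - (x \<bullet> j) *\<^sub>R i)"

definition rotation_generator :: "'a::euclidean_space \<Rightarrow> 'a \<Rightarrow> 'a \<Rightarrow> 'a" where
  "rotation_generator i j x = (x \<bullet> i) *\<^sub>R j - (x \<bullet> j) *\<^sub>R i"

context
  fixes i j :: "'a::euclidean_space"
  assumes ij: "i \<in> Basis" "j \<in> Basis" "i \<noteq> j"
begin

lemma inner_plane_basis: "i \<bullet> i = 1" "j \<bullet> j = 1" "i \<bullet> j = 0" "j \<bullet> i = 0"
  using ij by (auto simp: inner_Basis)

lemma orthogonal_plane_rotation: "orthogonal_transformation (plane_rotation i j t)"
  unfolding orthogonal_transformation_def
proof (intro conjI allI)
  show "linear (plane_rotation i j t)"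
    unfolding plane_rotation_def
    by (rule linearI) (simp_all add: inner_add_left algebra_simps)
  fix x y
  define c s a b a' b' where "c = cos t" and "s = sin t"
    and "a = x \<bullet> i" and "b = x \<bullet> j" and "a' = y \<bullet> i" and "b' = y \<bullet> j"
  have comm: "i \<bullet> y = a'" "j \<bullet> y = b'"
    by (simp_all add: a'_def b'_def inner_commute)
  have "plane_rotation i j t x \<bullet> plane_rotation i j t y
     = x \<bullet> y + (2 * (c - 1) + (c - 1)\<^sup>2 + s\<^sup>2) * (a * a' + b * b')"
    unfolding plane_rotation_def
    by (simp add: inner_add_left inner_add_right inner_diff_left inner_diff_right inner_plane_basis
        comm flip: c_def s_def a_def b_def a'_def b'_def)
       (simp add: algebra_simps power2_eq_square)
  also have "2 * (c - 1) + (c - 1)\<^sup>2 + s\<^sup>2 = 0"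
    using sin_cos_squared_add[of t] by (simp add: c_def s_def power2_eq_square algebra_simps)
  finally show "plane_rotation i j t x \<bullet> plane_rotation i j t y = x \<bullet> y"
    by simp
qed

lemma plane_rotation_has_vector_derivative:
  "((\<lambda>t. plane_rotation i j t x) has_vector_derivative
      rotation_generator i j (plane_rotation i j t x)) (at t)"
proof -
  have "((\<lambda>t. plane_rotation i j t x) has_vector_derivative
      - sin t *\<^sub>R ((x \<bullet> i) *\<^sub>R i + (x \<bullet> j) *\<^sub>R j)
     + cos t *\<^sub>R ((x \<bullet> i) *\<^sub>R j - (x \<bullet> j) *\<^sub>R i)) (at t)"
    unfolding plane_rotation_def
    by (auto intro!: derivative_eq_intros simp: has_vector_derivative_def algebra_simps)
  also have "- sin t *\<^sub>R ((x \<bullet> i) *\<^sub>R i + (x \<bullet> j) *\<^sub>R j)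
     + cos t *\<^sub>R ((x \<bullet> i) *\<^sub>R j - (x \<bullet> j) *\<^sub>R i) = rotation_generator i j (plane_rotation i j t x)"
    by (simp add: rotation_generator_def plane_rotation_def inner_add_left inner_diff_left
        inner_plane_basis algebra_simps)
  finally show ?thesis .
qed

end

text \<open>
  Along a rotation the integral of \<open>F\<close> is constant, so its derivative, the integral of the derivative of
  \<open>F\<close> along the generator, vanishes.
\<close>

lemma integral_rotation_derivative:
  fixes F :: "real^'m \<Rightarrow> real"
  assumes ij: "i \<in> Basis" "j \<in> Basis" "i \<noteq> j"
    and F: "\<And>x. (F has_derivative F' x) (at x)"
    and M: "\<And>x. norm x = 1 \<Longrightarrow> \<bar>F' x (rotation_generator i j x)\<bar> \<le> M"
  shows "(LINT x|sphere_measure. F' x (rotation_generator i j x)) = 0"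
proof -
  define R where "R = plane_rotation i j"
  have R: "orthogonal_transformation (R t)" for t
    unfolding R_def by (rule orthogonal_plane_rotation[OF ij])
  have der: "((\<lambda>t. F (R t x)) has_real_derivative F' (R t x) (rotation_generator i j (R t x))) (at t)" for t x
    using vector_derivative_diff_chain_within[OF plane_rotation_has_vector_derivative[OF ij, of x t, folded R_def]
        has_derivative_at_withinI[OF F[of "R t x"]]]
    by (simp add: o_def has_real_derivative_iff_has_vector_derivative)
  have cont: "continuous_on UNIV F"
    by (intro continuous_at_imp_continuous_on ballI has_derivative_continuous[OF F])
  have Fm: "F \<in> borel_measurable borel"
    by (rule borel_measurable_continuous_onI[OF cont])
  have FRm: "(\<lambda>x. F (R t x)) \<in> borel_measurable borel" for t
    by (rule measurable_compose[OF _ Fm])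
       (intro borel_measurable_linear orthogonal_transformation_linear R)
  define t where "t k = inverse (real (Suc k))" for k
  have t0: "t k > 0" for k
    by (simp add: t_def)
  define Q where "Q k x = (F (R (t k) x) - F x) / t k" for k x
  have R0: "R 0 x = x" for x
    by (simp add: R_def plane_rotation_def)
  have lim: "(\<lambda>k. Q k x) \<longlonglongrightarrow> F' x (rotation_generator i j x)" for x
  proof -
    have "((\<lambda>h. (F (R (0 + h) x) - F (R 0 x)) / h) \<longlongrightarrow> F' (R 0 x) (rotation_generator i j (R 0 x))) (at 0)"
      using der[of x 0] by (simp add: DERIV_def)
    then have "(\<lambda>k. (F (R (0 + t k) x) - F (R 0 x)) / t k) \<longlonglongrightarrow> F' (R 0 x) (rotation_generator i j (R 0 x))"
      by (rule filterlim_compose)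
         (use t0 LIMSEQ_inverse_real_of_nat in \<open>auto simp: filterlim_at t_def\<close>)
    then show ?thesis
      by (simp add: Q_def R0)
  qed
  \<comment> \<open>mean value theorem along the rotation, which stays on the sphere\<close>
  have bound: "\<bar>Q k x\<bar> \<le> M" if x: "norm x = 1" for k x
  proof -
    have "\<exists>z. 0 < z \<and> z < t k \<and>
        F (R (t k) x) - F (R 0 x) = (t k - 0) * F' (R z x) (rotation_generator i j (R z x))"
      by (rule MVT2[OF t0]) (rule der)
    then obtain z where "F (R (t k) x) - F (R 0 x) = (t k - 0) * F' (R z x) (rotation_generator i j (R z x))"
      by blast
    then have "Q k x = F' (R z x) (rotation_generator i j (R z x))"
      using t0[of k] by (simp add: Q_def R0)
    moreover have "norm (R z x) = 1"
      using R x by (simp add: orthogonal_transformation)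
    ultimately show ?thesis
      using M by simp
  qed
  have Qm: "Q k \<in> borel_measurable borel" for k
    unfolding Q_def[abs_def] using FRm[of "t k"] Fm by measurable
  have "(\<lambda>k. LINT x|sphere_measure. Q k x) \<longlonglongrightarrow> (LINT x|sphere_measure. F' x (rotation_generator i j x))"
  proof (rule integral_dominated_convergence[where w = "\<lambda>_. M"])
    show "(\<lambda>x. F' x (rotation_generator i j x)) \<in> borel_measurable sphere_measure"
      by (rule measurable_sphere_measure, rule borel_measurable_LIMSEQ_real[OF lim Qm])
    show "integrable sphere_measure (\<lambda>_::real^'m. M)"
      by (rule integrable_sphere_measure_continuous) auto
  qed (use bound lim Qm in \<open>auto intro: measurable_sphere_measure\<close>)
  moreover have "(LINT x|sphere_measure. Q k x) = 0" for k
  proof -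
    have "integrable sphere_measure F"
      by (rule integrable_sphere_measure_continuous[OF cont])
    moreover have "integrable sphere_measure (\<lambda>x. F (R (t k) x))"
      using orthogonal_transformation_linear[OF R[of "t k"]]
      by (intro integrable_sphere_measure_continuous continuous_on_compose2[OF cont] linear_continuous_on)
         (auto simp: linear_conv_bounded_linear)
    ultimately show ?thesis
      by (simp add: Q_def integral_sphere_orthogonal[OF R Fm])
  qed
  ultimately show ?thesis
    by (simp add: LIMSEQ_const_iff)
qed

text \<open>
  On the sphere a tangent field is \<open>X x = (\<Sum>i j. (x \<bullet> i) * (X x \<bullet> j) *\<^sub>R rotation_generator i j x)\<close>,
  and its divergence is the sum of the derivatives of the coefficients along the generators.  The formula
  is thus the sum over \<open>i\<close> and \<open>j\<close> of \<open>integral_rotation_derivative\<close> for \<open>u\<close> times a coefficient.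
\<close>

lemma sphere_integration_by_parts:
  fixes u :: "real^'m \<Rightarrow> real"
  assumes u: "\<And>x. (u has_derivative (\<lambda>h. g x \<bullet> h)) (at x)"
    and g: "g \<in> borel_measurable borel" "\<And>x. norm x = 1 \<Longrightarrow> norm (g x) \<le> M"
    and X: "smooth_tangent_field X"
  shows "(LINT x|sphere_measure. u x * sphere_div X x) = - (LINT x|sphere_measure. g x \<bullet> X x)"
proof -
  obtain D where D: "D [] = X" "\<And>vs x. (D vs has_derivative (\<lambda>v. D (v # vs) x)) (at x)"
    using X unfolding smooth_tangent_field_def smooth_map_def by blast
  have tangent: "x \<bullet> X x = 0" if "norm x = 1" for x
    using X that by (auto simp: smooth_tangent_field_def)
  have DX: "(X has_derivative (\<lambda>v. D [v] x)) (at x)" for x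
    using D(2)[of "[]" x] D(1) by simp
  have lin: "linear (\<lambda>v. D [v] x)" for x
    using DX by (rule has_derivative_linear)
  have frechet: "frechet_derivative X (at x) = (\<lambda>v. D [v] x)" for x
    using frechet_derivative_at[OF DX] by simp
  have contD: "continuous_on UNIV (D vs)" for vs
    by (intro continuous_at_imp_continuous_on ballI has_derivative_continuous[OF D(2)])
  have contX: "continuous_on UNIV X"
    using contD[of "[]"] D(1) by simp
  have contu: "continuous_on UNIV u"
    by (intro continuous_at_imp_continuous_on ballI has_derivative_continuous[OF u])
  define c1 where "c1 i j x = (x \<bullet> i) * (X x \<bullet> j)" for i j x
  define c2 where "c2 i j x = u x * ((rotation_generator i j x \<bullet> i) * (X x \<bullet> j)
      + (x \<bullet> i) * (((x \<bullet> i) *\<^sub>R D [j] x - (x \<bullet> j) *\<^sub>R D [i] x) \<bullet> j))" for i j x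
  \<comment> \<open>the derivative along the generator of \<open>u\<close> times the \<open>(i, j)\<close> coefficient of \<open>X\<close>\<close>
  define E where "E i j x = (g x \<bullet> rotation_generator i j x) * c1 i j x + c2 i j x" for i j x
  have cont1: "continuous_on UNIV (c1 i j)" for i j
    unfolding c1_def by (intro continuous_intros contX)
  have cont2: "continuous_on UNIV (c2 i j)" for i j
    unfolding c2_def rotation_generator_def by (intro continuous_intros contX contu contD)
  have Em: "E i j \<in> borel_measurable borel" for i j
    unfolding E_def[abs_def] rotation_generator_def
    using g(1) borel_measurable_continuous_onI[OF cont1[of i j]] borel_measurable_continuous_onI[OF cont2[of i j]]
    by measurable
  have gen: "norm (rotation_generator i j x) \<le> 2" if "i \<in> Basis" "j \<in> Basis" "norm x = 1" for i j x :: "real^'m"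
  proof -
    have "norm (rotation_generator i j x) \<le> norm ((x \<bullet> i) *\<^sub>R j) + norm ((x \<bullet> j) *\<^sub>R i)"
      unfolding rotation_generator_def by (rule norm_triangle_ineq4)
    also have "\<dots> \<le> 2"
      using that Basis_le_norm[of i x] Basis_le_norm[of j x] by simp
    finally show ?thesis .
  qed
  have bound: "\<exists>B. \<forall>x. norm x = 1 \<longrightarrow> \<bar>E i j x\<bar> \<le> B" if ij: "i \<in> Basis" "j \<in> Basis" for i j
  proof -
    obtain B1 where B1: "B1 \<ge> 0" "\<And>x. norm x = 1 \<Longrightarrow> norm (c1 i j x) \<le> B1"
      using continuous_bounded_on_sphere[OF cont1[of i j]] by blast
    obtain B2 where B2: "B2 \<ge> 0" "\<And>x. norm x = 1 \<Longrightarrow> norm (c2 i j x) \<le> B2"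
      using continuous_bounded_on_sphere[OF cont2[of i j]] by blast
    have "\<bar>E i j x\<bar> \<le> (M * 2) * B1 + B2" if x: "norm x = 1" for x
    proof -
      have "\<bar>g x \<bullet> rotation_generator i j x\<bar> \<le> norm (g x) * norm (rotation_generator i j x)"
        by (rule Cauchy_Schwarz_ineq2)
      also have "\<dots> \<le> M * 2"
        using g(2)[OF x] gen[OF ij x] order_trans[OF norm_ge_zero g(2)[OF x]] by (intro mult_mono) auto
      finally have "\<bar>(g x \<bullet> rotation_generator i j x) * c1 i j x\<bar> \<le> (M * 2) * B1"
        unfolding abs_mult using B1(2)[OF x] by (intro mult_mono) auto
      then show ?thesis
        using B2(2)[OF x] abs_triangle_ineq[of "(g x \<bullet> rotation_generator i j x) * c1 i j x" "c2 i j x"]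
        unfolding E_def by simp
    qed
    then show ?thesis by blast
  qed
  have int_E: "integrable sphere_measure (E i j)" if "i \<in> Basis" "j \<in> Basis" for i j
    using bound[OF that] integrable_sphere_measure_bounded[OF Em] by (metis real_norm_def)
  have zero: "(LINT x|sphere_measure. E i j x) = 0" if ij: "i \<in> Basis" "j \<in> Basis" for i j
  proof (cases "i = j")
    case True
    then have "E i j x = 0" for x
      by (simp add: E_def c2_def rotation_generator_def)
    then show ?thesis by simp
  next
    case False
    define F' where "F' x h = (g x \<bullet> h) * ((x \<bullet> i) * (X x \<bullet> j))
       + u x * ((h \<bullet> i) * (X x \<bullet> j) + (x \<bullet> i) * (D [h] x \<bullet> j))" for x h
    have E_eq: "E i j x = F' x (rotation_generator i j x)" for x
    proof -
      have "D [rotation_generator i j x] x = (x \<bullet> i) *\<^sub>R D [j] x - (x \<bullet> j) *\<^sub>R D [i] x"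
        unfolding rotation_generator_def by (simp add: linear_diff[OF lin] linear_cmul[OF lin])
      then show ?thesis
        by (simp add: E_def F'_def c1_def c2_def)
    qed
    have F: "((\<lambda>x. u x * ((x \<bullet> i) * (X x \<bullet> j))) has_derivative F' x) (at x)" for x
      unfolding F'_def
      by (rule has_derivative_eq_rhs, rule has_derivative_mult[OF u], rule has_derivative_mult)
         (auto intro!: derivative_eq_intros DX simp: fun_eq_iff algebra_simps)
    obtain B where B: "\<And>x. norm x = 1 \<Longrightarrow> \<bar>E i j x\<bar> \<le> B"
      using bound[OF ij] by blast
    show ?thesis
      using integral_rotation_derivative[OF ij False F, of B] B by (simp add: E_eq)
  qed
  have sum_E: "(\<Sum>i\<in>Basis. \<Sum>j\<in>Basis. E i j x) = g x \<bullet> X x + u x * sphere_div X x" if x: "norm x = 1" for x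
  proof -
    have one: "(\<Sum>i\<in>Basis. (x \<bullet> i) * (x \<bullet> i)) = 1"
      using x by (metis euclidean_inner norm_eq_1)
    have t: "(\<Sum>j\<in>Basis. (x \<bullet> j) * (X x \<bullet> j)) = 0"
      using tangent[OF x] by (metis euclidean_inner)
    have gX: "(\<Sum>j\<in>Basis. (g x \<bullet> j) * (X x \<bullet> j)) = g x \<bullet> X x"
      by (rule euclidean_inner[symmetric])
    have Dx: "(\<Sum>i\<in>Basis. (x \<bullet> i) * (\<Sum>j\<in>Basis. (x \<bullet> j) * (D [i] x \<bullet> j))) = D [x] x \<bullet> x"
    proof -
      have "D [x] x = (\<Sum>i\<in>Basis. (x \<bullet> i) *\<^sub>R D [i] x)"
        using linear_sum[OF lin[of x], of "\<lambda>i. (x \<bullet> i) *\<^sub>R i" Basis]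
        by (simp add: euclidean_representation linear_cmul[OF lin])
      then have "D [x] x \<bullet> x = (\<Sum>i\<in>Basis. (x \<bullet> i) * (D [i] x \<bullet> x))"
        by (simp add: inner_sum_left)
      also have "\<dots> = (\<Sum>i\<in>Basis. (x \<bullet> i) * (\<Sum>j\<in>Basis. (x \<bullet> j) * (D [i] x \<bullet> j)))"
        by (subst euclidean_inner) (simp add: mult.commute)
      finally show ?thesis by simp
    qed
    have e: "E i j x = (x \<bullet> i) * (x \<bullet> i) * ((g x \<bullet> j) * (X x \<bullet> j))
        - ((x \<bullet> i) * (g x \<bullet> i)) * ((x \<bullet> j) * (X x \<bullet> j))
        + u x * ((if j = i then x \<bullet> i * (X x \<bullet> j) else 0) - (x \<bullet> j) * (X x \<bullet> j))
        + u x * ((x \<bullet> i) * (x \<bullet> i) * (D [j] x \<bullet> j)) - u x * ((x \<bullet> i) * ((x \<bullet> j) * (D [i] x \<bullet> j)))"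
      if "i \<in> Basis" "j \<in> Basis" for i j
      using that
      by (simp add: E_def c1_def c2_def rotation_generator_def inner_diff_right inner_diff_left inner_Basis algebra_simps)
    have "(\<Sum>i\<in>Basis. \<Sum>j\<in>Basis. E i j x) =
        (\<Sum>i\<in>Basis. (x \<bullet> i) * (x \<bullet> i) * (g x \<bullet> X x)
         + u x * ((x \<bullet> i) * (X x \<bullet> i))
         + u x * ((x \<bullet> i) * (x \<bullet> i) * (\<Sum>j\<in>Basis. D [j] x \<bullet> j))
         - u x * ((x \<bullet> i) * (\<Sum>j\<in>Basis. (x \<bullet> j) * (D [i] x \<bullet> j))))"
      by (rule sum.cong[OF refl])
         (simp add: e sum.distrib sum_subtractf flip: sum_distrib_left, simp add: t gX)
    also have "\<dots> = g x \<bullet> X x + u x * (\<Sum>j\<in>Basis. D [j] x \<bullet> j) - u x * (D [x] x \<bullet> x)"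
      by (simp add: sum.distrib sum_subtractf one t Dx flip: sum_distrib_left sum_distrib_right)
    finally show ?thesis
      by (simp add: sphere_div_def frechet algebra_simps)
  qed
  have int_gX: "integrable sphere_measure (\<lambda>x. g x \<bullet> X x)"
  proof -
    obtain B where B: "B \<ge> 0" "\<And>x. norm x = 1 \<Longrightarrow> norm (X x) \<le> B"
      using continuous_bounded_on_sphere[OF contX] by blast
    have "norm (g x \<bullet> X x) \<le> M * B" if x: "norm x = 1" for x
    proof -
      have "norm (g x \<bullet> X x) \<le> norm (g x) * norm (X x)"
        by (simp add: Cauchy_Schwarz_ineq2)
      also have "\<dots> \<le> M * B"
        using g(2)[OF x] B(2)[OF x] order_trans[OF norm_ge_zero g(2)[OF x]] by (intro mult_mono) auto
      finally show ?thesis .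
    qed
    then show ?thesis
      using g(1) borel_measurable_continuous_onI[OF contX]
      by (intro integrable_sphere_measure_bounded) auto
  qed
  have int_div: "integrable sphere_measure (\<lambda>x. u x * sphere_div X x)"
  proof -
    have eq: "D [x] x = (\<Sum>i\<in>Basis. (x \<bullet> i) *\<^sub>R D [i] x)" for x
      using linear_sum[OF lin[of x], of "\<lambda>i. (x \<bullet> i) *\<^sub>R i" Basis]
      by (simp add: euclidean_representation linear_cmul[OF lin])
    show ?thesis
      unfolding sphere_div_def frechet eq
      by (intro integrable_sphere_measure_continuous continuous_intros contu contD)
  qed
  have "0 = (LINT x|sphere_measure. (\<Sum>i\<in>Basis. \<Sum>j\<in>Basis. E i j x))"
    by (simp add: integral_sum int_E zero)
  also have "\<dots> = (LINT x|sphere_measure. g x \<bullet> X x + u x * sphere_div X x)"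
    by (rule Bochner_Integration.integral_cong) (auto simp: sum_E)
  also have "\<dots> = (LINT x|sphere_measure. g x \<bullet> X x) + (LINT x|sphere_measure. u x * sphere_div X x)"
    by (rule Bochner_Integration.integral_add[OF int_gX int_div])
  finally show ?thesis by simp
qed

section \<open>Zonal functions and concentration\<close>

text \<open>
  The radial part of Lebesgue measure in \<open>d\<close> dimensions: the Euclidean norm has density
  \<open>d * unit_ball_vol d * r ^ (d - 1)\<close> on the positive half-line.
\<close>

lemma distr_PiM_radius:
  assumes fin: "finite A" "A \<noteq> {}"
  defines "d \<equiv> card A"
  shows "distr (Pi\<^sub>M A (\<lambda>_. lborel)) borel (\<lambda>f. sqrt (\<Sum>i\<in>A. (f i)\<^sup>2))
    = density lborel (\<lambda>r. ennreal (real d * unit_ball_vol d * r ^ (d - 1)) * indicator {0<..} r)"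
proof -
  have d: "d > 0"
    using fin by (auto simp: d_def card_gt_0_iff)
  define M where "M = distr (Pi\<^sub>M A (\<lambda>_. lborel)) borel (\<lambda>f. sqrt (\<Sum>i\<in>A. (f i)\<^sup>2))"
  define N where "N = density lborel (\<lambda>r. ennreal (real d * unit_ball_vol d * r ^ (d - 1)) * indicator {0<..} r)"
  have M: "emeasure M {..r} = ennreal (unit_ball_vol d * (max 0 r) ^ d)" for r
  proof (cases "r > 0")
    case True
    have "emeasure M {..r} = emeasure (Pi\<^sub>M A (\<lambda>_. lborel))
             ({f. sqrt (\<Sum>i\<in>A. (f i)\<^sup>2) \<le> r} \<inter> space (Pi\<^sub>M A (\<lambda>_. lborel)))"
      unfolding M_def by (subst emeasure_distr) (auto intro!: arg_cong2[where f = emeasure])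
    then show ?thesis
      using emeasure_cball_aux[OF fin(1) True] True by (simp add: d_def max_def)
  next
    case False
    \<comment> \<open>the ball of radius zero lies in every ball of radius \<open>e > 0\<close>\<close>
    show ?thesis
    proof (rule antisym)
      have "emeasure M {..r} \<le> ennreal (unit_ball_vol d * e ^ d)" if "e > 0" for e
      proof -
        have "emeasure M {..r} \<le> emeasure M {..e}"
          using False that by (intro emeasure_mono) (auto simp: M_def)
        also have "\<dots> = emeasure (Pi\<^sub>M A (\<lambda>_. lborel))
             ({f. sqrt (\<Sum>i\<in>A. (f i)\<^sup>2) \<le> e} \<inter> space (Pi\<^sub>M A (\<lambda>_. lborel)))"
          unfolding M_def by (subst emeasure_distr) (auto intro!: arg_cong2[where f = emeasure])
        finally show ?thesis
          using emeasure_cball_aux[OF fin(1) that] by (simp add: d_def)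
      qed
      then have "\<forall>\<^sub>F e in at_right 0. emeasure M {..r} \<le> ennreal (unit_ball_vol d * e ^ d)"
        by (auto simp: eventually_at_right_less eventually_at_filter)
      moreover have "((\<lambda>e. ennreal (unit_ball_vol d * e ^ d)) \<longlongrightarrow> ennreal (unit_ball_vol d * 0 ^ d)) (at_right 0)"
        by (intro tendsto_intros)
      ultimately have "emeasure M {..r} \<le> ennreal (unit_ball_vol d * 0 ^ d)"
        by (intro tendsto_lowerbound[of _ _ "at_right 0"]) auto
      then show "emeasure M {..r} \<le> ennreal (unit_ball_vol d * (max 0 r) ^ d)"
        using False by (simp add: max_absorb1)
    qed (use False d in \<open>simp add: max_def zero_power\<close>)
  qed
  have N: "emeasure N {..r} = ennreal (unit_ball_vol d * (max 0 r) ^ d)" for r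
  proof (cases "r > 0")
    case True
    have "emeasure N {..r} = (\<integral>\<^sup>+x. ennreal (real d * unit_ball_vol d * x ^ (d - 1)) * indicator {0<..} x * indicator {..r} x \<partial>lborel)"
      unfolding N_def by (subst emeasure_density) auto
    also have "\<dots> = (\<integral>\<^sup>+x. ennreal (real d * unit_ball_vol d * x ^ (d - 1)) * indicator {0..r} x \<partial>lborel)"
    proof (rule nn_integral_cong_AE)
      have "AE x in lborel. x \<noteq> (0::real)"
        by (rule AE_lborel_singleton)
      then show "AE x in lborel. ennreal (real d * unit_ball_vol d * x ^ (d - 1)) * indicator {0<..} x * indicator {..r} x
         = ennreal (real d * unit_ball_vol d * x ^ (d - 1)) * indicator {0..r} x"
        by eventually_elim (auto simp: indicator_def)
    qed
    also have "\<dots> = ennreal (unit_ball_vol d * r ^ d - unit_ball_vol d * 0 ^ d)"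
      using True
      by (intro nn_integral_FTC_Icc) (auto intro!: derivative_eq_intros)
    finally show ?thesis
      using True d by (simp add: zero_power)
  next
    case False
    have "emeasure N {..r} = (\<integral>\<^sup>+x. ennreal (real d * unit_ball_vol d * x ^ (d - 1)) * indicator {0<..} x * indicator {..r} x \<partial>lborel)"
      unfolding N_def by (subst emeasure_density) auto
    also have "\<dots> = (\<integral>\<^sup>+x. 0 \<partial>(lborel :: real measure))"
      using False by (intro nn_integral_cong) (auto simp: indicator_def)
    finally show ?thesis
      using False d by (simp add: max_def zero_power)
  qed
  have "M = N"
  proof (rule measure_eqI_generator_eq[where E = "range (\<lambda>a::real. {..a})" and \<Omega> = UNIV and A = "\<lambda>i. {..real i}"])
    show "Int_stable (range (\<lambda>a::real. {..a}))"
      by (auto simp: Int_stable_def)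
    show "sets M = sigma_sets UNIV (range (\<lambda>a::real. {..a}))" "sets N = sigma_sets UNIV (range (\<lambda>a::real. {..a}))"
      unfolding M_def N_def by (simp_all add: borel_eq_atMost)
    show "emeasure M X = emeasure N X" if "X \<in> range (\<lambda>a::real. {..a})" for X
      using that M N by auto
    show "(\<Union>i. {..real i}) = UNIV"
      using real_arch_simple by auto
    show "emeasure M {..real i} \<noteq> \<infinity>" for i
      by (simp add: M)
  qed auto
  then show ?thesis
    by (simp add: M_def N_def)
qed

text \<open>
  With \<open>x \<bullet> e = cos \<theta>\<close> and \<open>z = tan \<theta>\<close> this is the integral of a zonal function, supported in the open
  hemisphere around \<open>e\<close>, in the gnomonic coordinate \<open>z\<close>.  In the cone over the sphere the height \<open>s\<close> above
  the equator and the distance \<open>r\<close> from the axis are separated by Tonelli, and the linear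
  substitution \<open>r = s * z\<close> makes the integral over \<open>s\<close> elementary.
\<close>

lemma nn_integral_zonal_Basis:
  fixes e :: "'a::euclidean_space" and f :: "real \<Rightarrow> ennreal"
  assumes e: "e \<in> Basis" and dim: "DIM('a) = Suc d" "d > 0"
    and f[measurable]: "f \<in> borel_measurable borel" and f0: "\<And>t. t \<le> 0 \<Longrightarrow> f t = 0"
  shows "(\<integral>\<^sup>+x. f (x \<bullet> e) \<partial>sphere_measure)
    = (\<integral>\<^sup>+z. f (1 / sqrt (1 + z\<^sup>2)) * ennreal (real d * unit_ball_vol d * z ^ (d - 1) / sqrt (1 + z\<^sup>2) ^ Suc d)
          * indicator {0<..} z \<partial>lborel)"
proof -
  let ?B = "Basis - {e} :: 'a set"
  define \<omega> where "\<omega> = real d * unit_ball_vol d"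
  have \<omega>: "\<omega> \<ge> 0" by (simp add: \<omega>_def)
  interpret product_sigma_finite "\<lambda>_::'a. lborel :: real measure" ..
  have cardB: "card ?B = d" and finB: "finite ?B"
    using e dim by (auto simp: card_Diff_singleton)
  have neB: "?B \<noteq> {}"
    using cardB dim by force
  have insB: "insert e ?B = Basis" "e \<notin> ?B"
    using e by auto
  \<comment> \<open>the integrand in the height \<open>s\<close> and the distance \<open>r\<close> from the axis; only \<open>s > 0\<close> contributes, because of \<open>f0\<close>\<close>
  define G where "G s r = f (s / sqrt (s\<^sup>2 + r\<^sup>2)) * indicator {x. x < 1} (s\<^sup>2 + r\<^sup>2) * indicator {0<..} s" for s r :: real
  have Gm[measurable]: "(\<lambda>(s, r). G s r) \<in> borel_measurable (borel \<Otimes>\<^sub>M borel)"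
    unfolding G_def by measurable
  have [measurable]: "G s \<in> borel_measurable borel" for s
    unfolding G_def by measurable
  have Im [measurable]: "(\<lambda>r. \<integral>\<^sup>+s. G s r \<partial>lborel) \<in> borel_measurable borel"
    unfolding G_def by measurable
  have fe: "(\<lambda>x::'a. f (x \<bullet> e)) \<in> borel_measurable borel"
    by measurable
  define H where "H x = f (sgn x \<bullet> e) * indicator (ball 0 1 - {0}) x" for x :: 'a
  have sgn_meas: "(sgn :: 'a \<Rightarrow> _) \<in> borel_measurable borel"
    unfolding sgn_div_norm[abs_def] by measurable
  have Hm: "H \<in> borel_measurable borel"
    unfolding H_def[abs_def]
    by (intro borel_measurable_times_ennreal measurable_compose[OF sgn_meas fe] borel_measurable_indicator) auto
  let ?S = "\<lambda>g. \<Sum>b\<in>Basis. g b *\<^sub>R (b::'a)"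
  have H_eq: "H (?S (y(e := s))) = G s (sqrt (\<Sum>i\<in>?B. (y i)\<^sup>2))" for y s
  proof -
    define x where "x = ?S (y(e := s))"
    define r where "r = sqrt (\<Sum>i\<in>?B. (y i)\<^sup>2)"
    have r2: "r\<^sup>2 = (\<Sum>i\<in>?B. (y i)\<^sup>2)"
      unfolding r_def by (intro real_sqrt_pow2 sum_nonneg) auto
    have xb: "x \<bullet> b = (y(e := s)) b" if "b \<in> Basis" for b
      unfolding x_def using that by (rule inner_sum_left_Basis)
    have xe: "x \<bullet> e = s"
      using xb[OF e] by simp
    have "x \<bullet> x = (\<Sum>b\<in>Basis. (x \<bullet> b)\<^sup>2)"
      by (subst euclidean_inner) (simp add: power2_eq_square)
    also have "\<dots> = (x \<bullet> e)\<^sup>2 + (\<Sum>b\<in>?B. (x \<bullet> b)\<^sup>2)"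
      using e by (subst sum.remove[of _ e]) auto
    also have "(\<Sum>b\<in>?B. (x \<bullet> b)\<^sup>2) = r\<^sup>2"
      unfolding r2 by (intro sum.cong) (auto simp: xb)
    finally have nx: "norm x = sqrt (s\<^sup>2 + r\<^sup>2)"
      by (simp add: norm_eq_sqrt_inner xe)
    have "sgn x \<bullet> e = s / sqrt (s\<^sup>2 + r\<^sup>2)"
      by (simp add: sgn_div_norm nx xe divide_inverse mult.commute)
    moreover have "x \<in> ball 0 1 \<longleftrightarrow> s\<^sup>2 + r\<^sup>2 < 1"
      by (simp add: nx)
    moreover have "x \<noteq> 0" if "s > 0"
      using xe that by auto
    moreover have "f (s / sqrt (s\<^sup>2 + r\<^sup>2)) = 0" if "s \<le> 0"
      using that by (intro f0) (simp add: divide_nonpos_nonneg)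
    ultimately show ?thesis
      unfolding x_def[symmetric] r_def[symmetric] H_def G_def
      by (auto simp: indicator_def)
  qed
  have "(\<integral>\<^sup>+x. f (x \<bullet> e) \<partial>sphere_measure) = of_nat (Suc d) * (\<integral>\<^sup>+x. H x \<partial>lborel)"
    unfolding nn_integral_sphere_measure[OF fe] H_def dim ..
  also have "(\<integral>\<^sup>+x. H x \<partial>lborel) = (\<integral>\<^sup>+y. H (?S y) \<partial>(Pi\<^sub>M (insert e ?B) (\<lambda>_. lborel)))"
    unfolding insB by (subst lborel_eq, subst nn_integral_distr) (use Hm in auto)
  also have "\<dots> = (\<integral>\<^sup>+y. \<integral>\<^sup>+s. H (?S (y(e := s))) \<partial>lborel \<partial>(Pi\<^sub>M ?B (\<lambda>_. lborel)))"
    by (rule product_nn_integral_insert[OF finB insB(2)])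
       (unfold insB, rule measurable_compose[OF _ Hm], measurable)
  also have "\<dots> = (\<integral>\<^sup>+y. (\<integral>\<^sup>+s. G s (sqrt (\<Sum>i\<in>?B. (y i)\<^sup>2)) \<partial>lborel) \<partial>(Pi\<^sub>M ?B (\<lambda>_. lborel)))"
    unfolding H_eq ..
  also have "\<dots> = (\<integral>\<^sup>+r. (\<integral>\<^sup>+s. G s r \<partial>lborel) \<partial>distr (Pi\<^sub>M ?B (\<lambda>_. lborel)) borel (\<lambda>f. sqrt (\<Sum>i\<in>?B. (f i)\<^sup>2)))"
  proof (rule nn_integral_distr[symmetric])
    show "(\<lambda>f. sqrt (\<Sum>i\<in>?B. (f i)\<^sup>2)) \<in> Pi\<^sub>M ?B (\<lambda>_. lborel) \<rightarrow>\<^sub>M borel"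
      by measurable
  qed (use Im in simp)
  also have "\<dots> = (\<integral>\<^sup>+r. ennreal (\<omega> * r ^ (d - 1)) * indicator {0<..} r * (\<integral>\<^sup>+s. G s r \<partial>lborel) \<partial>lborel)"
    unfolding distr_PiM_radius[OF finB neB] cardB \<omega>_def
    by (subst nn_integral_density) auto
  also have "\<dots> = (\<integral>\<^sup>+r. \<integral>\<^sup>+s. ennreal (\<omega> * r ^ (d - 1)) * indicator {0<..} r * G s r \<partial>lborel \<partial>lborel)"
    by (intro nn_integral_cong nn_integral_cmult[symmetric]) measurable
  also have "\<dots> = (\<integral>\<^sup>+s. \<integral>\<^sup>+r. ennreal (\<omega> * r ^ (d - 1)) * indicator {0<..} r * G s r \<partial>lborel \<partial>lborel)"
    by (rule lborel_pair.Fubini') measurable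
  also have "\<dots> = (\<integral>\<^sup>+s. \<integral>\<^sup>+z. f (1 / sqrt (1 + z\<^sup>2)) * ennreal (\<omega> * z ^ (d - 1)) * indicator {0<..} z
        * (ennreal (s ^ d) * indicator {0<..<1 / sqrt (1 + z\<^sup>2)} s) \<partial>lborel \<partial>lborel)"
  proof (rule nn_integral_cong)
    fix s :: real
    show "(\<integral>\<^sup>+r. ennreal (\<omega> * r ^ (d - 1)) * indicator {0<..} r * G s r \<partial>lborel)
      = (\<integral>\<^sup>+z. f (1 / sqrt (1 + z\<^sup>2)) * ennreal (\<omega> * z ^ (d - 1)) * indicator {0<..} z
        * (ennreal (s ^ d) * indicator {0<..<1 / sqrt (1 + z\<^sup>2)} s) \<partial>lborel)"
    proof (cases "s > 0")
      case False
      then show ?thesis by (simp add: G_def)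
    next
      case s: True
      have "(\<integral>\<^sup>+r. ennreal (\<omega> * r ^ (d - 1)) * indicator {0<..} r * G s r \<partial>lborel)
         = ennreal s * (\<integral>\<^sup>+z. ennreal (\<omega> * (s * z) ^ (d - 1)) * indicator {0<..} (s * z) * G s (s * z) \<partial>lborel)"
        using s by (subst nn_integral_real_affine[where c = s and t = 0]) auto
      also have "\<dots> = (\<integral>\<^sup>+z. ennreal s * (ennreal (\<omega> * (s * z) ^ (d - 1)) * indicator {0<..} (s * z) * G s (s * z)) \<partial>lborel)"
        by (rule nn_integral_cmult[symmetric]) measurable
      also have "\<dots> = (\<integral>\<^sup>+z. f (1 / sqrt (1 + z\<^sup>2)) * ennreal (\<omega> * z ^ (d - 1)) * indicator {0<..} z
        * (ennreal (s ^ d) * indicator {0<..<1 / sqrt (1 + z\<^sup>2)} s) \<partial>lborel)"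
      proof (rule nn_integral_cong)
        fix z :: real
        show "ennreal s * (ennreal (\<omega> * (s * z) ^ (d - 1)) * indicator {0<..} (s * z) * G s (s * z))
          = f (1 / sqrt (1 + z\<^sup>2)) * ennreal (\<omega> * z ^ (d - 1)) * indicator {0<..} z
             * (ennreal (s ^ d) * indicator {0<..<1 / sqrt (1 + z\<^sup>2)} s)"
        proof (cases "z > 0")
          case False
          then show ?thesis
            using s by (simp add: zero_less_mult_iff)
        next
          case z: True
          have sq: "s\<^sup>2 + (s * z)\<^sup>2 = s\<^sup>2 * (1 + z\<^sup>2)"
            by (simp add: power_mult_distrib algebra_simps)
          have pos: "sqrt (1 + z\<^sup>2) > 0"
            by (simp add: add_pos_nonneg)
          have "s / sqrt (s\<^sup>2 + (s * z)\<^sup>2) = 1 / sqrt (1 + z\<^sup>2)"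
            unfolding sq real_sqrt_mult using s by simp
          moreover have "s\<^sup>2 + (s * z)\<^sup>2 < 1 \<longleftrightarrow> s < 1 / sqrt (1 + z\<^sup>2)"
          proof -
            have "s\<^sup>2 * (1 + z\<^sup>2) < 1 \<longleftrightarrow> sqrt (s\<^sup>2 * (1 + z\<^sup>2)) < 1"
              by simp
            also have "sqrt (s\<^sup>2 * (1 + z\<^sup>2)) = s * sqrt (1 + z\<^sup>2)"
              using s by (simp add: real_sqrt_mult)
            finally show ?thesis
              unfolding sq using pos by (simp add: field_simps)
          qed
          moreover have "ennreal s * ennreal (\<omega> * (s * z) ^ (d - 1)) = ennreal (\<omega> * z ^ (d - 1)) * ennreal (s ^ d)"
          proof -
            have "s * (\<omega> * (s * z) ^ (d - 1)) = \<omega> * z ^ (d - 1) * s ^ d"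
              using dim(2) by (cases d) (simp_all add: power_mult_distrib)
            then show ?thesis
              using s z \<omega> by (simp flip: ennreal_mult)
          qed
          ultimately show ?thesis
            using s z by (auto simp: G_def indicator_def mult_ac) (metis mult.assoc mult.commute)+
        qed
      qed
      finally show ?thesis .
    qed
  qed
  also have "\<dots> = (\<integral>\<^sup>+z. \<integral>\<^sup>+s. f (1 / sqrt (1 + z\<^sup>2)) * ennreal (\<omega> * z ^ (d - 1)) * indicator {0<..} z
        * (ennreal (s ^ d) * indicator {0<..<1 / sqrt (1 + z\<^sup>2)} s) \<partial>lborel \<partial>lborel)"
    by (rule lborel_pair.Fubini') (unfold indicator_def greaterThanLessThan_iff of_bool_def, measurable)
  also have "\<dots> = (\<integral>\<^sup>+z. f (1 / sqrt (1 + z\<^sup>2)) * ennreal (\<omega> * z ^ (d - 1)) * indicator {0<..} z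
        * (\<integral>\<^sup>+s. ennreal (s ^ d) * indicator {0<..<1 / sqrt (1 + z\<^sup>2)} s \<partial>lborel) \<partial>lborel)"
    by (intro nn_integral_cong nn_integral_cmult) measurable
  also have "\<dots> = (\<integral>\<^sup>+z. f (1 / sqrt (1 + z\<^sup>2)) * ennreal (\<omega> * z ^ (d - 1)) * indicator {0<..} z
        * ennreal (1 / (real (Suc d) * sqrt (1 + z\<^sup>2) ^ Suc d)) \<partial>lborel)"
  proof -
    have "(\<integral>\<^sup>+s. ennreal (s ^ d) * indicator {0<..<c} s \<partial>lborel) = ennreal (c ^ Suc d / real (Suc d))" if "c > 0" for c :: real
    proof -
      have "(\<integral>\<^sup>+s. ennreal (s ^ d) * indicator {0<..<c} s \<partial>lborel) = (\<integral>\<^sup>+s. ennreal (s ^ d) * indicator {0..c} s \<partial>lborel)"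
      proof (rule nn_integral_cong_AE)
        have "AE x in lborel. x \<noteq> (0::real)" "AE x in lborel. x \<noteq> c"
          by (rule AE_lborel_singleton)+
        then show "AE x in lborel. ennreal (x ^ d) * indicator {0<..<c} x = ennreal (x ^ d) * indicator {0..c} x"
          by eventually_elim (auto simp: indicator_def)
      qed
      also have "\<dots> = ennreal (c ^ Suc d / real (Suc d) - 0 ^ Suc d / real (Suc d))"
      proof (rule nn_integral_FTC_Icc)
        show "((\<lambda>s. s ^ Suc d / real (Suc d)) has_real_derivative s ^ d) (at s)" for s
          using DERIV_cdivide[OF DERIV_pow[of "Suc d" s UNIV], of "real (Suc d)"]
          by (simp del: of_nat_Suc power_Suc)
      qed (use that in auto)
      finally show ?thesis by simp
    qed
    moreover have "1 / sqrt (1 + z\<^sup>2) > 0" for z :: real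
      by (simp add: add_pos_nonneg)
    ultimately show ?thesis
      by (simp add: power_one_over del: of_nat_Suc power_Suc) (simp add: mult.commute del: of_nat_Suc power_Suc)
  qed
  also have "of_nat (Suc d) * \<dots> = (\<integral>\<^sup>+z. of_nat (Suc d) * (f (1 / sqrt (1 + z\<^sup>2)) * ennreal (\<omega> * z ^ (d - 1)) * indicator {0<..} z
        * ennreal (1 / (real (Suc d) * sqrt (1 + z\<^sup>2) ^ Suc d))) \<partial>lborel)"
    by (rule nn_integral_cmult[symmetric]) measurable
  also have "\<dots> = (\<integral>\<^sup>+z. f (1 / sqrt (1 + z\<^sup>2)) * ennreal (\<omega> * z ^ (d - 1) / sqrt (1 + z\<^sup>2) ^ Suc d)
          * indicator {0<..} z \<partial>lborel)"
  proof (rule nn_integral_cong)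
    fix z :: real
    define w where "w = sqrt (1 + z\<^sup>2) ^ Suc d"
    have w: "w > 0"
      unfolding w_def by (intro zero_less_power) (simp add: add_pos_nonneg)
    have key: "of_nat (Suc d) * (ennreal (\<omega> * z ^ (d - 1)) * ennreal (1 / (real (Suc d) * w))) = ennreal (\<omega> * z ^ (d - 1) / w)"
      if "z > 0"
    proof -
      have "of_nat (Suc d) * (ennreal (\<omega> * z ^ (d - 1)) * ennreal (1 / (real (Suc d) * w)))
          = ennreal (real (Suc d) * (\<omega> * z ^ (d - 1) * (1 / (real (Suc d) * w))))"
      proof -
        have nn: "0 \<le> \<omega> * z ^ (d - 1)" "0 \<le> 1 / (real (Suc d) * w)" "0 \<le> real (Suc d)"
          using \<omega> w that by auto
        show ?thesis
          unfolding ennreal_of_nat_eq_real_of_nat ennreal_mult[OF nn(1,2), symmetric]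
          by (rule ennreal_mult[symmetric]) (use nn in auto)
      qed
      also have "real (Suc d) * (\<omega> * z ^ (d - 1) * (1 / (real (Suc d) * w))) = \<omega> * z ^ (d - 1) / w"
        by (simp del: of_nat_Suc)
      finally show ?thesis .
    qed
    show "of_nat (Suc d) * (f (1 / sqrt (1 + z\<^sup>2)) * ennreal (\<omega> * z ^ (d - 1)) * indicator {0<..} z
        * ennreal (1 / (real (Suc d) * sqrt (1 + z\<^sup>2) ^ Suc d)))
        = f (1 / sqrt (1 + z\<^sup>2)) * ennreal (\<omega> * z ^ (d - 1) / sqrt (1 + z\<^sup>2) ^ Suc d) * indicator {0<..} z"
    proof (cases "z > 0")
      case True
      then show ?thesis
        unfolding w_def[symmetric] key[OF True, symmetric] by (simp add: mult_ac)
    qed simp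
  qed
  finally show ?thesis
    by (simp add: \<omega>_def)
qed


lemma nn_integral_zonal:
  fixes v :: "real^'m" and f :: "real \<Rightarrow> ennreal"
  assumes v: "norm v = 1" and dim: "CARD('m) = Suc d" "d > 0"
    and f: "f \<in> borel_measurable borel" and f0: "\<And>t. t \<le> 0 \<Longrightarrow> f t = 0"
  shows "(\<integral>\<^sup>+x. f (x \<bullet> v) \<partial>sphere_measure)
    = (\<integral>\<^sup>+z. f (1 / sqrt (1 + z\<^sup>2)) * ennreal (real d * unit_ball_vol d * z ^ (d - 1) / sqrt (1 + z\<^sup>2) ^ Suc d)
          * indicator {0<..} z \<partial>lborel)"
proof -
  obtain e :: "real^'m" where e: "e \<in> Basis"
    using nonempty_Basis by blast
  then obtain T where T: "orthogonal_transformation T" "T e = v"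
    using orthogonal_transformation_exists[of e v] v by auto
  have m: "(\<lambda>x. f (x \<bullet> v)) \<in> borel_measurable borel"
    by (rule measurable_compose[OF _ f]) measurable
  have "(\<integral>\<^sup>+x. f (x \<bullet> v) \<partial>sphere_measure) = (\<integral>\<^sup>+x. f (T x \<bullet> v) \<partial>sphere_measure)"
    by (rule nn_integral_sphere_orthogonal[OF T(1) m, symmetric])
  also have "\<dots> = (\<integral>\<^sup>+x. f (x \<bullet> e) \<partial>sphere_measure)"
    using T by (auto simp: orthogonal_transformation_def)
  finally show ?thesis
    using nn_integral_zonal_Basis[OF e _ dim(2) f f0] dim by simp
qed

lemma integral_zonal:
  fixes v :: "real^'m" and f :: "real \<Rightarrow> real"
  assumes v: "norm v = 1" and dim: "CARD('m) = Suc d" "d > 0"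
    and f[measurable]: "f \<in> borel_measurable borel"
    and f0: "\<And>t. t \<le> 0 \<Longrightarrow> f t = 0" and f_nonneg: "\<And>t. f t \<ge> 0"
  shows "(LINT x|sphere_measure. f (x \<bullet> v))
    = (LINT z|lborel. indicator {0<..} z *
         (f (1 / sqrt (1 + z\<^sup>2)) * (real d * unit_ball_vol d * z ^ (d - 1) / sqrt (1 + z\<^sup>2) ^ Suc d)))"
    (is "_ = (LINT z|lborel. ?g z)")
proof -
  have "(\<lambda>x. f (x \<bullet> v)) \<in> borel_measurable borel"
    by measurable
  then have "(LINT x|sphere_measure. f (x \<bullet> v)) = enn2real (\<integral>\<^sup>+x. ennreal (f (x \<bullet> v)) \<partial>sphere_measure)"
    using f_nonneg by (intro integral_eq_nn_integral measurable_sphere_measure) auto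
  also have "(\<integral>\<^sup>+x. ennreal (f (x \<bullet> v)) \<partial>sphere_measure) = (\<integral>\<^sup>+z. ennreal (?g z) \<partial>lborel)"
  proof -
    have "ennreal (f (1 / sqrt (1 + z\<^sup>2))) * ennreal (real d * unit_ball_vol d * z ^ (d - 1) / sqrt (1 + z\<^sup>2) ^ Suc d)
          * indicator {0<..} z = ennreal (?g z)" for z
    proof (cases "z > 0")
      case True
      have "ennreal (f (1 / sqrt (1 + z\<^sup>2))) * ennreal (real d * unit_ball_vol d * z ^ (d - 1) / sqrt (1 + z\<^sup>2) ^ Suc d)
          = ennreal (f (1 / sqrt (1 + z\<^sup>2)) * (real d * unit_ball_vol d * z ^ (d - 1) / sqrt (1 + z\<^sup>2) ^ Suc d))"
        using True f_nonneg by (intro ennreal_mult[symmetric]) auto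
      then show ?thesis
        using True by (simp del: power_Suc)
    qed simp
    then show ?thesis
      using nn_integral_zonal[OF v dim, of "\<lambda>t. ennreal (f t)"] f0 by (simp del: power_Suc)
  qed
  also have "enn2real \<dots> = (LINT z|lborel. ?g z)"
  proof (rule integral_eq_nn_integral[symmetric])
    show "?g \<in> borel_measurable lborel"
      by measurable
    show "AE z in lborel. 0 \<le> ?g z"
      using f_nonneg by (intro AE_I2) (auto simp: indicator_def)
  qed
  finally show ?thesis .
qed

text \<open>
  For large \<open>j\<close> the function \<open>\<Phi>\<close> of the scaled chordal distance lives in a small cap, which is
  asymptotically a Euclidean ball of dimension \<open>d\<close>.
\<close>

lemma sphere_concentration:
  fixes v :: "real^'m" and \<Phi> :: "real \<Rightarrow> real"
  assumes v: "norm v = 1" and dim: "CARD('m) = Suc d" "d > 0"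
    and cont: "continuous_on UNIV \<Phi>" and nonneg: "\<And>r. \<Phi> r \<ge> 0"
    and R: "\<And>r. r \<ge> R \<Longrightarrow> \<Phi> r = 0" "R > 0"
  shows "(\<lambda>j. real (Suc j) ^ d * (LINT x|sphere_measure. \<Phi> (real (Suc j) * norm (x - v))))
     \<longlonglongrightarrow> real d * unit_ball_vol d * (LINT s|lborel. indicator {0<..} s * (\<Phi> s * s ^ (d - 1)))"
proof -
  define \<omega> where "\<omega> = real d * unit_ball_vol d"
  have \<omega>: "\<omega> \<ge> 0" by (simp add: \<omega>_def)
  have \<Phi>m[measurable]: "\<Phi> \<in> borel_measurable borel"
    by (rule borel_measurable_continuous_onI[OF cont])
  define w where "w j s = sqrt (1 + (s / real (Suc j))\<^sup>2)" for j s
  define c where "c j s = sqrt (2 / (w j s * (w j s + 1)))" for j s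
  define g where "g j s = indicator {0<..} s * (\<Phi> (s * c j s) * (\<omega> * s ^ (d - 1) / w j s ^ Suc d))" for j s
  have w1: "w j s \<ge> 1" for j s
    unfolding w_def by simp
  have [measurable]: "w j \<in> borel_measurable borel" for j
    unfolding w_def[abs_def] by measurable
  have [measurable]: "c j \<in> borel_measurable borel" for j
    unfolding c_def[abs_def] by measurable
  have gm: "g j \<in> borel_measurable borel" for j
    unfolding g_def[abs_def] by measurable
  \<comment> \<open>\<open>w\<close> is \<open>1 / cos \<theta>\<close> at \<open>tan \<theta> = s / real (Suc j)\<close>, and \<open>s * c j s\<close> is the scaled chordal distance\<close>
  have chord: "real (Suc j) * sqrt (2 - 2 * (1 / w j s)) = s * c j s" if "s \<ge> 0" for j s
  proof -
    have w2: "(w j s)\<^sup>2 - 1 = (s / real (Suc j))\<^sup>2"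
      unfolding w_def by (subst real_sqrt_pow2) auto
    have "2 - 2 * (1 / w j s) = ((w j s)\<^sup>2 - 1) * (2 / (w j s * (w j s + 1)))"
    proof -
      have nz: "w j s \<noteq> 0" "w j s + 1 \<noteq> 0"
        using w1[of j s] by linarith+
      have "2 - 2 * (1 / w j s) = ((w j s - 1) * (w j s + 1)) * (2 / (w j s * (w j s + 1)))"
        using nz by (simp add: diff_divide_distrib)
      also have "(w j s - 1) * (w j s + 1) = (w j s)\<^sup>2 - 1"
        by (simp add: algebra_simps power2_eq_square)
      finally show ?thesis .
    qed
    also have "sqrt \<dots> = s / real (Suc j) * c j s"
      unfolding w2 c_def real_sqrt_mult real_sqrt_abs using that by simp
    finally show ?thesis by simp
  qed
  have eq: "real (Suc j) ^ d * (LINT x|sphere_measure. \<Phi> (real (Suc j) * norm (x - v))) = (LINT s|lborel. g j s)"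
    if j: "real j \<ge> R" for j
  proof -
    define f where "f t = \<Phi> (real (Suc j) * sqrt (2 - 2 * t))" for t
    have fm: "f \<in> borel_measurable borel"
      unfolding f_def[abs_def] by measurable
    have f0: "f t = 0" if "t \<le> 0" for t
    proof -
      have "1 \<le> sqrt (2 - 2 * t)"
        using that by simp
      then have "real (Suc j) * 1 \<le> real (Suc j) * sqrt (2 - 2 * t)"
        by (intro mult_left_mono) auto
      moreover have "R \<le> real (Suc j) * 1"
        using j by simp
      ultimately show ?thesis
        unfolding f_def by (intro R(1)) (rule order_trans)
    qed
    have "norm (x - v) = sqrt (2 - 2 * (x \<bullet> v))" if "norm x = 1" for x
      using that v by (simp add: norm_eq_sqrt_inner inner_diff_left inner_diff_right inner_commute)
    then have "(LINT x|sphere_measure. \<Phi> (real (Suc j) * norm (x - v))) = (LINT x|sphere_measure. f (x \<bullet> v))"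
      by (intro Bochner_Integration.integral_cong) (auto simp: f_def)
    also have "\<dots> = (LINT z|lborel. indicator {0<..} z *
         (f (1 / sqrt (1 + z\<^sup>2)) * (\<omega> * z ^ (d - 1) / sqrt (1 + z\<^sup>2) ^ Suc d)))"
      unfolding \<omega>_def by (rule integral_zonal[OF v dim fm f0]) (simp_all add: f_def nonneg)
    also have "\<dots> = \<bar>1 / real (Suc j)\<bar> *\<^sub>R (LINT s|lborel. indicator {0<..} (0 + 1 / real (Suc j) * s) *
         (f (1 / sqrt (1 + (0 + 1 / real (Suc j) * s)\<^sup>2)) * (\<omega> * (0 + 1 / real (Suc j) * s) ^ (d - 1)
            / sqrt (1 + (0 + 1 / real (Suc j) * s)\<^sup>2) ^ Suc d)))"
      by (rule lborel_integral_real_affine) simp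
    also have "\<dots> = 1 / real (Suc j) * (LINT s|lborel. (1 / real (Suc j)) ^ (d - 1) * g j s)"
    proof -
      have "indicator {0<..} (0 + 1 / real (Suc j) * s) *
         (f (1 / sqrt (1 + (0 + 1 / real (Suc j) * s)\<^sup>2)) * (\<omega> * (0 + 1 / real (Suc j) * s) ^ (d - 1)
            / sqrt (1 + (0 + 1 / real (Suc j) * s)\<^sup>2) ^ Suc d)) = (1 / real (Suc j)) ^ (d - 1) * g j s" for s
      proof (cases "s > 0")
        case True
        have z: "0 + 1 / real (Suc j) * s = s / real (Suc j)"
          by simp
        have "f (1 / w j s) = \<Phi> (s * c j s)"
          using chord[of s j] True by (simp add: f_def)
        then show ?thesis
          using True unfolding z w_def[symmetric] g_def
          by (simp add: power_divide del: of_nat_Suc power_Suc)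
      qed (simp add: g_def zero_less_divide_iff del: of_nat_Suc)
      then show ?thesis by simp
    qed
    finally have "(LINT x|sphere_measure. \<Phi> (real (Suc j) * norm (x - v)))
        = (1 / real (Suc j)) ^ d * (LINT s|lborel. g j s)"
      using dim(2) by (cases d) (simp_all del: of_nat_Suc)
    then show ?thesis
      by (simp add: power_one_over del: of_nat_Suc)
  qed
  obtain B where B: "\<And>r. 0 \<le> r \<Longrightarrow> r \<le> R \<Longrightarrow> \<Phi> r \<le> B"
  proof -
    have "\<exists>x\<in>{0..R}. \<forall>y\<in>{0..R}. \<Phi> y \<le> \<Phi> x"
      using R(2) by (intro continuous_attains_sup continuous_on_subset[OF cont]) auto
    then obtain x where "\<forall>y\<in>{0..R}. \<Phi> y \<le> \<Phi> x"
      by blast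
    then show thesis
      by (intro that[of "\<Phi> x"]) auto
  qed
  have wlim: "(\<lambda>j. w j s) \<longlonglongrightarrow> 1" for s
  proof -
    have "(\<lambda>j. s / real (Suc j)) \<longlonglongrightarrow> 0"
      by (rule LIMSEQ_Suc[OF lim_const_over_n])
    then have "(\<lambda>j. w j s) \<longlonglongrightarrow> sqrt (1 + 0\<^sup>2)"
      unfolding w_def by (intro tendsto_intros)
    then show ?thesis by simp
  qed
  have glim: "(\<lambda>j. g j s) \<longlonglongrightarrow> indicator {0<..} s * (\<Phi> s * (\<omega> * s ^ (d - 1)))" for s
  proof -
    have "(\<lambda>j. c j s) \<longlonglongrightarrow> sqrt (2 / (1 * (1 + 1)))"
      unfolding c_def by (intro tendsto_intros wlim) auto
    then have "(\<lambda>j. s * c j s) \<longlonglongrightarrow> s * 1"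
      by (intro tendsto_intros) simp
    then have "(\<lambda>j. \<Phi> (s * c j s)) \<longlonglongrightarrow> \<Phi> s"
      using continuous_on_tendsto_compose[OF cont, of "\<lambda>j. s * c j s" s] by simp
    then have "(\<lambda>j. g j s) \<longlonglongrightarrow> indicator {0<..} s * (\<Phi> s * (\<omega> * s ^ (d - 1) / 1 ^ Suc d))"
      unfolding g_def by (intro tendsto_intros wlim) auto
    then show ?thesis by simp
  qed
  \<comment> \<open>the integrand vanishes unless the chord is shorter than \<open>1\<close>; then \<open>w j s < 2\<close>, so \<open>s < 2 * R\<close>\<close>
  have gbound: "\<bar>g j s\<bar> \<le> B * (\<omega> * (2 * R) ^ (d - 1)) * indicator {0..2 * R} s" if j: "real j \<ge> R" for j s
  proof (cases "s > 0 \<and> \<Phi> (s * c j s) \<noteq> 0")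
    case False
    have "B \<ge> 0"
      using B[of 0] nonneg[of 0] R(2) by linarith
    then show ?thesis
      using False \<omega> R(2) by (auto simp: g_def indicator_def)
  next
    case True
    then have s: "s > 0" and sc: "s * c j s < R"
      using R(1)[of "s * c j s"] by force+
    have c0: "c j s \<ge> 0"
      unfolding c_def using w1[of j s] by simp
    have "real (Suc j) * sqrt (2 - 2 * (1 / w j s)) < real (Suc j) * 1"
      using chord[of s j] s sc j by simp
    then have "sqrt (2 - 2 * (1 / w j s)) < 1"
      by (simp del: of_nat_Suc)
    then have "w j s < 2"
      using w1[of j s] by (simp add: field_simps)
    then have "w j s * (w j s + 1) \<le> 2 * 3"
      using w1[of j s] by (intro mult_mono) auto
    moreover have "0 < w j s * (w j s + 1)"
      using w1[of j s] by (intro mult_pos_pos) linarith+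
    ultimately have "1 / 4 \<le> 2 / (w j s * (w j s + 1))"
      by (simp only: pos_le_divide_eq)
    then have "sqrt (1 / 4) \<le> c j s"
      unfolding c_def by (rule real_sqrt_le_mono)
    then have "1 / 2 \<le> c j s"
      by (simp add: real_sqrt_divide)
    then have "s * (1 / 2) \<le> s * c j s"
      using s by (intro mult_left_mono) auto
    then have s2: "s \<le> 2 * R"
      using sc by simp
    have "\<omega> * s ^ (d - 1) / w j s ^ Suc d \<le> \<omega> * s ^ (d - 1) / 1"
      using w1[of j s] \<omega> s by (intro divide_left_mono) (auto intro!: mult_nonneg_nonneg one_le_power simp del: power_Suc)
    also have "\<dots> \<le> \<omega> * (2 * R) ^ (d - 1)"
      unfolding div_by_1 using s s2 \<omega> by (intro mult_left_mono power_mono) auto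
    finally have "\<Phi> (s * c j s) * (\<omega> * s ^ (d - 1) / w j s ^ Suc d) \<le> B * (\<omega> * (2 * R) ^ (d - 1))"
      using B[of "s * c j s"] nonneg[of "s * c j s"] s c0 sc \<omega> w1[of j s]
      by (intro mult_mono) (auto simp del: power_Suc)
    moreover have "0 \<le> \<Phi> (s * c j s) * (\<omega> * s ^ (d - 1) / w j s ^ Suc d)"
      using s \<omega> nonneg w1[of j s] by (intro mult_nonneg_nonneg divide_nonneg_nonneg) auto
    ultimately show ?thesis
      using s s2 by (simp add: g_def del: power_Suc)
  qed
  obtain j0 :: nat where j0: "real j0 \<ge> R"
    using real_arch_simple by blast
  have "(\<lambda>j. LINT s|lborel. g (j + j0) s) \<longlonglongrightarrow> (LINT s|lborel. indicator {0<..} s * (\<Phi> s * (\<omega> * s ^ (d - 1))))"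
  proof (rule integral_dominated_convergence[where w = "\<lambda>s. B * (\<omega> * (2 * R) ^ (d - 1)) * indicator {0..2 * R} s"])
    show "integrable lborel (\<lambda>s. B * (\<omega> * (2 * R) ^ (d - 1)) * indicator {0..2 * R} s)"
      using R(2) by (intro integrable_mult_right integrable_real_indicator) (simp_all add: emeasure_lborel_Icc_eq)
    show "AE s in lborel. (\<lambda>j. g (j + j0) s) \<longlonglongrightarrow> indicator {0<..} s * (\<Phi> s * (\<omega> * s ^ (d - 1)))"
      using glim by (intro AE_I2 LIMSEQ_ignore_initial_segment)
    show "AE s in lborel. norm (g (j + j0) s) \<le> B * (\<omega> * (2 * R) ^ (d - 1)) * indicator {0..2 * R} s" for j
      using gbound[of "j + j0"] j0 by (intro AE_I2) simp
  qed (use gm in measurable)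
  also have "(LINT s|lborel. indicator {0<..} s * (\<Phi> s * (\<omega> * s ^ (d - 1))))
     = \<omega> * (LINT s|lborel. indicator {0<..} s * (\<Phi> s * s ^ (d - 1)))"
    by (subst integral_mult_right_zero[symmetric]) (simp add: mult_ac)
  finally have "(\<lambda>j. LINT s|lborel. g (j + j0) s) \<longlonglongrightarrow> \<dots>" .
  moreover have "(LINT s|lborel. g (j + j0) s)
     = real (Suc (j + j0)) ^ d * (LINT x|sphere_measure. \<Phi> (real (Suc (j + j0)) * norm (x - v)))" for j
    using eq[of "j + j0"] j0 by simp
  ultimately have "(\<lambda>j. real (Suc (j + j0)) ^ d * (LINT x|sphere_measure. \<Phi> (real (Suc (j + j0)) * norm (x - v))))
      \<longlonglongrightarrow> \<omega> * (LINT s|lborel. indicator {0<..} s * (\<Phi> s * s ^ (d - 1)))"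
    by (simp only:)
  then show ?thesis
    unfolding \<omega>_def[symmetric] by (rule LIMSEQ_offset)
qed

section \<open>The regular simplex as a design of degree two\<close>

text \<open>
  Reflection in the hyperplane orthogonal to \<open>a\<close>; the identity if \<open>a = 0\<close>.
\<close>

definition reflection :: "'a::real_inner \<Rightarrow> 'a \<Rightarrow> 'a" where
  "reflection a x = x - (2 * (x \<bullet> a) / (a \<bullet> a)) *\<^sub>R a"

lemma orthogonal_reflection: "orthogonal_transformation (reflection (a::'a::euclidean_space))"
  unfolding orthogonal_transformation_def
proof (intro conjI allI)
  show "linear (reflection a)"
    unfolding reflection_def
    by (rule linearI) (simp_all add: inner_add_left algebra_simps add_divide_distrib)
  show "reflection a x \<bullet> reflection a y = x \<bullet> y" for x y
  proof (cases "a = 0")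
    case False
    then show ?thesis
      by (simp add: reflection_def inner_diff_left inner_diff_right inner_commute field_simps)
  qed (simp add: reflection_def)
qed

lemma inner_reflection_normal: "reflection a x \<bullet> a = - (x \<bullet> a)"
  by (cases "a = 0") (simp_all add: reflection_def inner_diff_left)

lemma inner_reflection_orthogonal: "a \<bullet> b = 0 \<Longrightarrow> reflection a x \<bullet> b = x \<bullet> b"
  by (simp add: reflection_def inner_diff_left)

lemma integral_sphere_radial_rotation:
  fixes v v' :: "real^'m" and \<Phi> :: "real \<Rightarrow> real"
  assumes "norm v = 1" "norm v' = 1" "continuous_on UNIV \<Phi>"
  shows "(LINT x|sphere_measure. \<Phi> (norm (x - v))) = (LINT x|sphere_measure. \<Phi> (norm (x - v')))"
proof -
  obtain T where T: "orthogonal_transformation T" "T v = v'"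
    using orthogonal_transformation_exists[of v v'] assms by auto
  have m: "(\<lambda>x. \<Phi> (norm (x - v'))) \<in> borel_measurable borel"
    by (rule measurable_compose[OF _ borel_measurable_continuous_onI[OF assms(3)]]) measurable
  have "norm (T x - v') = norm (x - v)" for x
    using orthogonal_transformation_norm[OF T(1), of "x - v"] T(2)
    by (simp add: linear_diff[OF orthogonal_transformation_linear[OF T(1)]])
  then show ?thesis
    using integral_sphere_orthogonal[OF T(1) m] by simp
qed

text \<open>
  The reflection along \<open>a\<close> fixes \<open>v\<close> and \<open>b\<close> and changes the sign of \<open>x \<bullet> a\<close>.
\<close>

lemma integral_sphere_odd:
  fixes a b v :: "real^'m" and K :: "real \<Rightarrow> real"
  assumes K: "continuous_on UNIV K" and a: "a \<bullet> v = 0" "a \<bullet> b = 0"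
  shows "(LINT x|sphere_measure. (x \<bullet> a) * (c + x \<bullet> b) * K (norm (x - v))) = 0"
proof -
  have R: "orthogonal_transformation (reflection a)"
    by (rule orthogonal_reflection)
  have v: "reflection a v = v"
    using a by (simp add: reflection_def inner_commute)
  have "norm (reflection a x - v) = norm (x - v)" for x
    using orthogonal_transformation_norm[OF R, of "x - v"] v
    by (simp add: linear_diff[OF orthogonal_transformation_linear[OF R]])
  moreover have "reflection a x \<bullet> b = x \<bullet> b" for x
    using a by (intro inner_reflection_orthogonal)
  moreover have m: "(\<lambda>x. (x \<bullet> a) * (c + x \<bullet> b) * K (norm (x - v))) \<in> borel_measurable borel"
    by (intro borel_measurable_continuous_onI continuous_intros continuous_on_compose2[OF K]) auto
  ultimately show ?thesis
    using integral_sphere_orthogonal[OF R m] by (simp add: inner_reflection_normal)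
qed

lemma integral_sphere_first_moment:
  fixes a v :: "real^'m" and K :: "real \<Rightarrow> real"
  assumes K: "continuous_on UNIV K" and v: "norm v = 1"
  shows "(LINT x|sphere_measure. (x \<bullet> a) * K (norm (x - v)))
     = (a \<bullet> v) * (LINT x|sphere_measure. (x \<bullet> v) * K (norm (x - v)))"
proof -
  define a' where "a' = a - (a \<bullet> v) *\<^sub>R v"
  have "a' \<bullet> v = 0"
    using v by (simp add: a'_def inner_diff_left norm_eq_1)
  then have 0: "(LINT x|sphere_measure. (x \<bullet> a') * K (norm (x - v))) = 0"
    using integral_sphere_odd[OF K, of a' v 0 1] by simp
  have int: "integrable sphere_measure (\<lambda>x. (x \<bullet> b) * K (norm (x - v)))" for b
    by (intro integrable_sphere_measure_continuous continuous_intros continuous_on_compose2[OF K]) auto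
  have "(LINT x|sphere_measure. (x \<bullet> a) * K (norm (x - v)))
      = (LINT x|sphere_measure. (x \<bullet> a') * K (norm (x - v)) + (a \<bullet> v) * ((x \<bullet> v) * K (norm (x - v))))"
    by (simp add: a'_def inner_diff_right algebra_simps)
  also have "\<dots> = (LINT x|sphere_measure. (x \<bullet> a') * K (norm (x - v)))
     + (a \<bullet> v) * (LINT x|sphere_measure. (x \<bullet> v) * K (norm (x - v)))"
    by (subst Bochner_Integration.integral_add) (auto intro: int)
  finally show ?thesis
    by (simp add: 0)
qed

text \<open>
  By symmetry around the axis \<open>v\<close> the second moments form a matrix \<open>A v v\<^sup>T + \<beta> (1 - v v\<^sup>T)\<close>; taking the trace
  expresses \<open>\<beta>\<close> through the total mass \<open>\<kappa>\<close> and \<open>A\<close>.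
\<close>

lemma integral_sphere_second_moment:
  fixes a v :: "real^'m" and K :: "real \<Rightarrow> real"
  assumes K: "continuous_on UNIV K" and v: "norm v = 1" and m: "CARD('m) > 1"
  defines "A \<equiv> LINT x|sphere_measure. (x \<bullet> v)\<^sup>2 * K (norm (x - v))"
    and "\<kappa> \<equiv> LINT x|sphere_measure. K (norm (x - v))"
  shows "(LINT x|sphere_measure. (x \<bullet> a)\<^sup>2 * K (norm (x - v)))
     = (a \<bullet> v)\<^sup>2 * A + (a \<bullet> a - (a \<bullet> v)\<^sup>2) * ((\<kappa> - A) / (real CARD('m) - 1))"
proof -
  define T where "T a b = (LINT x|sphere_measure. (x \<bullet> a) * (x \<bullet> b) * K (norm (x - v)))" for a b
  have int: "integrable sphere_measure (\<lambda>x. (x \<bullet> a) * (x \<bullet> b) * K (norm (x - v)))" for a b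
    by (intro integrable_sphere_measure_continuous continuous_intros continuous_on_compose2[OF K]) auto
  have vv: "v \<bullet> v = 1"
    using v by (simp add: norm_eq_1)
  have sym: "T a b = T b a" for a b
    unfolding T_def by (simp add: mult_ac)
  have add: "T (a + b) c = T a c + T b c" for a b c
    unfolding T_def using int[of a c] int[of b c] by (simp add: inner_add_right distrib_right)
  have scale: "T (r *\<^sub>R a) c = r * T a c" for a c r
    unfolding T_def by (simp add: mult.assoc)
  have diff: "T (a - b) c = T a c - T b c" for a b c
    using add[of a "- b" c] scale[of "-1" b c] by simp
  have orth: "T a b = 0" if "a \<bullet> v = 0" "a \<bullet> b = 0" for a b
    using integral_sphere_odd[OF K that, of 0] by (simp add: T_def)
  have same: "T a a = T b b" if "a \<bullet> v = 0" "b \<bullet> v = 0" "norm a = norm b" for a b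
  proof -
    \<comment> \<open>for vectors of equal norm, sum and difference are orthogonal\<close>
    have "T (a + b) (a - b) = 0"
      using that
      by (intro orth) (simp_all add: inner_add_left inner_add_right inner_diff_right norm_eq inner_commute[of b a])
    then have "T a (a - b) + T b (a - b) = 0"
      by (simp add: add)
    moreover have "T a (a - b) = T a a - T a b" "T b (a - b) = T a b - T b b"
      using diff[of a b a] diff[of a b b] sym by metis+
    ultimately show ?thesis by simp
  qed
  obtain \<beta> where \<beta>: "\<And>a. a \<bullet> v = 0 \<Longrightarrow> T a a = \<beta> * (a \<bullet> a)"
  proof (cases "\<exists>e. e \<bullet> v = 0 \<and> norm e = 1")
    case True
    then obtain e where e: "e \<bullet> v = 0" "norm e = 1"
      by blast
    have "T a a = T e e * (a \<bullet> a)" if "a \<bullet> v = 0" for a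
    proof -
      have "T a a = T (norm a *\<^sub>R e) (norm a *\<^sub>R e)"
        using that e by (intro same) auto
      also have "\<dots> = T e e * (norm a)\<^sup>2"
        by (simp add: scale sym[of e "norm a *\<^sub>R e"] power2_eq_square)
      finally show ?thesis
        by (simp add: power2_norm_eq_inner)
    qed
    then show thesis by (rule that)
  next
    case False
    have "T a a = 0 * (a \<bullet> a)" if a: "a \<bullet> v = 0" for a
    proof -
      have "a = 0"
      proof (rule ccontr)
        assume "a \<noteq> 0"
        then have "sgn a \<bullet> v = 0 \<and> norm (sgn a) = 1"
          using a by (simp add: sgn_div_norm norm_sgn)
        then show False
          using False by blast
      qed
      then show ?thesis
        by (simp add: T_def)
    qed
    then show thesis by (rule that)
  qed
  have quad: "T a a = (a \<bullet> v)\<^sup>2 * A + (a \<bullet> a - (a \<bullet> v)\<^sup>2) * \<beta>" for a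
  proof -
    define a' where "a' = a - (a \<bullet> v) *\<^sub>R v"
    have a': "a' \<bullet> v = 0"
      by (simp add: a'_def inner_diff_left vv)
    have "T a a = T (a' + (a \<bullet> v) *\<^sub>R v) a"
      by (simp add: a'_def)
    also have "\<dots> = T a a' + (a \<bullet> v) * T a v"
      by (simp only: add scale sym[of a' a] sym[of v a])
    also have "T a a' = T (a' + (a \<bullet> v) *\<^sub>R v) a'"
      by (simp add: a'_def)
    also have "\<dots> = T a' a' + (a \<bullet> v) * T a' v"
      by (simp only: add scale sym[of v a'])
    also have "T a v = T (a' + (a \<bullet> v) *\<^sub>R v) v"
      by (simp add: a'_def)
    also have "\<dots> = T a' v + (a \<bullet> v) * T v v"
      by (simp only: add scale)
    also have "T a' v = 0"
      using a' by (intro orth)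
    also have "T a' a' = \<beta> * (a' \<bullet> a')"
      by (rule \<beta>[OF a'])
    also have "a' \<bullet> a' = a \<bullet> a - (a \<bullet> v)\<^sup>2"
      by (simp add: a'_def inner_diff_left inner_diff_right vv inner_commute power2_eq_square)
    also have "T v v = A"
      unfolding T_def A_def by (simp add: power2_eq_square)
    finally show ?thesis
      by (simp add: power2_eq_square algebra_simps)
  qed
  have "\<kappa> = (LINT x|sphere_measure. (\<Sum>b\<in>Basis. (x \<bullet> b) * (x \<bullet> b) * K (norm (x - v))))"
    unfolding \<kappa>_def
  proof (rule Bochner_Integration.integral_cong)
    fix x :: "real^'m" assume "x \<in> space sphere_measure"
    then have "x \<bullet> x = 1"
      by (simp add: norm_eq_1)
    then have "(\<Sum>b\<in>Basis. (x \<bullet> b) * (x \<bullet> b)) = 1"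
      by (simp only: euclidean_inner[of x x])
    then show "K (norm (x - v)) = (\<Sum>b\<in>Basis. (x \<bullet> b) * (x \<bullet> b) * K (norm (x - v)))"
      by (simp flip: sum_distrib_right)
  qed simp
  also have "\<dots> = (\<Sum>b\<in>Basis. T b b)"
    unfolding T_def by (rule Bochner_Integration.integral_sum) (rule int)
  also have "\<dots> = (\<Sum>b\<in>Basis. (b \<bullet> v)\<^sup>2) * A + (\<Sum>b\<in>(Basis :: (real^'m) set). (b \<bullet> b) - (b \<bullet> v)\<^sup>2) * \<beta>"
    unfolding quad by (simp add: sum.distrib sum_distrib_right)
  also have "(\<Sum>b\<in>Basis. (b \<bullet> v)\<^sup>2) = 1"
    using vv euclidean_inner[of v v] by (simp add: power2_eq_square inner_commute)
  finally have "\<kappa> = A + (real CARD('m) - 1) * \<beta>"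
    using \<open>(\<Sum>b\<in>Basis. (b \<bullet> v)\<^sup>2) = 1\<close> by (simp add: sum_subtractf)
  then have "\<beta> = (\<kappa> - A) / (real CARD('m) - 1)"
    using m by (simp add: field_simps)
  then show ?thesis
    using quad[of a] by (simp add: T_def power2_eq_square)
qed

text \<open>
  The vertices of a regular simplex inscribed in the unit sphere of an \<open>m\<close>-dimensional space.  The vertex
  \<open>None\<close> lies opposite to the diagonal; the other \<open>m\<close> are \<open>\<alpha>\<close> times a coordinate vector plus \<open>\<beta>\<close> times
  the vector of ones, with the constants chosen so that they have norm one and all the vertices sum to zero.
\<close>

definition simplex_vertex :: "'m option \<Rightarrow> real^'m::finite" where
  "simplex_vertex k = (let m = real CARD('m); \<alpha> = sqrt ((m + 1) / m); \<beta> = (1 / sqrt m - \<alpha>) / m in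
     case k of None \<Rightarrow> (\<chi> i. - 1 / sqrt m) | Some j \<Rightarrow> (\<chi> i. (if i = j then \<alpha> else 0) + \<beta>))"

lemma sum_UNIV_option: "(\<Sum>k\<in>UNIV. f k) = f None + (\<Sum>j\<in>(UNIV::'m::finite set). f (Some j))"
  by (simp add: UNIV_option_conv sum.reindex)

text \<open>
  The second and third claims say that the vertices have centroid zero and form a tight frame.
\<close>

lemma simplex_vertex:
  shows norm_simplex_vertex: "norm (simplex_vertex k :: real^'m::finite) = 1"
    and sum_simplex_vertex: "(\<Sum>k\<in>UNIV. simplex_vertex k \<bullet> (a :: real^'m)) = 0"
    and simplex_vertex_frame: "(\<Sum>k\<in>UNIV. (simplex_vertex k \<bullet> (a :: real^'m))\<^sup>2)
       = (real CARD('m) + 1) / real CARD('m) * (a \<bullet> a)"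
proof -
  define m where "m = real CARD('m)"
  define \<alpha> where "\<alpha> = sqrt ((m + 1) / m)"
  define \<beta> where "\<beta> = (1 / sqrt m - \<alpha>) / m"
  define s where "s = (\<Sum>i\<in>UNIV. a $ i)"
  have m: "m > 0"
    by (simp add: m_def)
  have \<alpha>2: "\<alpha>\<^sup>2 = (m + 1) / m"
    unfolding \<alpha>_def using m by (intro real_sqrt_pow2) auto
  have sm: "(1 / sqrt m)\<^sup>2 = 1 / m"
    using m by (simp add: power_divide)
  have mb: "m * \<beta> = 1 / sqrt m - \<alpha>"
    using m by (simp add: \<beta>_def)
  have "m * (2 * \<alpha> * \<beta> + m * \<beta>\<^sup>2) = 2 * \<alpha> * (m * \<beta>) + (m * \<beta>)\<^sup>2"
    by (simp add: power2_eq_square algebra_simps)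
  also have "\<dots> = (1 / sqrt m)\<^sup>2 - \<alpha>\<^sup>2"
    unfolding mb by (simp add: power2_eq_square algebra_simps)
  also have "\<dots> = - 1"
    unfolding sm \<alpha>2 using m by (simp add: field_simps)
  finally have ab: "2 * \<alpha> * \<beta> + m * \<beta>\<^sup>2 = - 1 / m"
    using m by (simp add: field_simps)
  have coords: "(simplex_vertex None :: real^'m) = (\<chi> i. - 1 / sqrt m)"
    "(simplex_vertex (Some j) :: real^'m) = (\<chi> i. (if i = j then \<alpha> else 0) + \<beta>)" for j
    by (simp_all only: simplex_vertex_def Let_def option.case m_def \<alpha>_def \<beta>_def)
  have inner_None: "(simplex_vertex None :: real^'m) \<bullet> b = - (\<Sum>i\<in>UNIV. b $ i) / sqrt m" for b
    by (simp add: coords inner_vec_def sum_negf sum_divide_distrib)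
  have inner_Some: "(simplex_vertex (Some j) :: real^'m) \<bullet> b = \<alpha> * (b $ j) + \<beta> * (\<Sum>i\<in>UNIV. b $ i)" for j b
    by (simp add: coords inner_vec_def distrib_right sum.distrib sum_distrib_left
        if_distrib[where f = "\<lambda>c. c * _"] cong: if_cong)
  have "(simplex_vertex k :: real^'m) \<bullet> simplex_vertex k = 1"
  proof (cases k)
    case k: None
    have "(\<Sum>i\<in>UNIV. (simplex_vertex None :: real^'m) $ i) = - m / sqrt m"
      by (simp add: coords m_def)
    then show ?thesis
      unfolding k inner_None using m by simp
  next
    case k: (Some j)
    have "(\<Sum>i\<in>UNIV. (simplex_vertex (Some j) :: real^'m) $ i) = \<alpha> + m * \<beta>"
      "(simplex_vertex (Some j) :: real^'m) $ j = \<alpha> + \<beta>"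
      by (simp_all add: coords sum.distrib m_def)
    then have "(simplex_vertex k :: real^'m) \<bullet> simplex_vertex k = \<alpha>\<^sup>2 + (2 * \<alpha> * \<beta> + m * \<beta>\<^sup>2)"
      unfolding k inner_Some by (simp add: power2_eq_square algebra_simps)
    also have "\<dots> = 1"
      unfolding ab \<alpha>2 using m by (simp add: field_simps)
    finally show ?thesis .
  qed
  then show "norm (simplex_vertex k :: real^'m::finite) = 1"
    by (simp add: norm_eq_1)
  have "(\<Sum>k\<in>UNIV. simplex_vertex k \<bullet> a) = - s / sqrt m + \<alpha> * s + m * \<beta> * s"
    unfolding sum_UNIV_option inner_None inner_Some s_def[symmetric]
    by (simp add: sum.distrib m_def mult.assoc flip: sum_distrib_left s_def)
  also have "\<dots> = 0"
    unfolding mb by (simp add: algebra_simps)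
  finally show "(\<Sum>k\<in>UNIV. simplex_vertex k \<bullet> a) = 0" .
  have "(\<Sum>k\<in>UNIV. (simplex_vertex k \<bullet> a)\<^sup>2)
     = s\<^sup>2 * (1 / sqrt m)\<^sup>2 + (\<Sum>j\<in>UNIV. \<alpha>\<^sup>2 * (a $ j)\<^sup>2 + 2 * \<alpha> * \<beta> * s * (a $ j) + \<beta>\<^sup>2 * s\<^sup>2)"
    unfolding sum_UNIV_option inner_None inner_Some s_def[symmetric]
    by (simp add: power2_eq_square algebra_simps)
  also have "\<dots> = s\<^sup>2 * (1 / m) + \<alpha>\<^sup>2 * (a \<bullet> a) + 2 * \<alpha> * \<beta> * s * s + m * (\<beta>\<^sup>2 * s\<^sup>2)"
    unfolding sm by (simp add: sum.distrib m_def inner_vec_def power2_eq_square s_def flip: sum_distrib_left)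
  also have "\<dots> = s\<^sup>2 * (1 / m) + \<alpha>\<^sup>2 * (a \<bullet> a) + s\<^sup>2 * (2 * \<alpha> * \<beta> + m * \<beta>\<^sup>2)"
    by (simp add: power2_eq_square algebra_simps)
  also have "\<dots> = \<alpha>\<^sup>2 * (a \<bullet> a)"
    unfolding ab by simp
  finally show "(\<Sum>k\<in>UNIV. (simplex_vertex k \<bullet> a)\<^sup>2) = (real CARD('m) + 1) / real CARD('m) * (a \<bullet> a)"
    unfolding \<alpha>2 m_def .
qed

text \<open>
  The frame identity at the vertex \<open>k\<close> bounds the square of the inner product of two vertices by
  \<open>1 / CARD('m)\<close>; the constant \<open>1 / 2\<close> is not optimal.
\<close>

lemma simplex_vertex_separated:
  assumes m: "CARD('m::finite) > 1" and ne: "k \<noteq> l"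
  shows "norm (simplex_vertex k - simplex_vertex l :: real^'m) > 1 / 2"
proof -
  define a b :: "real^'m" where "a = simplex_vertex k" and "b = simplex_vertex l"
  have aa: "a \<bullet> a = 1" and bb: "b \<bullet> b = 1"
    using norm_simplex_vertex[of k] norm_simplex_vertex[of l] by (simp_all add: a_def b_def norm_eq_1)
  have "1 + (b \<bullet> a)\<^sup>2 = (\<Sum>k\<in>{k, l}. (simplex_vertex k \<bullet> a)\<^sup>2)"
    using ne aa by (simp add: a_def b_def)
  also have "\<dots> \<le> (\<Sum>k\<in>UNIV. (simplex_vertex k \<bullet> a)\<^sup>2)"
    by (rule sum_mono2) auto
  also have "\<dots> = 1 + 1 / real CARD('m)"
    by (simp add: simplex_vertex_frame aa add_divide_distrib)
  also have "\<dots> \<le> 1 + 1 / 2"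
    using m by (simp add: field_simps)
  finally have "(b \<bullet> a)\<^sup>2 < (3 / 4)\<^sup>2"
    by (simp add: power2_eq_square)
  then have "b \<bullet> a < 3 / 4"
    by (rule power_less_imp_less_base) simp
  moreover have "(norm (a - b))\<^sup>2 = 2 - 2 * (b \<bullet> a)"
    by (simp add: power2_norm_eq_inner inner_diff_left inner_diff_right inner_commute[of a b] aa bb)
  ultimately have "(1 / 2)\<^sup>2 < (norm (a - b))\<^sup>2"
    by (simp add: power_divide)
  then show ?thesis
    unfolding a_def b_def by (rule power_less_imp_less_base) simp
qed

lemma simplex_moments:
  fixes a b :: "real^'m" and K :: "real \<Rightarrow> real"
  assumes K: "continuous_on UNIV K" and m: "CARD('m) > 1"
  defines "W \<equiv> \<lambda>x. \<Sum>k\<in>UNIV. K (norm (x - simplex_vertex k))"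
  shows "(LINT x|sphere_measure. (x \<bullet> a) * W x) = 0"
    and "(LINT x|sphere_measure. (x \<bullet> a) * (x \<bullet> b) * W x)
       = (a \<bullet> b) * (LINT x|sphere_measure. W x) / real CARD('m)"
proof -
  let ?v = "simplex_vertex :: 'm option \<Rightarrow> real^'m"
  define v where "v = ?v None"
  have v: "norm v = 1"
    unfolding v_def by (rule norm_simplex_vertex)
  have vk: "norm (?v k) = 1" for k
    by (rule norm_simplex_vertex)
  have radial: "(LINT x|sphere_measure. \<Phi> (norm (x - ?v k))) = (LINT x|sphere_measure. \<Phi> (norm (x - v)))"
    if "continuous_on UNIV \<Phi>" for \<Phi> :: "real \<Rightarrow> real" and k
    by (rule integral_sphere_radial_rotation[OF vk v that])
  have inner_v: "x \<bullet> ?v k = 1 - (norm (x - ?v k))\<^sup>2 / 2" if "norm x = 1" for x k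
    using that vk[of k] by (simp add: power2_norm_eq_inner inner_diff_left inner_diff_right inner_commute norm_eq_1 diff_divide_distrib)
  have contK: "continuous_on UNIV (\<lambda>r. g r * K r)" if "continuous_on UNIV g" for g
    by (intro continuous_intros that K)
  define \<mu>1 where "\<mu>1 = (LINT x|sphere_measure. (1 - (norm (x - v))\<^sup>2 / 2) * K (norm (x - v)))"
  define A where "A = (LINT x|sphere_measure. (1 - (norm (x - v))\<^sup>2 / 2)\<^sup>2 * K (norm (x - v)))"
  define \<kappa> where "\<kappa> = (LINT x|sphere_measure. K (norm (x - v)))"
  define \<beta> where "\<beta> = (\<kappa> - A) / (real CARD('m) - 1)"
  have \<kappa>: "(LINT x|sphere_measure. K (norm (x - ?v k))) = \<kappa>" for k
    unfolding \<kappa>_def by (rule radial[OF K])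
  have \<mu>1: "(LINT x|sphere_measure. (x \<bullet> ?v k) * K (norm (x - ?v k))) = \<mu>1" for k
  proof -
    have "(LINT x|sphere_measure. (x \<bullet> ?v k) * K (norm (x - ?v k)))
       = (LINT x|sphere_measure. (1 - (norm (x - ?v k))\<^sup>2 / 2) * K (norm (x - ?v k)))"
      by (rule Bochner_Integration.integral_cong) (simp_all add: inner_v)
    also have "\<dots> = \<mu>1"
      unfolding \<mu>1_def by (rule radial) (intro continuous_intros K, simp)
    finally show ?thesis .
  qed
  have A: "(LINT x|sphere_measure. (x \<bullet> ?v k)\<^sup>2 * K (norm (x - ?v k))) = A" for k
  proof -
    have "(LINT x|sphere_measure. (x \<bullet> ?v k)\<^sup>2 * K (norm (x - ?v k)))
       = (LINT x|sphere_measure. (1 - (norm (x - ?v k))\<^sup>2 / 2)\<^sup>2 * K (norm (x - ?v k)))"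
      by (rule Bochner_Integration.integral_cong) (simp_all add: inner_v)
    also have "\<dots> = A"
      unfolding A_def by (rule radial) (intro continuous_intros K, simp)
    finally show ?thesis .
  qed
  have int: "integrable sphere_measure (\<lambda>x. g x * K (norm (x - ?v k)))" if "continuous_on UNIV g" for g k
    by (intro integrable_sphere_measure_continuous continuous_intros continuous_on_compose2[OF K] that) auto
  have int_W: "integrable sphere_measure (\<lambda>x. g x * W x)" if "continuous_on UNIV g" for g
    unfolding W_def
    by (intro integrable_sphere_measure_continuous continuous_intros continuous_on_compose2[OF K] that) auto
  have LINT_W: "(LINT x|sphere_measure. g x * W x) = (\<Sum>k\<in>UNIV. LINT x|sphere_measure. g x * K (norm (x - ?v k)))"
    if "continuous_on UNIV g" for g
    unfolding W_def sum_distrib_left by (rule Bochner_Integration.integral_sum) (rule int[OF that])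
  have "(LINT x|sphere_measure. (x \<bullet> a) * W x) = (\<Sum>k\<in>UNIV. (?v k \<bullet> a) * \<mu>1)"
  proof (subst LINT_W)
    show "(\<Sum>k\<in>UNIV. LINT x|sphere_measure. (x \<bullet> a) * K (norm (x - ?v k))) = (\<Sum>k\<in>UNIV. (?v k \<bullet> a) * \<mu>1)"
      using integral_sphere_first_moment[OF K vk, of a] unfolding \<mu>1 by (simp add: inner_commute)
  qed (auto intro!: continuous_intros)
  also have "\<dots> = 0"
    using sum_simplex_vertex[of a] by (simp flip: sum_distrib_right)
  finally show "(LINT x|sphere_measure. (x \<bullet> a) * W x) = 0" .
  have totW: "(LINT x|sphere_measure. W x) = (real CARD('m) + 1) * \<kappa>"
    using LINT_W[of "\<lambda>_. 1"] \<kappa> by simp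
  define \<theta> where "\<theta> = (LINT x|sphere_measure. W x) / real CARD('m)"
  define Q where "Q c = (LINT x|sphere_measure. (x \<bullet> c)\<^sup>2 * W x)" for c
  have Q: "Q c = (c \<bullet> c) * \<theta>" for c
  proof -
    have "Q c = (\<Sum>k\<in>UNIV. (?v k \<bullet> c)\<^sup>2 * A + (c \<bullet> c - (?v k \<bullet> c)\<^sup>2) * \<beta>)"
      unfolding Q_def
    proof (subst LINT_W)
      show "(\<Sum>k\<in>UNIV. LINT x|sphere_measure. (x \<bullet> c)\<^sup>2 * K (norm (x - ?v k)))
          = (\<Sum>k\<in>UNIV. (?v k \<bullet> c)\<^sup>2 * A + (c \<bullet> c - (?v k \<bullet> c)\<^sup>2) * \<beta>)"
        using integral_sphere_second_moment[OF K vk m, of c] unfolding A \<kappa> \<beta>_def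
        by (simp add: inner_commute)
    qed (auto intro!: continuous_intros)
    also have "\<dots> = (\<Sum>k\<in>UNIV. (?v k \<bullet> c)\<^sup>2) * (A - \<beta>) + (real CARD('m) + 1) * ((c \<bullet> c) * \<beta>)"
    proof -
      have "(?v k \<bullet> c)\<^sup>2 * A + (c \<bullet> c - (?v k \<bullet> c)\<^sup>2) * \<beta> = (?v k \<bullet> c)\<^sup>2 * (A - \<beta>) + (c \<bullet> c) * \<beta>" for k
        by (simp add: algebra_simps)
      then show ?thesis
        by (simp add: sum.distrib card_UNIV_option flip: sum_distrib_right)
    qed
    also have "\<dots> = (c \<bullet> c) * ((real CARD('m) + 1) / real CARD('m) * (A - \<beta>) + (real CARD('m) + 1) * \<beta>)"
      by (simp add: simplex_vertex_frame algebra_simps)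
    also have "(real CARD('m) + 1) / real CARD('m) * (A - \<beta>) + (real CARD('m) + 1) * \<beta> = \<theta>"
    proof -
      have "A - \<beta> + real CARD('m) * \<beta> = \<kappa>"
      proof -
        have "(real CARD('m) - 1) * \<beta> = \<kappa> - A"
          unfolding \<beta>_def using m by simp
        then show ?thesis
          by (simp add: algebra_simps)
      qed
      moreover have "(real CARD('m) + 1) / real CARD('m) * (A - \<beta>) + (real CARD('m) + 1) * \<beta>
          = (real CARD('m) + 1) / real CARD('m) * (A - \<beta> + real CARD('m) * \<beta>)"
        using m by (simp add: distrib_left)
      ultimately show ?thesis
        unfolding \<theta>_def totW by simp
    qed
    finally show ?thesis .
  qed
  have "Q (a + b) = (LINT x|sphere_measure. (x \<bullet> a)\<^sup>2 * W x + (x \<bullet> b)\<^sup>2 * W x + 2 * ((x \<bullet> a) * (x \<bullet> b) * W x))"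
    unfolding Q_def by (simp add: inner_add_right power2_sum algebra_simps)
  also have "\<dots> = Q a + Q b + 2 * (LINT x|sphere_measure. (x \<bullet> a) * (x \<bullet> b) * W x)"
  proof -
    have "integrable sphere_measure (\<lambda>x. (x \<bullet> a)\<^sup>2 * W x)" "integrable sphere_measure (\<lambda>x. (x \<bullet> b)\<^sup>2 * W x)"
      "integrable sphere_measure (\<lambda>x. (x \<bullet> a) * (x \<bullet> b) * W x)"
      by (intro int_W continuous_intros)+
    then show ?thesis
      unfolding Q_def by simp
  qed
  finally have "2 * (LINT x|sphere_measure. (x \<bullet> a) * (x \<bullet> b) * W x) = 2 * ((a \<bullet> b) * \<theta>)"
    unfolding Q by (simp add: inner_add_left inner_add_right inner_commute algebra_simps)
  then show "(LINT x|sphere_measure. (x \<bullet> a) * (x \<bullet> b) * W x)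
       = (a \<bullet> b) * (LINT x|sphere_measure. W x) / real CARD('m)"
    by (simp add: \<theta>_def)
qed

lemma monomial_factor:
  fixes k :: "'m::finite \<Rightarrow> nat"
  assumes "sum k UNIV = Suc r"
  shows "\<exists>a k'. sum k' UNIV = r \<and>
    (\<forall>x :: real^'m. (\<Prod>i\<in>UNIV. x $ i ^ k i) = x $ a * (\<Prod>i\<in>UNIV. x $ i ^ k' i))"
proof -
  obtain a where a: "k a > 0"
    using assms by (cases "\<forall>a. k a = 0") auto
  define k' where "k' = k(a := k a - 1)"
  have "sum k UNIV = k a + sum k (UNIV - {a})" "sum k' UNIV = k' a + sum k' (UNIV - {a})"
    by (simp_all add: sum.remove)
  moreover have "sum k' (UNIV - {a}) = sum k (UNIV - {a})"
    by (rule sum.cong) (auto simp: k'_def)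
  ultimately have "sum k' UNIV = r"
    using a assms by (simp add: k'_def)
  moreover have "(\<Prod>i\<in>UNIV. x $ i ^ k i) = x $ a * (\<Prod>i\<in>UNIV. x $ i ^ k' i)" for x :: "real^'m"
  proof -
    have "(\<Prod>i\<in>UNIV. x $ i ^ k i) = x $ a ^ k a * (\<Prod>i\<in>UNIV - {a}. x $ i ^ k i)"
      "(\<Prod>i\<in>UNIV. x $ i ^ k' i) = x $ a ^ k' a * (\<Prod>i\<in>UNIV - {a}. x $ i ^ k' i)"
      by (simp_all add: prod.remove)
    moreover have "(\<Prod>i\<in>UNIV - {a}. x $ i ^ k' i) = (\<Prod>i\<in>UNIV - {a}. x $ i ^ k i)"
      by (rule prod.cong) (auto simp: k'_def)
    moreover have "x $ a ^ k a = x $ a * x $ a ^ k' a"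
      using a by (cases "k a") (auto simp: k'_def)
    ultimately show ?thesis by simp
  qed
  ultimately show ?thesis by blast
qed

text \<open>
  Equal zonal weights around the vertices of the simplex have, up to a constant factor, the same
  moments of degree at most two as the uniform measure.
\<close>

lemma simplex_quadrature:
  fixes K :: "real \<Rightarrow> real" and f :: "real^'m \<Rightarrow> real"
  assumes K: "continuous_on UNIV K" and m: "CARD('m) > 1" and f: "f \<in> polynomials_le 2"
  defines "W \<equiv> \<lambda>x. \<Sum>k\<in>UNIV. K (norm (x - simplex_vertex k))"
  shows "(LINT x|sphere_measure. f x * W x)
    = (LINT x|sphere_measure. W x) / measure (sphere_measure :: (real^'m) measure) (sphere 0 1) * (LINT x|sphere_measure. f x)"
proof -
  define \<sigma> where "\<sigma> = measure (sphere_measure :: (real^'m) measure) (sphere 0 1)"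
  have \<sigma>: "\<sigma> > 0"
    unfolding \<sigma>_def by (rule measure_sphere_pos)
  define c where "c = (LINT x|sphere_measure. W x) / \<sigma>"
  define P where "P k x = (\<Prod>i\<in>UNIV. x $ i ^ k i)" for k :: "'m \<Rightarrow> nat" and x :: "real^'m"
  \<comment> \<open>the uniform measure is the weighted one with constant weights\<close>
  have unweighted: "(LINT x|sphere_measure. (x \<bullet> a)) = 0"
    "(LINT x|sphere_measure. (x \<bullet> a) * (x \<bullet> b)) = (a \<bullet> b) * \<sigma> / real CARD('m)" for a b :: "real^'m"
  proof -
    have 1: "continuous_on UNIV (\<lambda>_::real. 1 / (real CARD('m) + 1))"
      by simp
    have 2: "(\<Sum>k\<in>(UNIV :: 'm option set). 1 / (real CARD('m) + 1)) = 1"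
      by (simp add: field_simps)
    show "(LINT x|sphere_measure. (x \<bullet> a)) = 0"
      using simplex_moments(1)[OF 1 m, of a] unfolding 2 by simp
    show "(LINT x|sphere_measure. (x \<bullet> a) * (x \<bullet> b)) = (a \<bullet> b) * \<sigma> / real CARD('m)"
      using simplex_moments(2)[OF 1 m, of a b] unfolding 2 by (simp add: \<sigma>_def)
  qed
  have monomial: "(LINT x|sphere_measure. P k x * W x) = c * (LINT x|sphere_measure. P k x)"
    if deg: "sum k UNIV \<le> 2" for k
  proof -
    consider "sum k UNIV = 0" | "sum k UNIV = Suc 0" | "sum k UNIV = Suc (Suc 0)"
      using deg by linarith
    then show ?thesis
    proof cases
      case 1
      then have "P k x = 1" for x
        by (simp add: P_def)
      then show ?thesis
        using \<sigma> by (simp add: c_def \<sigma>_def)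
    next
      case 2
      then obtain a k' where k': "sum k' UNIV = 0" "\<And>x. P k x = x $ a * P k' x"
        using monomial_factor[of k 0] unfolding P_def by blast
      have "P k' x = 1" for x
        using k'(1) by (simp add: P_def)
      then have "P k x = x \<bullet> axis a 1" for x
        by (simp add: k' inner_axis)
      then show ?thesis
        using simplex_moments(1)[OF K m, of "axis a 1"] unweighted(1)[of "axis a 1"] by (simp add: W_def)
    next
      case 3
      then obtain a k' where k': "sum k' UNIV = Suc 0" "\<And>x. P k x = x $ a * P k' x"
        using monomial_factor[of k "Suc 0"] unfolding P_def by blast
      from k'(1) obtain b k'' where k'': "sum k'' UNIV = 0" "\<And>x. P k' x = x $ b * P k'' x"
        using monomial_factor[of k' 0] unfolding P_def by blast
      have "P k'' x = 1" for x
        using k''(1) by (simp add: P_def)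
      then have P: "P k x = (x \<bullet> axis a 1) * (x \<bullet> axis b 1)" for x
        by (simp add: k' k'' inner_axis)
      show ?thesis
        using simplex_moments(2)[OF K m, of "axis a 1" "axis b 1"] \<sigma>
        unfolding P unweighted(2) by (simp add: W_def c_def)
    qed
  qed
  obtain C where f: "f = (\<lambda>x. \<Sum>k | sum k UNIV \<le> 2. C k * P k x)"
    using f by (auto simp: polynomials_le_def P_def)
  have contP: "continuous_on UNIV (P k)" for k
    unfolding P_def by (intro continuous_intros)
  have contW: "continuous_on UNIV W"
    unfolding W_def by (intro continuous_intros continuous_on_compose2[OF K]) auto
  have "(LINT x|sphere_measure. f x * W x) = (\<Sum>k | sum k UNIV \<le> 2. LINT x|sphere_measure. C k * (P k x * W x))"
    unfolding f sum_distrib_right mult.assoc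
    by (intro Bochner_Integration.integral_sum integrable_sphere_measure_continuous continuous_intros contP contW)
  also have "\<dots> = c * (\<Sum>k | sum k UNIV \<le> 2. LINT x|sphere_measure. C k * P k x)"
    unfolding sum_distrib_left by (intro sum.cong refl) (simp add: monomial)
  also have "(\<Sum>k | sum k UNIV \<le> 2. LINT x|sphere_measure. C k * P k x) = (LINT x|sphere_measure. f x)"
    unfolding f
    by (intro Bochner_Integration.integral_sum[symmetric] integrable_sphere_measure_continuous continuous_intros contP)
  finally show ?thesis
    by (simp add: c_def \<sigma>_def)
qed

section \<open>The truncated Euclidean extremal\<close>

text \<open>
  The substitution \<open>r = (t / (1 - t)) powr (1 / k)\<close> gives the Beta integral.
\<close>

lemma integral_radial_Beta:
  fixes \<alpha> \<beta> k :: real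
  assumes pos: "\<alpha> > 0" "\<beta> > 0" "k > 0"
  defines "f \<equiv> \<lambda>r. r powr (k * \<alpha> - 1) * (1 + r powr k) powr (- (\<alpha> + \<beta>))"
  shows "integrable lborel (\<lambda>r. indicator {0<..} r * f r)"
    and "(LINT r|lborel. indicator {0<..} r * f r) = Beta \<alpha> \<beta> / k"
proof -
  define g where "g t = (t / (1 - t)) powr (1 / k)" for t :: real
  define g' where "g' t = 1 / k * (t / (1 - t)) powr (1 / k - 1) * (1 / (1 - t)\<^sup>2)" for t :: real
  define b where "b t = t powr (\<alpha> - 1) * (1 - t) powr (\<beta> - 1)" for t
  have fg: "f (g t) * g' t = b t / k" if t: "0 < t" "t < 1" for t
  proof -
    define y where "y = t / (1 - t)"
    have y: "y > 0"
      using t by (simp add: y_def)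
    have t_eq: "t = y * (1 - t)"
      using t by (simp add: y_def)
    have "g t powr k = y"
      using y pos by (simp add: g_def powr_powr flip: y_def)
    moreover have "1 + y = 1 / (1 - t)"
      using t by (simp add: y_def field_simps)
    moreover have "g t powr (k * \<alpha> - 1) = y powr (\<alpha> - 1 / k)"
      using pos by (simp add: g_def powr_powr field_simps flip: y_def)
    ultimately have "f (g t) = y powr (\<alpha> - 1 / k) * (1 / (1 - t)) powr (- (\<alpha> + \<beta>))"
      by (simp add: f_def)
    also have "(1 / (1 - t)) powr (- (\<alpha> + \<beta>)) = (1 - t) powr (\<alpha> + \<beta>)"
    proof -
      have inv: "(1 / x) powr (- s) = x powr s" if "x > 0" for x s :: real
        using that by (simp add: powr_divide powr_minus)
      show ?thesis
        using t by (intro inv) simp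
    qed
    finally have "f (g t) * g' t
        = 1 / k * (y powr (\<alpha> - 1 / k) * y powr (1 / k - 1)) * ((1 - t) powr (\<alpha> + \<beta>) * (1 / (1 - t)\<^sup>2))"
      by (simp add: g'_def flip: y_def)
    also have "y powr (\<alpha> - 1 / k) * y powr (1 / k - 1) = y powr (\<alpha> - 1)"
      by (simp flip: powr_add)
    also have "(1 - t) powr (\<alpha> + \<beta>) * (1 / (1 - t)\<^sup>2) = (1 - t) powr (\<alpha> + \<beta> - 2)"
      using t by (simp add: powr_diff)
    also have "(1 - t) powr (\<alpha> + \<beta> - 2) = (1 - t) powr (\<alpha> - 1) * (1 - t) powr (\<beta> - 1)"
      by (simp flip: powr_add)
    also have "1 / k * y powr (\<alpha> - 1) * ((1 - t) powr (\<alpha> - 1) * (1 - t) powr (\<beta> - 1))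
       = 1 / k * ((y * (1 - t)) powr (\<alpha> - 1) * (1 - t) powr (\<beta> - 1))"
      using y t by (simp add: powr_mult)
    finally show ?thesis
      unfolding t_eq[symmetric] by (simp add: b_def)
  qed
  have b_int: "set_integrable lborel {0..1} b"
    unfolding b_def by (rule integrable_Beta) fact+
  then have "(LINT t:{0..1}|lborel. b t) = integral {0..1} b"
    by (rule set_borel_integral_eq_integral)
  also have "\<dots> = Beta \<alpha> \<beta>"
    unfolding b_def by (rule integral_unique, rule has_integral_Beta_real) fact+
  finally have b_val: "(LINT t:{0..1}|lborel. b t) = Beta \<alpha> \<beta>" .
  have lt: "ereal 0 < ereal 1" by simp
  have f_nn: "0 \<le> f (g x)" for x
    by (simp add: f_def)
  have g_nn: "0 \<le> g' x" if "ereal 0 \<le> ereal x" "ereal x \<le> ereal 1" for x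
    using that pos by (simp add: g'_def)
  have derg: "(g has_real_derivative g' x) (at x)" if "ereal 0 < ereal x" "ereal x < ereal 1" for x
  proof -
    have x: "0 < x" "x < 1" using that by auto
    have 1: "((\<lambda>t. t / (1 - t)) has_real_derivative 1 / (1 - x)\<^sup>2) (at x)"
      using x by (auto intro!: derivative_eq_intros simp: power2_eq_square divide_simps)
    have 2: "((\<lambda>z. z powr (1 / k)) has_real_derivative 1 / k * (x / (1 - x)) powr (1 / k - 1)) (at (x / (1 - x)))"
      using x by (intro has_real_derivative_powr) simp
    show ?thesis
      using DERIV_chain2[OF 2 1] by (simp add: g_def[abs_def] g'_def)
  qed
  have contf: "isCont f (g x)" if "ereal 0 < ereal x" "ereal x < ereal 1" for x
  proof -
    have "g x > 0" using that by (simp add: g_def)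
    moreover have "1 + g x powr k > 0"
      by (simp add: add_pos_nonneg)
    ultimately show ?thesis
      unfolding f_def by (intro continuous_intros) auto
  qed
  have contg: "isCont g' x" if "ereal 0 < ereal x" "ereal x < ereal 1" for x
    unfolding g'_def[abs_def] using that by (intro continuous_intros) auto
  have "(g \<longlongrightarrow> (0 / (1 - 0)) powr (1 / k)) (at_right 0)"
    unfolding g_def[abs_def] using pos
    by (intro tendsto_intros) (auto simp: eventually_at_right_less eventually_at_right[of 0 1] intro!: exI[of _ "1/2"])
  then have limA: "((ereal \<circ> g \<circ> real_of_ereal) \<longlongrightarrow> ereal 0) (at_right (ereal 0))"
    by (simp only: ereal_tendsto_simps) simp
  have "filterlim g at_top (at_left 1)"
  proof -
    have "((\<lambda>t::real. 1 - t) \<longlongrightarrow> 1 - 1) (at_left 1)"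
      by (intro tendsto_intros)
    then have "filterlim (\<lambda>t::real. inverse (1 - t)) at_top (at_left 1)"
      by (intro filterlim_inverse_at_top) (auto simp: eventually_at_left[of 0 1] intro!: exI[of _ 0])
    then have "filterlim (\<lambda>t::real. -1 + inverse (1 - t)) at_top (at_left 1)"
      by (intro filterlim_tendsto_add_at_top[OF tendsto_const])
    then have "filterlim (\<lambda>t::real. exp (1 / k * ln (-1 + inverse (1 - t)))) at_top (at_left 1)"
      using pos
      by (intro filterlim_compose[OF exp_at_top] filterlim_tendsto_pos_mult_at_top[OF tendsto_const]
          filterlim_compose[OF ln_at_top]) auto
    moreover have "\<forall>\<^sub>F t in at_left 1. exp (1 / k * ln (-1 + inverse (1 - t))) = g t"
    proof -
      have "exp (1 / k * ln (-1 + inverse (1 - t))) = g t" if "0 < t" "t < 1" for t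
      proof -
        have "-1 + inverse (1 - t) = t / (1 - t)"
          using that by (simp add: field_simps)
        then show ?thesis
          using that by (simp add: g_def powr_def)
      qed
      then show ?thesis
        by (auto simp: eventually_at_left[of 0 1] intro!: exI[of _ 0])
    qed
    ultimately show ?thesis
      by (rule filterlim_cong[THEN iffD1, rotated 3, OF _ refl refl])
  qed
  then have limB: "((ereal \<circ> g \<circ> real_of_ereal) \<longlongrightarrow> \<infinity>) (at_left (ereal 1))"
    by (simp only: ereal_tendsto_simps)
  have "set_integrable lborel {0<..<1} b"
    using b_int by (rule set_integrable_subset) auto
  then have "set_integrable lborel {0<..<1} (\<lambda>t. b t / k)"
    by (rule set_integrable_divide)
  then have intg: "set_integrable lborel (einterval (ereal 0) (ereal 1)) (\<lambda>x. f (g x) * g' x)"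
    unfolding einterval_eq by (rule set_integrable_cong[THEN iffD1, OF refl refl, rotated]) (simp add: fg)
  note sub = interval_integral_substitution_nonneg[OF lt derg contf contg f_nn g_nn limA limB intg]
  from sub(1) show "integrable lborel (\<lambda>r. indicator {0<..} r * f r)"
    unfolding einterval_eq set_integrable_def by simp
  have "(LINT r|lborel. indicator {0<..} r * f r) = (LBINT x=ereal 0..\<infinity>. f x)"
    unfolding interval_integral_to_infinity_eq set_lebesgue_integral_def by simp
  also have "\<dots> = (LBINT x=ereal 0..ereal 1. f (g x) * g' x)"
    by (rule sub(2))
  also have "\<dots> = (LBINT x=ereal 0..ereal 1. b x / k)"
    by (rule interval_integral_cong) (auto simp: einterval_eq fg)
  also have "\<dots> = (LINT x:{0..1}|lborel. b x / k)"
    by (rule interval_integral_Icc) simp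
  also have "\<dots> = Beta \<alpha> \<beta> / k"
    unfolding set_integral_divide_zero b_val ..
  finally show "(LINT r|lborel. indicator {0<..} r * f r) = Beta \<alpha> \<beta> / k" .
qed

lemma one_plus_powr_pos: "1 + (x::real) powr k > 0"
  by (intro add_pos_nonneg) auto

lemma one_plus_powr_nonzero: "1 + (x::real) powr k \<noteq> 0"
  using one_plus_powr_pos[of x k] by simp

text \<open>
  The radial extremal of the Euclidean Sobolev inequality, extended to an even function on the whole line,
  and its derivative.
\<close>

definition bubble :: "real \<Rightarrow> real \<Rightarrow> real \<Rightarrow> real" where
  "bubble k \<gamma> r = (1 + \<bar>r\<bar> powr k) powr (- \<gamma>)"

definition bubble_deriv :: "real \<Rightarrow> real \<Rightarrow> real \<Rightarrow> real" where
  "bubble_deriv k \<gamma> r = - \<gamma> * (1 + \<bar>r\<bar> powr k) powr (- \<gamma> - 1) * (k * \<bar>r\<bar> powr (k - 1) * sgn r)"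

lemma has_derivative_abs_powr:
  assumes k: "k > (1 :: real)"
  shows "((\<lambda>r. \<bar>r\<bar> powr k) has_real_derivative k * \<bar>r\<bar> powr (k - 1) * sgn r) (at r)"
proof -
  consider "r > 0" | "r < 0" | "r = 0" by linarith
  then show ?thesis
  proof cases
    case 1
    have "((\<lambda>r. r powr k) has_real_derivative k * r powr (k - 1)) (at r)"
      by (rule has_real_derivative_powr[OF 1])
    then have "((\<lambda>r. \<bar>r\<bar> powr k) has_real_derivative k * r powr (k - 1)) (at r)"
      by (rule has_field_derivative_transform_within_open[where S = "{0<..}"]) (use 1 in auto)
    then show ?thesis
      using 1 by simp
  next
    case 2
    have "((\<lambda>r. (- r) powr k) has_real_derivative k * (- r) powr (k - 1) * (- 1)) (at r)"
      using 2 by (intro DERIV_chain2[OF has_real_derivative_powr]) (auto intro!: derivative_eq_intros)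
    then have "((\<lambda>r. \<bar>r\<bar> powr k) has_real_derivative k * (- r) powr (k - 1) * (- 1)) (at r)"
      by (rule has_field_derivative_transform_within_open[where S = "{..<0}"]) (use 2 in auto)
    then show ?thesis
      using 2 by simp
  next
    case 3
    have "((\<lambda>h. \<bar>h\<bar> powr k / h) \<longlongrightarrow> 0) (at (0::real))"
    proof (rule Lim_null_comparison)
      show "\<forall>\<^sub>F h in at 0. norm (\<bar>h\<bar> powr k / h) \<le> \<bar>h\<bar> powr (k - 1)"
        by (auto simp: eventually_at_filter powr_diff intro!: always_eventually)
      have "((\<lambda>h::real. \<bar>h\<bar> powr (k - 1)) \<longlongrightarrow> \<bar>0\<bar> powr (k - 1)) (at 0)"
        using k by (intro tendsto_intros) auto
      then show "((\<lambda>h::real. \<bar>h\<bar> powr (k - 1)) \<longlongrightarrow> 0) (at 0)"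
        by simp
    qed
    then show ?thesis
      using 3 by (simp add: DERIV_def)
  qed
qed

lemma bubble_pos: "bubble k \<gamma> r > 0"
  unfolding bubble_def using one_plus_powr_nonzero by simp

lemma bubble_has_derivative:
  assumes "k > 1"
  shows "(bubble k \<gamma> has_real_derivative bubble_deriv k \<gamma> r) (at r)"
proof -
  have "((\<lambda>r. 1 + \<bar>r\<bar> powr k) has_real_derivative 0 + k * \<bar>r\<bar> powr (k - 1) * sgn r) (at r)"
    by (intro DERIV_add DERIV_const has_derivative_abs_powr assms)
  from DERIV_chain2[OF has_real_derivative_powr[OF one_plus_powr_pos] this, of "- \<gamma>"] show ?thesis
    by (simp add: bubble_def[abs_def] bubble_deriv_def)
qed

lemma continuous_abs_powr: "s > 0 \<Longrightarrow> continuous_on UNIV (\<lambda>r::real. \<bar>r\<bar> powr s)"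
  by (intro continuous_on_powr' continuous_intros) auto

lemma continuous_bubble: "k > 0 \<Longrightarrow> continuous_on UNIV (bubble k \<gamma>)"
  unfolding bubble_def[abs_def]
  by (intro continuous_on_powr' continuous_intros continuous_abs_powr)
    (auto simp: one_plus_powr_nonzero less_imp_le[OF one_plus_powr_pos])

lemma abs_bubble_deriv:
  assumes "k > 1" "\<gamma> > 0"
  shows "\<bar>bubble_deriv k \<gamma> r\<bar> = \<gamma> * k * \<bar>r\<bar> powr (k - 1) * (1 + \<bar>r\<bar> powr k) powr (- \<gamma> - 1)"
  using assms by (cases "r = 0") (simp_all add: bubble_deriv_def abs_mult)

lemma continuous_abs_bubble_deriv:
  assumes "k > 1" "\<gamma> > 0"
  shows "continuous_on UNIV (\<lambda>r. \<bar>bubble_deriv k \<gamma> r\<bar>)"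
proof -
  have "continuous_on UNIV (\<lambda>r::real. (1 + \<bar>r\<bar> powr k) powr (- \<gamma> - 1))"
    using assms by (intro continuous_on_powr' continuous_intros continuous_abs_powr)
    (auto simp: one_plus_powr_nonzero less_imp_le[OF one_plus_powr_pos])
  then show ?thesis
    unfolding abs_bubble_deriv[OF assms] using assms
    by (intro continuous_on_mult continuous_on_const continuous_abs_powr) auto
qed

lemma bubble_le:
  assumes "k > 0" "\<gamma> > 0" "\<eta> > 0" "r \<ge> (\<eta> powr (- 1 / \<gamma>)) powr (1 / k)"
  shows "bubble k \<gamma> r \<le> \<eta>"
proof -
  have r: "r > 0"
    using assms by (intro less_le_trans[OF _ assms(4)]) simp
  have "((\<eta> powr (- 1 / \<gamma>)) powr (1 / k)) powr k \<le> r powr k"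
    using assms by (intro powr_mono2) auto
  also have "((\<eta> powr (- 1 / \<gamma>)) powr (1 / k)) powr k = \<eta> powr (- 1 / \<gamma>)"
    using assms by (simp add: powr_powr)
  finally have "\<eta> powr (- 1 / \<gamma>) \<le> 1 + \<bar>r\<bar> powr k"
    using r by simp
  then have "(1 + \<bar>r\<bar> powr k) powr (- \<gamma>) \<le> (\<eta> powr (- 1 / \<gamma>)) powr (- \<gamma>)"
    using assms by (intro powr_mono2') auto
  also have "\<dots> = \<eta>"
    using assms by (simp add: powr_powr)
  finally show ?thesis
    by (simp add: bubble_def)
qed

text \<open>
  A \<open>C\<^sup>1\<close> truncation at the level \<open>\<eta>\<close> and its derivative: \<open>soft_cut \<eta> y\<close> vanishes for \<open>y \<le> \<eta>\<close>, tends
  to \<open>y\<close> as \<open>\<eta> \<rightarrow> 0\<close>, and has slope between \<open>0\<close> and \<open>1\<close>, for positive \<open>y\<close>.  Composing with it makes the support of the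
  bubble compact without increasing its gradient.
\<close>

definition soft_cut :: "real \<Rightarrow> real \<Rightarrow> real" where
  "soft_cut \<eta> y = (max 0 (y - \<eta>))\<^sup>2 / y"

definition soft_cut_deriv :: "real \<Rightarrow> real \<Rightarrow> real" where
  "soft_cut_deriv \<eta> y = 2 * max 0 (y - \<eta>) / y - (max 0 (y - \<eta>))\<^sup>2 / y\<^sup>2"

lemma max_square_has_derivative:
  "((\<lambda>y::real. (max 0 y)\<^sup>2) has_real_derivative 2 * max 0 y) (at y)"
proof -
  consider "y > 0" | "y < 0" | "y = 0" by linarith
  then show ?thesis
  proof cases
    case 1
    have "((\<lambda>y. y\<^sup>2) has_real_derivative 2 * y) (at y)"
      by (auto intro!: derivative_eq_intros)
    then have "((\<lambda>y. (max 0 y)\<^sup>2) has_real_derivative 2 * y) (at y)"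
      by (rule has_field_derivative_transform_within_open[where S = "{0<..}"]) (use 1 in auto)
    then show ?thesis
      using 1 by simp
  next
    case 2
    have "((\<lambda>y::real. 0) has_real_derivative 0) (at y)"
      by simp
    then have "((\<lambda>y::real. (max 0 y)\<^sup>2) has_real_derivative 0) (at y)"
      by (rule has_field_derivative_transform_within_open[where S = "{..<0}"]) (use 2 in auto)
    then show ?thesis
      using 2 by simp
  next
    case 3
    have "((\<lambda>h::real. (max 0 h)\<^sup>2 / h) \<longlongrightarrow> 0) (at 0)"
    proof (rule Lim_null_comparison)
      show "\<forall>\<^sub>F h in at (0::real). norm ((max 0 h)\<^sup>2 / h) \<le> \<bar>h\<bar>"
        by (auto simp: eventually_at_filter max_def power2_eq_square intro!: always_eventually)
      show "((\<lambda>h::real. \<bar>h\<bar>) \<longlongrightarrow> 0) (at 0)"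
        using tendsto_rabs[OF tendsto_ident_at, of "0::real" UNIV] by simp
    qed
    then show ?thesis
      using 3 by (simp add: DERIV_def)
  qed
qed

lemma soft_cut_has_derivative:
  assumes "y > 0"
  shows "(soft_cut \<eta> has_real_derivative soft_cut_deriv \<eta> y) (at y)"
proof -
  have 1: "((\<lambda>y. y - \<eta>) has_real_derivative 1) (at y)"
    by (auto intro!: derivative_eq_intros)
  have "((\<lambda>y. (max 0 (y - \<eta>))\<^sup>2) has_real_derivative 2 * max 0 (y - \<eta>)) (at y)"
    using DERIV_chain2[OF max_square_has_derivative 1] by simp
  then have "(soft_cut \<eta> has_real_derivative (2 * max 0 (y - \<eta>) * y - (max 0 (y - \<eta>))\<^sup>2 * 1) / (y * y)) (at y)"
    unfolding soft_cut_def[abs_def] using assms by (intro DERIV_divide DERIV_ident) auto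
  also have "(2 * max 0 (y - \<eta>) * y - (max 0 (y - \<eta>))\<^sup>2 * 1) / (y * y) = soft_cut_deriv \<eta> y"
    using assms by (simp add: soft_cut_deriv_def diff_divide_distrib power2_eq_square)
  finally show ?thesis .
qed

lemma soft_cut_bounds:
  assumes "y > 0" "\<eta> > 0"
  shows "0 \<le> soft_cut \<eta> y" "soft_cut \<eta> y \<le> y" "0 \<le> soft_cut_deriv \<eta> y" "soft_cut_deriv \<eta> y \<le> 1"
proof -
  define m where "m = max 0 (y - \<eta>)"
  have m: "0 \<le> m" "m \<le> y"
    using assms by (auto simp: m_def)
  show "0 \<le> soft_cut \<eta> y"
    using assms by (simp add: soft_cut_def)
  have "m\<^sup>2 \<le> y * y"
    using m by (simp add: power2_eq_square mult_mono)
  then show "soft_cut \<eta> y \<le> y"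
    using assms by (simp add: soft_cut_def m_def[symmetric] divide_le_eq)
  have eq: "soft_cut_deriv \<eta> y = 1 - ((y - m) / y)\<^sup>2"
    using assms by (simp add: soft_cut_deriv_def m_def[symmetric] power2_eq_square field_simps)
  have "((y - m) / y)\<^sup>2 \<le> 1"
    using m assms by (intro power_le_one) auto
  then show "0 \<le> soft_cut_deriv \<eta> y" "soft_cut_deriv \<eta> y \<le> 1"
    unfolding eq by auto
qed

lemma soft_cut_eq_0: "y \<le> \<eta> \<Longrightarrow> soft_cut \<eta> y = 0" "y \<le> \<eta> \<Longrightarrow> soft_cut_deriv \<eta> y = 0"
  by (simp_all add: soft_cut_def soft_cut_deriv_def max_absorb1)

lemma continuous_soft_cut:
  "continuous_on {0<..} (soft_cut \<eta>)" "continuous_on {0<..} (soft_cut_deriv \<eta>)"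
  unfolding soft_cut_def[abs_def] soft_cut_deriv_def[abs_def] by (intro continuous_intros; simp)+

lemma soft_cut_tendsto:
  assumes "y > 0" "\<eta> \<longlonglongrightarrow> 0"
  shows "(\<lambda>i. soft_cut (\<eta> i) y) \<longlonglongrightarrow> y"
proof -
  have "(\<lambda>i. soft_cut (\<eta> i) y) \<longlonglongrightarrow> (max 0 (y - 0))\<^sup>2 / y"
    unfolding soft_cut_def using assms by (intro tendsto_intros) auto
  then show ?thesis
    using assms by (simp add: power2_eq_square)
qed

lemma Gamma_plus1_pos: "x > 0 \<Longrightarrow> Gamma (x + 1) = x * Gamma (x :: real)"
  by (rule Gamma_plus1) (auto elim!: nonpos_Ints_cases')

text \<open>
  Both integrands are of the form of \<open>integral_radial_Beta\<close>: since \<open>\<gamma> * q = n\<close> and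
  \<open>(\<gamma> + 1) * p = n\<close>, the factor \<open>1 + r powr k\<close> has the exponent \<open>- n\<close> in each of them.
\<close>

lemma integral_bubble:
  fixes p :: real and n :: nat
  assumes p: "1 < p" "p < real n"
  defines "k \<equiv> p / (p - 1)" and "\<gamma> \<equiv> (real n - p) / p" and "q \<equiv> p * real n / (real n - p)"
  defines "I \<equiv> Gamma (real n / p) * Gamma (real n + 1 - real n / p) / fact n"
  shows "integrable lborel (\<lambda>r. indicator {0<..} r * (bubble k \<gamma> r powr q * r ^ (n - 1)))"
    and "(LINT r|lborel. indicator {0<..} r * (bubble k \<gamma> r powr q * r ^ (n - 1))) = I"
    and "integrable lborel (\<lambda>r. indicator {0<..} r * (\<bar>bubble_deriv k \<gamma> r\<bar> powr p * r ^ (n - 1)))"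
    and "(LINT r|lborel. indicator {0<..} r * (\<bar>bubble_deriv k \<gamma> r\<bar> powr p * r ^ (n - 1)))
       = ((real n - p) / (p - 1)) powr p * (real n * (p - 1) / (real n - p)) * I"
proof -
  define \<alpha> where "\<alpha> = real n - real n / p"
  define \<beta> where "\<beta> = real n / p"
  have n0: "real n > 0" "n > 0"
    using p by (auto intro: Suc_leI)
  have k: "k > 1" and \<gamma>: "\<gamma> > 0"
    using p by (simp_all add: k_def \<gamma>_def)
  have \<beta>1: "\<beta> > 1"
    using p by (simp add: \<beta>_def)
  have \<alpha>k: "k * \<alpha> = real n"
    using p by (simp add: \<alpha>_def k_def field_simps)
  have \<alpha>0: "\<alpha> > 0"
    using \<alpha>k k n0 by (metis less_trans zero_less_mult_pos zero_less_one)
  have \<alpha>\<beta>: "\<alpha> + \<beta> = real n"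
    by (simp add: \<alpha>_def \<beta>_def)
  have \<gamma>q: "\<gamma> * q = real n"
    using p by (simp add: \<gamma>_def q_def)
  have \<gamma>p: "(\<gamma> + 1) * p = real n"
    using p by (simp add: \<gamma>_def field_simps)
  have kp: "(k - 1) * p = k"
    using p by (simp add: k_def field_simps)
  have pow: "r ^ (n - 1) = r powr (real n - 1)" if "r > 0" for r :: real
    using that n0 by (simp add: of_nat_diff flip: powr_realpow)
  have A: "indicator {0<..} r * (bubble k \<gamma> r powr q * r ^ (n - 1))
     = indicator {0<..} r * (r powr (k * \<alpha> - 1) * (1 + r powr k) powr (- (\<alpha> + \<beta>)))" for r :: real
    using pow[of r] by (cases "r > 0") (simp_all add: bubble_def powr_powr \<gamma>q \<alpha>k \<alpha>\<beta>)
  have B: "indicator {0<..} r * (\<bar>bubble_deriv k \<gamma> r\<bar> powr p * r ^ (n - 1))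
     = (\<gamma> * k) powr p * (indicator {0<..} r * (r powr (k * (\<alpha> + 1) - 1) * (1 + r powr k) powr (- ((\<alpha> + 1) + (\<beta> - 1)))))"
    for r :: real
  proof (cases "r > 0")
    case True
    have "\<bar>bubble_deriv k \<gamma> r\<bar> powr p = (\<gamma> * k * r powr (k - 1) * (1 + r powr k) powr (- \<gamma> - 1)) powr p"
      unfolding abs_bubble_deriv[OF k \<gamma>] using True by simp
    also have "\<dots> = (\<gamma> * k) powr p * r powr ((k - 1) * p) * (1 + r powr k) powr ((- \<gamma> - 1) * p)"
      using k \<gamma> by (simp add: powr_mult powr_powr)
    also have "(- \<gamma> - 1) * p = - real n"
      using \<gamma>p by (simp add: algebra_simps)
    also have "(k - 1) * p = k"
      by (rule kp)
    finally have "\<bar>bubble_deriv k \<gamma> r\<bar> powr p * r ^ (n - 1)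
        = (\<gamma> * k) powr p * ((r powr k * r powr (real n - 1)) * (1 + r powr k) powr (- real n))"
      unfolding pow[OF True] by (simp add: mult_ac)
    also have "r powr k * r powr (real n - 1) = r powr (k * (\<alpha> + 1) - 1)"
      by (simp add: \<alpha>k distrib_left add_ac add_diff_eq flip: powr_add)
    finally show ?thesis
      using \<alpha>\<beta> by simp
  qed simp
  note radA = integral_radial_Beta[of \<alpha> \<beta> k] and radB = integral_radial_Beta[of "\<alpha> + 1" "\<beta> - 1" k]
  have pos: "0 < \<beta>" "0 < k" "0 < \<alpha> + 1" "0 < \<beta> - 1"
    using \<beta>1 k \<alpha>0 by simp_all
  show "integrable lborel (\<lambda>r. indicator {0<..} r * (bubble k \<gamma> r powr q * r ^ (n - 1)))"
    unfolding A by (rule radA(1)) (use \<alpha>0 pos in auto)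
  have G: "Gamma (real n + 1 - real n / p) = \<alpha> * Gamma \<alpha>"
  proof -
    have eq: "real n + 1 - real n / p = \<alpha> + 1"
      by (simp add: \<alpha>_def)
    show ?thesis
      unfolding eq by (rule Gamma_plus1_pos[OF \<alpha>0])
  qed
  have Gn: "fact n = real n * Gamma (real n)"
    using Gamma_fact[of n, where 'a = real] Gamma_plus1_pos[OF n0(1)] by (simp add: add.commute)
  have I: "Beta \<alpha> \<beta> / k = I"
  proof -
    have "I = (\<alpha> / real n) * (Gamma \<alpha> * Gamma \<beta> / Gamma (real n))"
      unfolding I_def G Gn \<beta>_def by simp
    also have "\<alpha> / real n = 1 / k"
      using \<alpha>k k n0 by (simp add: field_simps)
    finally show ?thesis
      by (simp add: Beta_def \<alpha>\<beta>)
  qed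
  show "(LINT r|lborel. indicator {0<..} r * (bubble k \<gamma> r powr q * r ^ (n - 1))) = I"
    unfolding A I[symmetric] by (rule radA(2)) (use \<alpha>0 pos in auto)
  show "integrable lborel (\<lambda>r. indicator {0<..} r * (\<bar>bubble_deriv k \<gamma> r\<bar> powr p * r ^ (n - 1)))"
    unfolding B by (rule integrable_mult_right, rule radB(1)) (use pos in auto)
  have "(LINT r|lborel. indicator {0<..} r * (\<bar>bubble_deriv k \<gamma> r\<bar> powr p * r ^ (n - 1)))
      = (\<gamma> * k) powr p * (Beta (\<alpha> + 1) (\<beta> - 1) / k)"
    unfolding B integral_mult_right_zero by (subst radB(2)) (use pos in auto)
  also have "Beta (\<alpha> + 1) (\<beta> - 1) = \<alpha> / (\<beta> - 1) * Beta \<alpha> \<beta>"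
  proof -
    have "Gamma (\<alpha> + 1) = \<alpha> * Gamma \<alpha>"
      by (rule Gamma_plus1_pos[OF \<alpha>0])
    moreover have "Gamma (\<beta> - 1 + 1) = (\<beta> - 1) * Gamma (\<beta> - 1)"
      by (rule Gamma_plus1_pos[OF pos(4)])
    ultimately show ?thesis
      using \<beta>1 by (simp add: Beta_def)
  qed
  also have "\<alpha> / (\<beta> - 1) = real n * (p - 1) / (real n - p)"
  proof -
    have "\<alpha> = real n * (p - 1) / p" "\<beta> - 1 = (real n - p) / p"
      using p by (simp_all add: \<alpha>_def \<beta>_def field_simps)
    then show ?thesis
      using p by simp
  qed
  also have "\<gamma> * k = (real n - p) / (p - 1)"
    using p by (simp add: \<gamma>_def k_def)
  finally show "(LINT r|lborel. indicator {0<..} r * (\<bar>bubble_deriv k \<gamma> r\<bar> powr p * r ^ (n - 1)))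
       = ((real n - p) / (p - 1)) powr p * (real n * (p - 1) / (real n - p)) * I"
    by (simp flip: I)
qed

lemma truncated_bubble:
  fixes k \<gamma> \<eta> :: real
  assumes k: "k > 1" and \<gamma>: "\<gamma> > 0" and \<eta>: "\<eta> > 0"
  defines "h \<equiv> \<lambda>r. soft_cut \<eta> (bubble k \<gamma> r)"
    and "h' \<equiv> \<lambda>r. soft_cut_deriv \<eta> (bubble k \<gamma> r) * bubble_deriv k \<gamma> r"
    and "R \<equiv> (\<eta> powr (- 1 / \<gamma>)) powr (1 / k)"
  shows "(h has_real_derivative h' r) (at r)"
    and "0 \<le> h r" "h r \<le> bubble k \<gamma> r" "\<bar>h' r\<bar> \<le> \<bar>bubble_deriv k \<gamma> r\<bar>"
    and "h' 0 = 0" "h' \<in> borel_measurable borel" "continuous_on UNIV (\<lambda>r. \<bar>h' r\<bar>)"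
    and "R > 0" "r \<ge> R \<Longrightarrow> h r = 0" "r \<ge> R \<Longrightarrow> h' r = 0"
proof -
  have w: "bubble k \<gamma> r > 0" for r
    by (rule bubble_pos)
  show "(h has_real_derivative h' r) (at r)"
    unfolding h_def h'_def by (rule DERIV_chain2[OF soft_cut_has_derivative[OF w] bubble_has_derivative[OF k]])
  show "0 \<le> h r" "h r \<le> bubble k \<gamma> r"
    unfolding h_def by (rule soft_cut_bounds[OF w \<eta>])+
  have d: "0 \<le> soft_cut_deriv \<eta> (bubble k \<gamma> r)" "soft_cut_deriv \<eta> (bubble k \<gamma> r) \<le> 1" for r
    by (rule soft_cut_bounds[OF w \<eta>])+
  show "\<bar>h' r\<bar> \<le> \<bar>bubble_deriv k \<gamma> r\<bar>"
    unfolding h'_def abs_mult using d[of r] by (intro mult_left_le_one_le) auto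
  show "h' 0 = 0"
    by (simp add: h'_def bubble_deriv_def)
  have contd: "continuous_on UNIV (\<lambda>r. soft_cut_deriv \<eta> (bubble k \<gamma> r))"
    using k by (intro continuous_on_compose2[OF continuous_soft_cut(2) continuous_bubble]) (auto simp: w)
  show "h' \<in> borel_measurable borel"
    unfolding h'_def bubble_deriv_def[abs_def]
    using borel_measurable_continuous_onI[OF contd] by measurable
  have "\<bar>h' r\<bar> = soft_cut_deriv \<eta> (bubble k \<gamma> r) * \<bar>bubble_deriv k \<gamma> r\<bar>" for r
    using d[of r] by (simp add: h'_def abs_mult)
  then show "continuous_on UNIV (\<lambda>r. \<bar>h' r\<bar>)"
    by (simp add: continuous_on_mult contd continuous_abs_bubble_deriv k \<gamma>)
  show "R > 0"
    using \<eta> by (simp add: R_def)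
  show "h r = 0" "h' r = 0" if "r \<ge> R"
    using bubble_le[of k \<gamma> \<eta> r] that k \<gamma> \<eta> by (simp_all add: R_def h_def h'_def soft_cut_eq_0)
qed

section \<open>Sums of bubbles as test functions\<close>

lemma sum_at_most_one_nonzero:
  fixes f :: "'k::finite \<Rightarrow> 'a::real_vector" and F :: "'a \<Rightarrow> 'b::real_vector"
  assumes one: "\<And>k l. f k \<noteq> 0 \<Longrightarrow> f l \<noteq> 0 \<Longrightarrow> k = l" and F: "F 0 = 0"
  shows "F (\<Sum>k\<in>UNIV. f k) = (\<Sum>k\<in>UNIV. F (f k))"
proof (cases "\<exists>k. f k \<noteq> 0")
  case True
  then obtain k where k: "f k \<noteq> 0" by blast
  then have z: "f l = 0" if "l \<noteq> k" for l
    using one that by blast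
  then show ?thesis
    by (simp add: sum.remove[of UNIV k] F)
next
  case False
  then show ?thesis by (simp add: F)
qed

text \<open>
  At the centre, where the norm is not differentiable, \<open>h' 0 = 0\<close> is needed; there \<open>sgn 0 = 0\<close> gives the
  right value of the gradient.
\<close>

lemma radial_has_derivative:
  fixes v :: "'a::euclidean_space"
  assumes h: "\<And>r. (h has_real_derivative h' r) (at r)" and h0: "h' 0 = 0" and \<rho>: "\<rho> > 0"
  shows "((\<lambda>x. h (\<rho> * norm (x - v))) has_derivative
     (\<lambda>y. ((\<rho> * h' (\<rho> * norm (x - v))) *\<^sub>R sgn (x - v)) \<bullet> y)) (at x)"
proof (cases "x = v")
  case False
  have "((\<lambda>x. x - v) has_derivative (\<lambda>y. y)) (at x)"
    by (auto intro!: derivative_eq_intros)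
  moreover have "(norm has_derivative (\<lambda>y. y \<bullet> sgn (x - v))) (at (x - v))"
    using False by (intro has_derivative_norm) simp
  ultimately have "((\<lambda>x. norm (x - v)) has_derivative (\<lambda>y. y \<bullet> sgn (x - v))) (at x)"
    by (rule has_derivative_compose)
  then have 1: "((\<lambda>x. \<rho> * norm (x - v)) has_derivative (\<lambda>y. \<rho> * (y \<bullet> sgn (x - v)))) (at x)"
    by (rule has_derivative_mult_right)
  have "((\<lambda>x. h (\<rho> * norm (x - v))) has_derivative
      (\<lambda>y. h' (\<rho> * norm (x - v)) * (\<rho> * (y \<bullet> sgn (x - v))))) (at x)"
    using has_derivative_compose[OF 1 h[unfolded has_field_derivative_def]] by simp
  then show ?thesis
    by (simp add: mult_ac inner_commute)
next
  case True
  have lim: "((\<lambda>z. (h z - h 0) / z) \<longlongrightarrow> 0) (at 0)"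
    using h[of 0] h0 by (simp add: DERIV_def)
  have "((\<lambda>y. \<rho> * norm (y - v)) \<longlongrightarrow> \<rho> * norm (v - v)) (at v)"
    by (intro tendsto_intros)
  then have "filterlim (\<lambda>y. \<rho> * norm (y - v)) (at 0) (at v)"
    using \<rho> by (auto simp: filterlim_at eventually_at_filter)
  from filterlim_compose[OF lim this]
  have "((\<lambda>y. \<rho> * ((h (\<rho> * norm (y - v)) - h 0) / (\<rho> * norm (y - v)))) \<longlongrightarrow> \<rho> * 0) (at v)"
    by (intro tendsto_intros)
  then have "((\<lambda>y. (h (\<rho> * norm (y - v)) - h 0) / norm (y - v)) \<longlongrightarrow> 0) (at v)"
    using \<rho> by simp
  then have "((\<lambda>y. norm ((h (\<rho> * norm (y - v)) - h 0) / norm (y - v))) \<longlongrightarrow> 0) (at v)"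
    by (rule tendsto_norm_zero)
  then have "((\<lambda>x. h (\<rho> * norm (x - v))) has_derivative (\<lambda>y. 0)) (at v)"
    by (simp add: has_derivative_iff_norm norm_divide)
  then show ?thesis
    using True by simp
qed

text \<open>
  The weak gradient is the tangential part of the Euclidean gradient \<open>g\<close>.
\<close>

lemma sobolev_gradient_C1:
  fixes u :: "real^'m \<Rightarrow> real"
  assumes p: "p > 0"
    and u: "\<And>x. (u has_derivative (\<lambda>h. g x \<bullet> h)) (at x)"
    and g: "g \<in> borel_measurable borel" "\<And>x. norm x = 1 \<Longrightarrow> norm (g x) \<le> M"
  defines "G \<equiv> \<lambda>x. g x - (g x \<bullet> x) *\<^sub>R x"
  shows "sobolev_gradient p u G"
    and "(LINT x|sphere_measure. norm (G x) powr p) \<le> (LINT x|sphere_measure. norm (g x) powr p)"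
proof -
  have contu: "continuous_on UNIV u"
    by (intro continuous_at_imp_continuous_on ballI has_derivative_continuous[OF u])
  have Gm: "G \<in> borel_measurable borel"
    unfolding G_def using g(1) by measurable
  have Gg: "norm (G x) \<le> norm (g x)" if x: "norm x = 1" for x
  proof -
    have "(norm (G x))\<^sup>2 = (norm (g x))\<^sup>2 - (g x \<bullet> x)\<^sup>2"
      using x unfolding G_def power2_norm_eq_inner
      by (simp add: norm_eq_1 inner_diff_left inner_diff_right inner_commute power2_eq_square)
    then have "(norm (G x))\<^sup>2 \<le> (norm (g x))\<^sup>2"
      by simp
    then show ?thesis
      by (rule power2_le_imp_le) simp
  qed
  have int: "integrable sphere_measure (\<lambda>x. norm (f x) powr p)"
    if "f \<in> borel_measurable borel" "\<And>x. norm x = 1 \<Longrightarrow> norm (f x) \<le> M" for f :: "real^'m \<Rightarrow> real^'m"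
  proof (rule integrable_sphere_measure_bounded)
    show "(\<lambda>x. norm (f x) powr p) \<in> borel_measurable borel"
      using that(1) by measurable
    show "norm (norm (f x) powr p) \<le> M powr p" if "norm x = 1" for x
      using p \<open>\<And>x. norm x = 1 \<Longrightarrow> norm (f x) \<le> M\<close>[OF that] by (simp add: powr_mono2)
  qed
  have int_G: "integrable sphere_measure (\<lambda>x. norm (G x) powr p)"
    by (rule int[OF Gm]) (use Gg g(2) order_trans in blast)
  show "(LINT x|sphere_measure. norm (G x) powr p) \<le> (LINT x|sphere_measure. norm (g x) powr p)"
    using Gg p by (intro integral_mono int_G int g powr_mono2) auto
  have "continuous_on UNIV (\<lambda>x. \<bar>u x\<bar> powr p)"
    using p by (intro continuous_on_powr' continuous_on_rabs contu continuous_on_const) auto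
  then have "u \<in> Lp_space sphere_measure p"
    unfolding Lp_space_def
    by (auto intro: measurable_sphere_measure borel_measurable_continuous_onI contu
        integrable_sphere_measure_continuous)
  moreover have "G \<in> Lp_space sphere_measure p"
    unfolding Lp_space_def using measurable_sphere_measure[OF Gm] int_G by simp
  moreover have "AE x in sphere_measure. x \<bullet> G x = 0"
    by (rule AE_I2) (simp add: G_def inner_diff_right norm_eq_1 inner_commute)
  moreover have "(LINT x|sphere_measure. u x * sphere_div X x) = - (LINT x|sphere_measure. G x \<bullet> X x)"
    if X: "smooth_tangent_field X" for X
  proof -
    have "(LINT x|sphere_measure. G x \<bullet> X x) = (LINT x|sphere_measure. g x \<bullet> X x)"
      using X by (intro Bochner_Integration.integral_cong)
        (auto simp: G_def inner_diff_left smooth_tangent_field_def)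
    then show ?thesis
      using sphere_integration_by_parts[OF u g X] by simp
  qed
  ultimately show "sobolev_gradient p u G"
    unfolding sobolev_gradient_def by blast
qed

lemma Lp_norm_powr:
  assumes "p > 0"
  shows "Lp_norm M q g powr p = (LINT x|M. norm (g x) powr q) powr (p / q)"
  by (simp add: Lp_norm_def powr_powr)

text \<open>
  The Sobolev inequality for sums of scaled copies of \<open>h\<close> around the vertices of the simplex, in the limit of
  infinite scale.
\<close>

lemma simplex_test_inequality:
  fixes p q a b :: real and h h' :: "real \<Rightarrow> real"
  assumes dim: "CARD('m::finite) = n + 1" and p: "1 < p" "p < real n"
    and q: "q = p * real n / (real n - p)"
    and ineq: "\<And>(u :: real ^ 'm \<Rightarrow> real) G.
        sobolev_gradient p u G \<Longrightarrow>
        (\<And>f. f \<in> mean_zero_polynomials_le 2 \<Longrightarrow>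
           (LINT x|sphere_measure. f x * \<bar>u x\<bar> powr q) = 0) \<Longrightarrow>
        Lp_norm sphere_measure q u powr p
          \<le> a * Lp_norm sphere_measure p G powr p + b * Lp_norm sphere_measure p u powr p"
    and h: "\<And>r. (h has_real_derivative h' r) (at r)" "\<And>r. 0 \<le> h r"
    and h': "h' 0 = 0" "h' \<in> borel_measurable borel" "continuous_on UNIV (\<lambda>r. \<bar>h' r\<bar>)"
    and R: "R > 0" "\<And>r. r \<ge> R \<Longrightarrow> h r = 0" "\<And>r. r \<ge> R \<Longrightarrow> h' r = 0"
  defines "N \<equiv> real n + 2" and "\<omega> \<equiv> real n * unit_ball_vol n"
  shows "(N * (\<omega> * (LINT r|lborel. indicator {0<..} r * (h r powr q * r ^ (n - 1))))) powr (p / q)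
    \<le> max a 0 * (N * (\<omega> * (LINT r|lborel. indicator {0<..} r * (\<bar>h' r\<bar> powr p * r ^ (n - 1)))))"
proof -
  have n: "n > 0" and q0: "q > 0" and np: "real n - p > 0" and pq: "real n * (p / q) = real n - p"
    using p by (auto simp: q)
  have m: "CARD('m) > 1"
    using dim n by simp
  have dim': "CARD('m) = Suc n"
    using dim by simp
  let ?V = "simplex_vertex :: 'm option \<Rightarrow> real^'m"
  define v where "v = ?V None"
  have V1: "norm (?V k) = 1" for k
    by (rule norm_simplex_vertex)
  have v1: "norm v = 1"
    unfolding v_def by (rule V1)
  have conth: "continuous_on UNIV h"
    by (rule has_real_derivative_imp_continuous_on) (rule has_field_derivative_at_within[OF h(1)])
  have cont_pow: "continuous_on UNIV (\<lambda>r. h r powr s)" "continuous_on UNIV (\<lambda>r. \<bar>h' r\<bar> powr s)"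
    if "s > 0" for s
    using that h(2) by (intro continuous_on_powr' conth h'(3) continuous_intros; simp)+
  obtain B where B: "B \<ge> 0" "\<And>r. r \<ge> 0 \<Longrightarrow> \<bar>h' r\<bar> \<le> B"
  proof -
    have "\<exists>x\<in>{0..R}. \<forall>y\<in>{0..R}. \<bar>h' y\<bar> \<le> \<bar>h' x\<bar>"
      using R(1) by (intro continuous_attains_sup continuous_on_subset[OF h'(3)]) auto
    then obtain x where x: "\<forall>y\<in>{0..R}. \<bar>h' y\<bar> \<le> \<bar>h' x\<bar>"
      by blast
    have "\<bar>h' r\<bar> \<le> \<bar>h' x\<bar>" if "r \<ge> 0" for r
      using x that R(3)[of r] by (cases "r \<le> R") auto
    then show thesis
      by (intro that[of "\<bar>h' x\<bar>"]) auto
  qed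
  define A where "A j = (LINT x|sphere_measure. h (real (Suc j) * norm (x - v)) powr q)" for j
  define D where "D j = (LINT x|sphere_measure. \<bar>h' (real (Suc j) * norm (x - v))\<bar> powr p)" for j
  define C where "C j = (LINT x|sphere_measure. h (real (Suc j) * norm (x - v)) powr p)" for j
  have nonneg: "A j \<ge> 0" "D j \<ge> 0" "C j \<ge> 0" for j
    unfolding A_def D_def C_def by (auto intro!: integral_nonneg)
  have card: "(\<Sum>k\<in>(UNIV :: 'm option set). c) = N * c" for c :: real
    using dim by (simp add: N_def card_UNIV_option)
  have main: "(N * A j) powr (p / q) \<le> max a 0 * (N * (real (Suc j) powr p * D j)) + b * (N * C j)"
    if j: "real (Suc j) \<ge> 4 * R" for j
  proof -
    define \<rho> where "\<rho> = real (Suc j)"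
    have \<rho>: "\<rho> > 0" "\<rho> \<ge> 4 * R"
      using j by (simp_all add: \<rho>_def)
    define u where "u x = (\<Sum>k\<in>UNIV. h (\<rho> * norm (x - ?V k)))" for x
    define g where "g x = (\<Sum>k\<in>UNIV. (\<rho> * h' (\<rho> * norm (x - ?V k))) *\<^sub>R sgn (x - ?V k))" for x
    define G where "G x = g x - (g x \<bullet> x) *\<^sub>R x" for x
    \<comment> \<open>the vertices are more than \<open>1 / 2\<close> apart, and the bubbles have radius \<open>R / \<rho> \<le> 1 / 4\<close>\<close>
    have disjoint: "k = l" if "\<rho> * norm (x - ?V k) < R" "\<rho> * norm (x - ?V l) < R" for x k l
    proof (rule ccontr)
      assume "k \<noteq> l"
      then have "1 / 2 < norm (?V k - ?V l)"
        by (rule simplex_vertex_separated[OF m])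
      also have "\<dots> \<le> norm (x - ?V k) + norm (x - ?V l)"
        using norm_triangle_ineq4[of "x - ?V l" "x - ?V k"] by simp
      finally have "\<rho> * (1 / 2) < \<rho> * (norm (x - ?V k) + norm (x - ?V l))"
        using \<rho>(1) by (intro mult_strict_left_mono)
      also have "\<dots> < R + R"
        using that by (simp add: distrib_left)
      finally show False
        using \<rho>(2) by simp
    qed
    have small: "\<rho> * norm (x - ?V k) < R"
      if "h (\<rho> * norm (x - ?V k)) \<noteq> 0 \<or> h' (\<rho> * norm (x - ?V k)) \<noteq> 0" for x k
      using that R(2,3)[of "\<rho> * norm (x - ?V k)"] by (meson not_le)
    have u_pow: "\<bar>u x\<bar> powr s = (\<Sum>k\<in>UNIV. h (\<rho> * norm (x - ?V k)) powr s)" for x s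
    proof -
      have "\<bar>u x\<bar> powr s = (\<Sum>k\<in>UNIV. \<bar>h (\<rho> * norm (x - ?V k))\<bar> powr s)"
        unfolding u_def
        by (rule sum_at_most_one_nonzero[where F = "\<lambda>y. \<bar>y\<bar> powr s"]) (use disjoint small in blast, simp)
      then show ?thesis
        using h(2) by simp
    qed
    have g_pow: "norm (g x) powr p \<le> (\<Sum>k\<in>UNIV. \<rho> powr p * \<bar>h' (\<rho> * norm (x - ?V k))\<bar> powr p)" for x
    proof -
      have "norm (g x) powr p = (\<Sum>k\<in>UNIV. norm ((\<rho> * h' (\<rho> * norm (x - ?V k))) *\<^sub>R sgn (x - ?V k)) powr p)"
        unfolding g_def
        by (rule sum_at_most_one_nonzero[where F = "\<lambda>y. norm y powr p"])
           (use disjoint small in \<open>metis mult_zero_right scaleR_zero_left\<close>, simp)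
      also have "\<dots> \<le> (\<Sum>k\<in>UNIV. (\<rho> * \<bar>h' (\<rho> * norm (x - ?V k))\<bar>) powr p)"
        using p \<rho>(1) by (intro sum_mono powr_mono2) (auto simp: norm_sgn abs_mult)
      also have "\<dots> = (\<Sum>k\<in>UNIV. \<rho> powr p * \<bar>h' (\<rho> * norm (x - ?V k))\<bar> powr p)"
        using \<rho>(1) by (simp add: powr_mult)
      finally show ?thesis .
    qed
    have der: "(u has_derivative (\<lambda>y. g x \<bullet> y)) (at x)" for x
      unfolding u_def[abs_def] g_def inner_sum_left
      by (intro has_derivative_sum radial_has_derivative h h' \<rho>)
    have gm: "g \<in> borel_measurable borel"
    proof -
      have [measurable]: "(sgn :: real^'m \<Rightarrow> _) \<in> borel_measurable borel"
        unfolding sgn_div_norm[abs_def] by measurable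
      show ?thesis
        unfolding g_def[abs_def] using h'(2) by measurable
    qed
    have g_bound: "norm (g x) \<le> (\<Sum>k\<in>(UNIV :: 'm option set). \<rho> * B)" for x
      unfolding g_def
    proof (rule sum_norm_le)
      fix k :: "'m option"
      have "norm (sgn (x - ?V k)) \<le> 1"
        by (simp add: norm_sgn)
      moreover have "\<bar>h' (\<rho> * norm (x - ?V k))\<bar> \<le> B"
        using \<rho>(1) by (intro B(2)) simp
      ultimately have "(\<rho> * \<bar>h' (\<rho> * norm (x - ?V k))\<bar>) * norm (sgn (x - ?V k)) \<le> (\<rho> * B) * 1"
        using \<rho>(1) B(1) by (intro mult_mono mult_left_mono) auto
      then show "norm ((\<rho> * h' (\<rho> * norm (x - ?V k))) *\<^sub>R sgn (x - ?V k)) \<le> \<rho> * B"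
        using \<rho>(1) by (simp add: abs_mult)
    qed
    have p0: "p > 0" using p by simp
    note sob = sobolev_gradient_C1[OF p0 der gm g_bound, folded G_def]
    have contK: "continuous_on UNIV (\<lambda>r. h (\<rho> * r) powr q)"
      by (rule continuous_on_compose2[OF cont_pow(1)[OF q0]]) (auto intro!: continuous_intros)
    have contp: "continuous_on UNIV (\<lambda>r. h (\<rho> * r) powr p)" "continuous_on UNIV (\<lambda>r. \<bar>h' (\<rho> * r)\<bar> powr p)"
      by (rule continuous_on_compose2[OF cont_pow(1)[OF p0]] continuous_on_compose2[OF cont_pow(2)[OF p0]];
          force intro!: continuous_intros)+
    have sum_int: "(LINT x|sphere_measure. (\<Sum>k\<in>UNIV. \<Phi> (norm (x - ?V k)))) = N * (LINT x|sphere_measure. \<Phi> (norm (x - v)))"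
      "integrable sphere_measure (\<lambda>x. \<Sum>k\<in>UNIV. \<Phi> (norm (x - ?V k)))"
      if \<Phi>: "continuous_on UNIV \<Phi>" for \<Phi> :: "real \<Rightarrow> real"
    proof -
      have int: "integrable sphere_measure (\<lambda>x. \<Phi> (norm (x - ?V k)))" for k
        by (intro integrable_sphere_measure_continuous continuous_on_compose2[OF \<Phi>] continuous_intros) auto
      show "integrable sphere_measure (\<lambda>x. \<Sum>k\<in>UNIV. \<Phi> (norm (x - ?V k)))"
        using int by (rule Bochner_Integration.integrable_sum)
      have "(LINT x|sphere_measure. (\<Sum>k\<in>UNIV. \<Phi> (norm (x - ?V k))))
         = (\<Sum>k\<in>UNIV. LINT x|sphere_measure. \<Phi> (norm (x - ?V k)))"
        using int by (rule Bochner_Integration.integral_sum)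
      also have "\<dots> = (\<Sum>k\<in>(UNIV :: 'm option set). LINT x|sphere_measure. \<Phi> (norm (x - v)))"
        by (intro sum.cong refl integral_sphere_radial_rotation V1 v1 \<Phi>)
      finally show "(LINT x|sphere_measure. (\<Sum>k\<in>UNIV. \<Phi> (norm (x - ?V k)))) = N * (LINT x|sphere_measure. \<Phi> (norm (x - v)))"
        unfolding card .
    qed
    have moment: "(LINT x|sphere_measure. f x * \<bar>u x\<bar> powr q) = 0" if f: "f \<in> mean_zero_polynomials_le 2" for f
      using simplex_quadrature[OF contK m, of f] f unfolding u_pow by (simp add: mean_zero_polynomials_le_def)
    have "Lp_norm sphere_measure q u powr p
          \<le> a * Lp_norm sphere_measure p G powr p + b * Lp_norm sphere_measure p u powr p"
      by (rule ineq[OF sob(1) moment])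
    moreover have "Lp_norm sphere_measure q u powr p = (N * A j) powr (p / q)"
      unfolding Lp_norm_powr[OF p0] real_norm_def u_pow sum_int(1)[OF contK]
      unfolding A_def \<rho>_def ..
    moreover have "Lp_norm sphere_measure p u powr p = N * C j"
    proof -
      have "(LINT x|sphere_measure. h (\<rho> * norm (x - v)) powr p) = C j"
        unfolding C_def \<rho>_def ..
      then show ?thesis
        unfolding Lp_norm_powr[OF p0] real_norm_def u_pow sum_int(1)[OF contp(1)]
        using p0 nonneg(3)[of j] by (simp add: N_def)
    qed
    moreover have "a * Lp_norm sphere_measure p G powr p \<le> max a 0 * (N * (\<rho> powr p * D j))"
    proof (rule mult_mono)
      have cont2: "continuous_on UNIV (\<lambda>r. \<rho> powr p * \<bar>h' (\<rho> * r)\<bar> powr p)"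
        by (intro continuous_on_mult continuous_on_const contp)
      have "(LINT x|sphere_measure. norm (G x) powr p) \<le> (LINT x|sphere_measure. norm (g x) powr p)"
        by (rule sob(2))
      also have "\<dots> \<le> (LINT x|sphere_measure. (\<Sum>k\<in>UNIV. \<rho> powr p * \<bar>h' (\<rho> * norm (x - ?V k))\<bar> powr p))"
        by (rule integral_mono'[OF sum_int(2)[OF cont2] g_pow]) (auto intro!: sum_nonneg)
      also have "\<dots> = N * (\<rho> powr p * D j)"
        unfolding sum_int(1)[OF cont2] by (simp add: D_def \<rho>_def)
      finally show "Lp_norm sphere_measure p G powr p \<le> N * (\<rho> powr p * D j)"
        unfolding Lp_norm_powr[OF p0] using p0 by simp
    qed auto
    ultimately show ?thesis
      unfolding \<rho>_def by simp
  qed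
  have lim: "(\<lambda>j. real (Suc j) ^ n * A j) \<longlonglongrightarrow> \<omega> * (LINT r|lborel. indicator {0<..} r * (h r powr q * r ^ (n - 1)))"
    "(\<lambda>j. real (Suc j) ^ n * D j) \<longlonglongrightarrow> \<omega> * (LINT r|lborel. indicator {0<..} r * (\<bar>h' r\<bar> powr p * r ^ (n - 1)))"
    "(\<lambda>j. real (Suc j) ^ n * C j) \<longlonglongrightarrow> \<omega> * (LINT r|lborel. indicator {0<..} r * (h r powr p * r ^ (n - 1)))"
    unfolding A_def D_def C_def \<omega>_def using p q0 R
    by (intro sphere_concentration[where R = R] v1 dim' n cont_pow; simp)+
  \<comment> \<open>multiply by \<open>\<rho> powr (n - p)\<close>, which is \<open>(\<rho> ^ n) powr (p / q)\<close>\<close>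
  have scaled: "(N * (real (Suc j) ^ n * A j)) powr (p / q)
      \<le> max a 0 * (N * (real (Suc j) ^ n * D j)) + b * (N * (real (Suc j) powr (- p) * (real (Suc j) ^ n * C j)))"
    if j: "real (Suc j) \<ge> 4 * R" for j
  proof -
    define \<rho> where "\<rho> = real (Suc j)"
    have \<rho>: "\<rho> > 0" by (simp add: \<rho>_def)
    have pw: "\<rho> ^ n = \<rho> powr real n"
      using \<rho> by (simp add: powr_realpow)
    have "(N * (\<rho> ^ n * A j)) powr (p / q) = (\<rho> powr real n * (N * A j)) powr (p / q)"
      unfolding pw by (simp add: mult_ac)
    also have "\<dots> = \<rho> powr (real n - p) * (N * A j) powr (p / q)"
    proof -
      have "(\<rho> powr real n) powr (p / q) = \<rho> powr (real n - p)"
        unfolding powr_powr pq ..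
      then show ?thesis
        using nonneg(1)[of j] by (simp add: powr_mult N_def)
    qed
    also have "\<dots> \<le> \<rho> powr (real n - p) * (max a 0 * (N * (\<rho> powr p * D j)) + b * (N * C j))"
      using main[OF j] by (intro mult_left_mono) (simp_all add: \<rho>_def)
    also have "\<dots> = max a 0 * (N * ((\<rho> powr (real n - p) * \<rho> powr p) * D j)) + b * (N * (\<rho> powr (real n - p) * C j))"
      by (simp add: algebra_simps)
    also have "\<rho> powr (real n - p) * \<rho> powr p = \<rho> ^ n"
      unfolding pw by (simp flip: powr_add)
    also have "\<rho> powr (real n - p) = \<rho> powr (- p) * \<rho> ^ n"
      unfolding pw by (simp flip: powr_add)
    finally show ?thesis
      unfolding \<rho>_def by (simp add: mult.assoc)
  qed
  have pow0: "(\<lambda>j. real (Suc j) powr (- p)) \<longlonglongrightarrow> 0"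
    using p by (intro LIMSEQ_Suc[OF tendsto_neg_powr] filterlim_real_sequentially) auto
  obtain j0 :: nat where j0: "real j0 \<ge> 4 * R"
    using real_arch_simple by blast
  show ?thesis
  proof (rule LIMSEQ_le)
    show "(\<lambda>j. (N * (real (Suc j) ^ n * A j)) powr (p / q)) \<longlonglongrightarrow>
       (N * (\<omega> * (LINT r|lborel. indicator {0<..} r * (h r powr q * r ^ (n - 1))))) powr (p / q)"
      using p q0 nonneg(1) by (intro tendsto_powr' tendsto_intros lim) (auto simp: N_def)
    have "(\<lambda>j. max a 0 * (N * (real (Suc j) ^ n * D j)) + b * (N * (real (Suc j) powr (- p) * (real (Suc j) ^ n * C j))))
      \<longlonglongrightarrow> max a 0 * (N * (\<omega> * (LINT r|lborel. indicator {0<..} r * (\<bar>h' r\<bar> powr p * r ^ (n - 1)))))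
         + b * (N * (0 * (\<omega> * (LINT r|lborel. indicator {0<..} r * (h r powr p * r ^ (n - 1))))))"
      by (intro tendsto_intros lim pow0)
    then show "(\<lambda>j. max a 0 * (N * (real (Suc j) ^ n * D j)) + b * (N * (real (Suc j) powr (- p) * (real (Suc j) ^ n * C j))))
      \<longlonglongrightarrow> max a 0 * (N * (\<omega> * (LINT r|lborel. indicator {0<..} r * (\<bar>h' r\<bar> powr p * r ^ (n - 1)))))"
      by simp
    show "\<exists>j1. \<forall>j\<ge>j1. (N * (real (Suc j) ^ n * A j)) powr (p / q)
      \<le> max a 0 * (N * (real (Suc j) ^ n * D j)) + b * (N * (real (Suc j) powr (- p) * (real (Suc j) ^ n * C j)))"
    proof (intro exI[of _ j0] allI impI scaled)
      fix j assume "j0 \<le> j"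
      then have "real j0 \<le> real (Suc j)"
        by simp
      then show "4 * R \<le> real (Suc j)"
        using j0 by linarith
    qed
  qed
qed

section \<open>The lower bound\<close>

theorem lemma4p1:
  fixes n :: nat and p q a b S :: real
  assumes dim_sub: "CARD('k::finite) = n"
    and dim: "CARD('m::finite) = n + 1"
    and p: "1 < p" "p < real n"
    and q: "q = p * real n / (real n - p)"
    and S: "S = 1 / real n * (real n * (p - 1) / (real n - p)) powr (1 - 1 / p)
              * (fact n / (Gamma (real n / p) * Gamma (real n + 1 - real n / p)
                   * measure (sphere_measure :: (real ^ 'k) measure) (sphere 0 1))) powr (1 / real n)"
    and ineq: "\<And>(u :: real ^ 'm \<Rightarrow> real) G.
        sobolev_gradient p u G \<Longrightarrow>
        (\<And>f. f \<in> mean_zero_polynomials_le 2 \<Longrightarrow>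
           (LINT x|sphere_measure. f x * \<bar>u x\<bar> powr q) = 0) \<Longrightarrow>
        Lp_norm sphere_measure q u powr p
          \<le> a * Lp_norm sphere_measure p G powr p + b * Lp_norm sphere_measure p u powr p"
  shows "a \<ge> S powr p / (real n + 2) powr (p / real n)"
proof -
  define k \<gamma> where "k = p / (p - 1)" and "\<gamma> = (real n - p) / p"
  define I where "I = Gamma (real n / p) * Gamma (real n + 1 - real n / p) / fact n"
  define N \<omega> where "N = real n + 2" and "\<omega> = real n * unit_ball_vol n"
  define x where "x = (p - 1) / (real n - p)"
  have n0: "real n > 0" and np: "real n - p > 0"
    using p by linarith+
  have k: "k > 1" and \<gamma>: "\<gamma> > 0" and q0: "q > 0" and x: "x > 0" and N: "N > 0" and \<omega>: "\<omega> > 0"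
    using p n0 by (simp_all add: k_def \<gamma>_def q x_def N_def \<omega>_def)
  have \<omega>_meas: "measure (sphere_measure :: (real ^ 'k) measure) (sphere 0 1) = \<omega>"
    by (simp add: measure_sphere dim_sub \<omega>_def)
  have I: "I > 0"
  proof -
    have "real n / p < real n * 1"
      using p n0 by (simp add: divide_less_eq)
    then show ?thesis
      unfolding I_def using p by (intro divide_pos_pos mult_pos_pos Gamma_real_pos) auto
  qed
  note bub = integral_bubble[OF p, folded k_def \<gamma>_def q I_def]
  define J where "J = ((real n - p) / (p - 1)) powr p * (real n * (p - 1) / (real n - p)) * I"
  define \<eta> where "\<eta> i = inverse (real (Suc i))" for i
  have \<eta>: "\<eta> i > 0" for i
    by (simp add: \<eta>_def)
  define h where "h i r = soft_cut (\<eta> i) (bubble k \<gamma> r)" for i r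
  define h' where "h' i r = soft_cut_deriv (\<eta> i) (bubble k \<gamma> r) * bubble_deriv k \<gamma> r" for i r
  note trunc = truncated_bubble[OF k \<gamma> \<eta>, folded h_def h'_def]
  define I' where "I' i = (LINT r|lborel. indicator {0<..} r * (h i r powr q * r ^ (n - 1)))" for i
  \<comment> \<open>the truncation does not increase the gradient\<close>
  have test: "(N * (\<omega> * I' i)) powr (p / q) \<le> max a 0 * (N * (\<omega> * J))" for i
  proof -
    have "(N * (\<omega> * I' i)) powr (p / q)
        \<le> max a 0 * (N * (\<omega> * (LINT r|lborel. indicator {0<..} r * (\<bar>h' i r\<bar> powr p * r ^ (n - 1)))))"
      unfolding I'_def N_def \<omega>_def
      by (rule simplex_test_inequality[OF dim p q ineq trunc(1,2,5,6,7,8,9,10)])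
    also have "\<dots> \<le> max a 0 * (N * (\<omega> * J))"
    proof (intro mult_left_mono)
      show "(LINT r|lborel. indicator {0<..} r * (\<bar>h' i r\<bar> powr p * r ^ (n - 1))) \<le> J"
        unfolding J_def bub(4)[symmetric]
      proof (rule integral_mono'[OF bub(3)])
        show "indicator {0<..} r * (\<bar>h' i r\<bar> powr p * r ^ (n - 1))
            \<le> indicator {0<..} r * (\<bar>bubble_deriv k \<gamma> r\<bar> powr p * r ^ (n - 1))" for r
        proof (cases "r > 0")
          case True
          then show ?thesis
            using trunc(4)[of i r] p by (simp add: mult_right_mono powr_mono2)
        qed simp
      qed (simp add: indicator_def)
    qed (use N \<omega> in auto)
    finally show ?thesis .
  qed
  have "(\<lambda>i. I' i) \<longlonglongrightarrow> I"
    unfolding I'_def bub(2)[symmetric]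
  proof (rule integral_dominated_convergence[OF _ _ bub(1)])
    have [measurable]: "bubble k \<gamma> \<in> borel_measurable borel"
      using k by (intro borel_measurable_continuous_onI continuous_bubble) simp
    have [measurable]: "h i \<in> borel_measurable borel" for i
      by (intro borel_measurable_continuous_onI continuous_at_imp_continuous_on ballI DERIV_isCont[OF trunc(1)])
    show "(\<lambda>r. indicator {0<..} r * (bubble k \<gamma> r powr q * r ^ (n - 1))) \<in> borel_measurable lborel"
      by measurable
    show "(\<lambda>r. indicator {0<..} r * (h i r powr q * r ^ (n - 1))) \<in> borel_measurable lborel" for i
      by measurable
    have \<eta>0: "\<eta> \<longlonglongrightarrow> 0"
      unfolding \<eta>_def[abs_def] by (rule LIMSEQ_inverse_real_of_nat)
    have "(\<lambda>i. h i r) \<longlonglongrightarrow> bubble k \<gamma> r" for r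
      unfolding h_def by (rule soft_cut_tendsto[OF bubble_pos \<eta>0])
    then show "AE r in lborel. (\<lambda>i. indicator {0<..} r * (h i r powr q * r ^ (n - 1)))
        \<longlonglongrightarrow> indicator {0<..} r * (bubble k \<gamma> r powr q * r ^ (n - 1))"
      using bubble_pos[of k \<gamma>] by (intro AE_I2 tendsto_intros) (auto simp: less_imp_neq[symmetric])
    show "AE r in lborel. norm (indicator {0<..} r * (h i r powr q * r ^ (n - 1)))
        \<le> indicator {0<..} r * (bubble k \<gamma> r powr q * r ^ (n - 1))" for i
      using trunc(2,3) q0 by (intro AE_I2) (auto simp: indicator_def intro!: mult_right_mono powr_mono2)
  qed
  then have "(\<lambda>i. (N * (\<omega> * I' i)) powr (p / q)) \<longlonglongrightarrow> (N * (\<omega> * I)) powr (p / q)"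
    using N \<omega> I by (intro tendsto_intros) auto
  then have limit: "(N * (\<omega> * I)) powr (p / q) \<le> max a 0 * (N * (\<omega> * J))"
    by (rule LIMSEQ_le_const2) (use test in blast)
  \<comment> \<open>cancel the factor \<open>M\<close> common to both sides, using \<open>p / q = 1 - p / n\<close>\<close>
  define M where "M = N * (\<omega> * I)"
  have M: "M > 0"
    using N \<omega> I by (simp add: M_def)
  have J: "J = real n * x * I / x powr p"
  proof -
    have "((real n - p) / (p - 1)) powr p = 1 / x powr p"
      using p by (simp add: x_def powr_divide)
    then show ?thesis
      by (simp add: J_def x_def)
  qed
  have pq: "p / q = 1 + - (p / real n)"
    using p n0 by (simp add: q field_simps)
  have "M * M powr (- (p / real n)) = M powr (p / q)"
    unfolding pq powr_add using M by simp
  also have "\<dots> \<le> max a 0 * (N * (\<omega> * J))"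
    using limit by (simp add: M_def)
  also have "\<dots> = M * (max a 0 * (real n * x / x powr p))"
    by (simp add: J M_def)
  finally have le: "M powr (- (p / real n)) \<le> max a 0 * (real n * x / x powr p)"
    by (rule mult_left_le_imp_le[OF _ M])
  have "S powr p = (1 / real n) powr p * (real n * x) powr (p - 1) * (1 / (\<omega> * I)) powr (p / real n)"
  proof -
    define c Y Z where "c = 1 / real n" and "Y = real n * x" and "Z = 1 / (\<omega> * I)"
    have "c \<ge> 0" "Y \<ge> 0" "Z \<ge> 0"
      using x I \<omega> by (simp_all add: c_def Y_def Z_def)
    moreover have "S = c * Y powr (1 - 1 / p) * Z powr (1 / real n)"
      unfolding S \<omega>_meas by (simp add: c_def Y_def Z_def x_def I_def mult.commute[of \<omega>])
    ultimately have "S powr p = c powr p * (Y powr (1 - 1 / p)) powr p * (Z powr (1 / real n)) powr p"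
      by (simp add: powr_mult)
    also have "(Y powr (1 - 1 / p)) powr p = Y powr (p - 1)"
      using p by (simp add: powr_powr left_diff_distrib)
    also have "(Z powr (1 / real n)) powr p = Z powr (p / real n)"
      by (simp add: powr_powr)
    finally show ?thesis
      by (simp only: c_def Y_def Z_def)
  qed
  also have "(1 / real n) powr p * (real n * x) powr (p - 1) = x powr p / (real n * x)"
    using n0 x by (simp add: powr_mult powr_diff powr_divide field_simps)
  finally have "S powr p / N powr (p / real n) = x powr p / (real n * x) * M powr (- (p / real n))"
    using N \<omega> I by (simp add: M_def powr_minus powr_divide powr_mult field_simps)
  also have "\<dots> \<le> x powr p / (real n * x) * (max a 0 * (real n * x / x powr p))"
    using le n0 x by (intro mult_left_mono) auto
  also have "\<dots> = max a 0"
    using n0 x by simp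
  finally have "S powr p / N powr (p / real n) \<le> max a 0" .
  \<comment> \<open>the bound is positive, so \<open>max a 0\<close> is \<open>a\<close>\<close>
  moreover have "S powr p / N powr (p / real n) > 0"
    using \<open>S powr p / N powr (p / real n) = x powr p / (real n * x) * M powr (- (p / real n))\<close> M x n0 by simp
  ultimately show ?thesis
    unfolding N_def by linarith
qed

end
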